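(* Let $F\colon\Sigma_k\times\mathbb S^1\to\Sigma_k\times\mathbb S^1$ be a transitive step skew-product map whose fiber maps are $C^1$ diffeomorphisms of $\mathbb S^1$, and assume that $F$ satisfies Axioms CEC$\pm$ and Acc$\pm$. Then the intersection of the closed convex hull of the set of ergodic measures with negative fiber exponent and the closed convex hull of the set of ergodic measures with positive fiber exponent is non-empty and contains all ergodic measures with zero fiber exponent.
   Context: Setting. Let $k\ge 2$, let $\Sigma_k=\{0,\dots,k-1\}^{\mathbb Z}$ with the left shift $\sigma$, and $\mathbb S^1=\mathbb R/\mathbb Z$. Given $C^1$ diffeomorphisms $f_0,\dots,f_{k-1}$ of $\mathbb S^1$ (the fiber maps), the associated step skew-product is $F(\xi,x)=(\sigma(\xi),f_{\xi_0}(x))$. $F$ is transitive if for all nonempty open $U,V\subset\Sigma_k\times\mathbb S^1$ there is $n\ge1$ with $F^n(U)\cap V\neq\emptyset$. For a finite word put $f_{[\xi_0\ldots\xi_n]}=f_{\xi_n}\circ\cdots\circ f_{\xi_0}$. $|H|$ is the length of an interval $H\subset\mathbb S^1$, and $B(J,r)$ is the open $r$-neighborhood of $J$. Axioms, for a nondegenerate closed interval $J\subset\mathbb S^1$. CEC$+(J)$: there are positive constants $K_1,\dots,K_5$ such that for every interval $H\subset\mathbb S^1$ intersecting $J$ with $|H|<K_1$ there is a finite word $(\eta_0\ldots\eta_{\ell-1})$, with $\ell$ a positive integer, $\ell\le K_2\,|\log|H||+K_3$, such that $f_{[\eta_0\ldots\eta_{\ell-1}]}(H)\supset B(J,K_4)$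 and $\log|(f_{[\eta_0\ldots\eta_{\ell-1}]})'(x)|\ge \ell K_5$ for every $x\in H$. CEC$-(J)$: CEC$+(J)$ holds for the family $\{f_i^{-1}\}$ in place of $\{f_i\}$. Acc$+(J)$: every point of $\mathbb S^1$ lies in $f_{[\theta_0\ldots\theta_{n-1}]}(\operatorname{int}J)$ for some finite word ($n\ge 0$; the empty word gives the identity). Acc$-(J)$: Acc$+(J)$ holds for the family $\{f_i^{-1}\}$. $F$ satisfies Axioms CEC$\pm$ and Acc$\pm$ if there is a closed interval $J$ for which CEC$+(J)$, CEC$-(J)$, Acc$+(J)$, Acc$-(J)$ all hold. Measures. Ergodic measures are ergodic $F$-invariant Borel probability measures $\mu$; the fiber exponent is $\chi(\mu)=\int\log|(f_{\xi_0})'(x)|\,d\mu(\xi,x)$. Closures are taken in the weak$\ast$ topology. *)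

theory Defs
  imports "HOL-Probability.Probability"
begin

quotient_type circle = real / "\<lambda>s t :: real. s - t \<in> \<int>"
  morphisms rep_circle circle_proj
proof (rule equivpI)
  show "reflp (\<lambda>s t :: real. s - t \<in> \<int>)"
    by (simp add: reflp_def)
  show "symp (\<lambda>s t :: real. s - t \<in> \<int>)"
    unfolding symp_def
  proof (intro allI impI)
    fix s t :: real
    assume "s - t \<in> \<int>"
    then have "- (s - t) \<in> \<int>" by (rule Ints_minus)
    then show "t - s \<in> \<int>" by simp
  qed
  show "transp (\<lambda>s t :: real. s - t \<in> \<int>)"
    unfolding transp_def
  proof (intro allI impI)
    fix s t u :: real
    assume "s - t \<in> \<int>" "t - u \<in> \<int>"
    then have "(s - t) + (t - u) \<in> \<int>" by (rule Ints_add)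
    then show "s - u \<in> \<int>" by simp
  qed
qed

lemma circle_proj_eq_iff: "circle_proj s = circle_proj t \<longleftrightarrow> s - t \<in> \<int>"
  using circle.abs_eq_iff by simp

lemma circle_proj_surj: "\<exists>s. circle_proj s = x"
  by (metis Quotient_circle Quotient_abs_rep)

definition dist_to_int :: "real \<Rightarrow> real"
  where "dist_to_int u = \<bar>u - of_int (round u)\<bar>"

lemma dist_to_int_le: "dist_to_int u \<le> \<bar>u - of_int n\<bar>"
  unfolding dist_to_int_def using round_diff_minimal[of u n] by simp

lemma dist_to_int_cong:
  assumes "u - v \<in> \<int>"
  shows "dist_to_int u = dist_to_int v"
proof -
  from assms obtain n where "u - v = of_int n"
    by (rule Ints_cases)
  then have n: "u = v + of_int n"
    by simp
  have "round u = \<lfloor>(v + 1 / 2) + of_int n\<rfloor>"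
    unfolding n round_def by (simp add: algebra_simps)
  then have "round u = round v + n"
    unfolding round_def by (simp only: floor_add_int)
  then show ?thesis
    by (simp add: dist_to_int_def n)
qed

lemma dist_to_int_triangle: "dist_to_int (u + v) \<le> dist_to_int u + dist_to_int v"
proof -
  have "dist_to_int (u + v) \<le> \<bar>(u + v) - of_int (round u + round v)\<bar>"
    by (rule dist_to_int_le)
  also have "\<dots> \<le> dist_to_int u + dist_to_int v"
    unfolding dist_to_int_def by simp
  finally show ?thesis .
qed

lemma dist_to_int_minus: "dist_to_int (- u) = dist_to_int u"
proof (rule antisym)
  have le: "dist_to_int (- w) \<le> dist_to_int w" for w
  proof -
    have "dist_to_int (- w) \<le> \<bar>- w - of_int (- round w)\<bar>"
      by (rule dist_to_int_le)
    then show ?thesis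
      unfolding dist_to_int_def by (simp add: abs_minus_commute)
  qed
  show "dist_to_int (- u) \<le> dist_to_int u" by (rule le)
  show "dist_to_int u \<le> dist_to_int (- u)" using le[of "- u"] by simp
qed

instantiation circle :: metric_space
begin

lift_definition dist_circle :: "circle \<Rightarrow> circle \<Rightarrow> real" is "\<lambda>s t. dist_to_int (s - t)"
proof -
  fix s s' t t' :: real
  assume "s - s' \<in> \<int>" "t - t' \<in> \<int>"
  then have "(s - s') - (t - t') \<in> \<int>"
    by (rule Ints_diff)
  then have "(s - t) - (s' - t') \<in> \<int>"
    by (simp add: algebra_simps)
  then show "dist_to_int (s - t) = dist_to_int (s' - t')"
    by (rule dist_to_int_cong)
qed

definition uniformity_circle :: "(circle \<times> circle) filter"
  where "uniformity_circle = (INF e\<in>{0 <..}. principal {(x, y). dist x y < e})"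

definition open_circle :: "circle set \<Rightarrow> bool"
  where "open_circle U \<longleftrightarrow> (\<forall>x\<in>U. \<forall>\<^sub>F (x', y) in uniformity. x' = x \<longrightarrow> y \<in> U)"

instance
proof
  fix x y z :: circle
  show "dist x y = 0 \<longleftrightarrow> x = y"
  proof transfer
    fix s t :: real
    show "dist_to_int (s - t) = 0 \<longleftrightarrow> s - t \<in> \<int>"
    proof
      assume "dist_to_int (s - t) = 0"
      then have "s - t = of_int (round (s - t))" by (simp add: dist_to_int_def)
      then show "s - t \<in> \<int>" by (metis Ints_of_int)
    next
      assume "s - t \<in> \<int>"
      then have "dist_to_int (s - t) = dist_to_int 0" by (intro dist_to_int_cong) simp
      then show "dist_to_int (s - t) = 0" by (simp add: dist_to_int_def)
    qed
  qed
  show "dist x y \<le> dist x z + dist y z"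
  proof transfer
    fix s t u :: real
    show "dist_to_int (s - t) \<le> dist_to_int (s - u) + dist_to_int (t - u)"
      using dist_to_int_triangle[of "s - u" "u - t"] dist_to_int_minus[of "t - u"] by simp
  qed
qed (simp_all add: uniformity_circle_def open_circle_def)

end

lemma dist_circle_proj: "dist (circle_proj s) (circle_proj t) = dist_to_int (s - t)"
  by (rule dist_circle.abs_eq)

lemma dist_circle_less_iff:
  "dist x y < r \<longleftrightarrow> (\<exists>s t. circle_proj s = x \<and> circle_proj t = y \<and> \<bar>s - t\<bar> < r)"
proof
  assume less: "dist x y < r"
  obtain s t where st: "circle_proj s = x" "circle_proj t = y"
    using circle_proj_surj by metis
  have "circle_proj (t + of_int (round (s - t))) = y"
    using st(2) circle_proj_eq_iff[of "t + of_int (round (s - t))" t] by simp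
  moreover have "\<bar>s - (t + of_int (round (s - t)))\<bar> < r"
    using less unfolding st[symmetric] dist_circle_proj dist_to_int_def by (simp add: algebra_simps)
  ultimately show "\<exists>s t. circle_proj s = x \<and> circle_proj t = y \<and> \<bar>s - t\<bar> < r"
    using st(1) by blast
next
  assume "\<exists>s t. circle_proj s = x \<and> circle_proj t = y \<and> \<bar>s - t\<bar> < r"
  then show "dist x y < r"
    using dist_to_int_le[where n = 0] dist_circle_proj
    by (metis diff_zero le_less_trans of_int_0)
qed

lemma open_circle_iff: "open U \<longleftrightarrow> open (circle_proj -` U)" for U :: "circle set"
proof
  assume U: "open U"
  show "open (circle_proj -` U)"
    unfolding open_dist
  proof
    fix s assume "s \<in> circle_proj -` U"
    then obtain e where e: "e > 0" "\<And>y. dist y (circle_proj s) < e \<Longrightarrow> y \<in> U"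
      using U unfolding open_dist by auto
    have "t \<in> circle_proj -` U" if "dist t s < e" for t
    proof -
      have "dist (circle_proj t) (circle_proj s) < e"
        using that dist_circle_less_iff by (metis dist_real_def)
      then show ?thesis using e(2) by simp
    qed
    then show "\<exists>e>0. \<forall>t. dist t s < e \<longrightarrow> t \<in> circle_proj -` U"
      using e(1) by blast
  qed
next
  assume V: "open (circle_proj -` U)"
  show "open U"
    unfolding open_dist
  proof
    fix x assume x: "x \<in> U"
    obtain s where s: "circle_proj s = x" using circle_proj_surj by blast
    then obtain e where e: "e > 0" "\<And>t. dist t s < e \<Longrightarrow> circle_proj t \<in> U"
      using V x unfolding open_dist by auto
    have "y \<in> U" if y: "dist y x < e" for y
    proof -
      from y obtain t u where tu: "circle_proj t = y" "circle_proj u = x" "\<bar>t - u\<bar> < e"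
        using dist_circle_less_iff by metis
      have "circle_proj (t + (s - u)) = y"
        using tu s circle_proj_eq_iff by (metis add_diff_cancel_left')
      moreover have "dist (t + (s - u)) s < e"
        using tu(3) by (simp add: dist_real_def)
      ultimately show ?thesis using e(2) by metis
    qed
    then show "\<exists>e>0. \<forall>y. dist y x < e \<longrightarrow> y \<in> U"
      using e(1) by blast
  qed
qed

text \<open>Intervals are taken proper and of any kind (open, closed, half-open); they may be
  degenerate.  The length is normalised so that the whole circle has length 1.\<close>

definition circle_interval :: "circle set \<Rightarrow> bool"
  where "circle_interval H \<longleftrightarrow> H \<noteq> UNIV \<and> (\<exists>I. is_interval I \<and> H = circle_proj ` I)"

definition circle_length :: "circle set \<Rightarrow> real"
  where "circle_length H = measure lborel ({0..<1} \<inter> circle_proj -` H)"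

definition circle_nbhd :: "circle set \<Rightarrow> real \<Rightarrow> circle set"
  where "circle_nbhd J r = {y. \<exists>x\<in>J. dist x y < r}"

text \<open>The lift \<open>\<phi>\<close> is only constrained near \<open>t\<close>: differentiability at \<open>t\<close> pins down
  its branch there, so \<open>D\<close> is independent of the choice of \<open>\<phi>\<close> and \<open>t\<close>.\<close>

definition has_circle_deriv :: "(circle \<Rightarrow> circle) \<Rightarrow> real \<Rightarrow> circle \<Rightarrow> bool"
  where "has_circle_deriv f D x \<longleftrightarrow>
    (\<exists>\<phi> t. circle_proj t = x \<and> (\<forall>s. f (circle_proj s) = circle_proj (\<phi> s)) \<and>
      (\<phi> has_real_derivative D) (at t))"

definition circle_deriv :: "(circle \<Rightarrow> circle) \<Rightarrow> circle \<Rightarrow> real"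
  where "circle_deriv f x = (THE D. has_circle_deriv f D x)"

definition circle_C1 :: "(circle \<Rightarrow> circle) \<Rightarrow> bool"
  where "circle_C1 f \<longleftrightarrow>
    (\<forall>x. \<exists>D. has_circle_deriv f D x) \<and> continuous_on UNIV (circle_deriv f)"

definition circle_C1_diffeo :: "(circle \<Rightarrow> circle) \<Rightarrow> bool"
  where "circle_C1_diffeo f \<longleftrightarrow> bij f \<and> circle_C1 f \<and> circle_C1 (inv f)"

definition Sigma_seq :: "nat \<Rightarrow> (int \<Rightarrow> nat) set"
  where "Sigma_seq k = {\<xi>. \<forall>i. \<xi> i < k}"

definition left_shift :: "(int \<Rightarrow> nat) \<Rightarrow> (int \<Rightarrow> nat)"
  where "left_shift \<xi> = (\<lambda>i. \<xi> (i + 1))"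

text \<open>The product topology, with \<open>nat\<close> discrete, is the library's topology
  on \<open>int \<Rightarrow> nat\<close>.\<close>

definition phase_space :: "nat \<Rightarrow> ((int \<Rightarrow> nat) \<times> circle) set"
  where "phase_space k = Sigma_seq k \<times> UNIV"

definition skew_product ::
    "(nat \<Rightarrow> circle \<Rightarrow> circle) \<Rightarrow> (int \<Rightarrow> nat) \<times> circle \<Rightarrow> (int \<Rightarrow> nat) \<times> circle"
  where "skew_product f = (\<lambda>(\<xi>, x). (left_shift \<xi>, f (\<xi> 0) x))"

definition transitive_on :: "'a::topological_space set \<Rightarrow> ('a \<Rightarrow> 'a) \<Rightarrow> bool"
  where "transitive_on X F \<longleftrightarrow>
    (\<forall>U V. openin (top_of_set X) U \<and> openin (top_of_set X) V \<and> U \<noteq> {} \<and> V \<noteq> {} \<longrightarrow>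
      (\<exists>n\<ge>1. (F ^^ n) ` U \<inter> V \<noteq> {}))"

text \<open>\<open>fold f w\<close> applies the letters of \<open>w\<close> from left to right, so that it is
  \<open>f\<^bsub>[w]\<^esub> = f\<^bsub>w\<^sub>n\<^esub> \<circ> \<dots> \<circ> f\<^bsub>w\<^sub>0\<^esub>\<close>.\<close>

abbreviation word_map :: "(nat \<Rightarrow> circle \<Rightarrow> circle) \<Rightarrow> nat list \<Rightarrow> circle \<Rightarrow> circle"
  where "word_map f w \<equiv> fold f w"

definition CEC_plus :: "nat \<Rightarrow> (nat \<Rightarrow> circle \<Rightarrow> circle) \<Rightarrow> circle set \<Rightarrow> bool"
  where "CEC_plus k f J \<longleftrightarrow>
    (\<exists>K1>0. \<exists>K2>0. \<exists>K3>0. \<exists>K4>0. \<exists>K5>0.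
      \<forall>H. circle_interval H \<and> H \<inter> J \<noteq> {} \<and> 0 < circle_length H \<and> circle_length H < K1 \<longrightarrow>
        (\<exists>w. set w \<subseteq> {..<k} \<and> w \<noteq> [] \<and>
          real (length w) \<le> K2 * \<bar>ln (circle_length H)\<bar> + K3 \<and>
          circle_nbhd J K4 \<subseteq> word_map f w ` H \<and>
          (\<forall>x\<in>H. real (length w) * K5 \<le> ln \<bar>circle_deriv (word_map f w) x\<bar>)))"

definition CEC_minus :: "nat \<Rightarrow> (nat \<Rightarrow> circle \<Rightarrow> circle) \<Rightarrow> circle set \<Rightarrow> bool"
  where "CEC_minus k f J \<longleftrightarrow> CEC_plus k (\<lambda>i. inv (f i)) J"

definition Acc_plus :: "nat \<Rightarrow> (nat \<Rightarrow> circle \<Rightarrow> circle) \<Rightarrow> circle set \<Rightarrow> bool"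
  where "Acc_plus k f J \<longleftrightarrow> (\<forall>x. \<exists>w. set w \<subseteq> {..<k} \<and> x \<in> word_map f w ` interior J)"

definition Acc_minus :: "nat \<Rightarrow> (nat \<Rightarrow> circle \<Rightarrow> circle) \<Rightarrow> circle set \<Rightarrow> bool"
  where "Acc_minus k f J \<longleftrightarrow> Acc_plus k (\<lambda>i. inv (f i)) J"

definition satisfies_axioms :: "nat \<Rightarrow> (nat \<Rightarrow> circle \<Rightarrow> circle) \<Rightarrow> bool"
  where "satisfies_axioms k f \<longleftrightarrow>
    (\<exists>J. circle_interval J \<and> closed J \<and> 0 < circle_length J \<and>
      CEC_plus k f J \<and> CEC_minus k f J \<and> Acc_plus k f J \<and> Acc_minus k f J)"

definition borel_probs :: "'a::topological_space set \<Rightarrow> 'a measure set"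
  where "borel_probs X = {M. prob_space M \<and> sets M = sets (restrict_space borel X)}"

definition ergodic_measures :: "'a::topological_space set \<Rightarrow> ('a \<Rightarrow> 'a) \<Rightarrow> 'a measure set"
  where "ergodic_measures X F = {M \<in> borel_probs X.
    F \<in> measurable M M \<and> distr M M F = M \<and>
    (\<forall>A\<in>sets M. F -` A \<inter> space M = A \<longrightarrow> measure M A = 0 \<or> measure M A = 1)}"

definition fiber_exponent ::
    "(nat \<Rightarrow> circle \<Rightarrow> circle) \<Rightarrow> ((int \<Rightarrow> nat) \<times> circle) measure \<Rightarrow> real"
  where "fiber_exponent f M = (LINT (\<xi>, x)|M. ln \<bar>circle_deriv (f (\<xi> 0)) x\<bar>)"

text \<open>The coarsest topology making \<open>M \<mapsto> \<integral>g dM\<close> continuous for every continuous \<open>g\<close> on \<open>X\<close>.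
  Intended for compact \<open>X\<close>, where every such \<open>g\<close> is bounded.\<close>

definition weak_star :: "'a::topological_space set \<Rightarrow> 'a measure topology"
  where "weak_star X = topology_generated_by
    {{M \<in> borel_probs X. integral\<^sup>L M g \<in> U} | g (U :: real set). continuous_on X g \<and> open U}"

lemma topspace_weak_star: "topspace (weak_star X) = borel_probs X"
proof
  show "topspace (weak_star X) \<subseteq> borel_probs X"
    by (auto simp: weak_star_def)
  have "borel_probs X = {M \<in> borel_probs X. integral\<^sup>L M (\<lambda>_. 0) \<in> (UNIV :: real set)}"
    by simp
  then show "borel_probs X \<subseteq> topspace (weak_star X)"
    unfolding weak_star_def topology_generated_by_topspace
    by (intro Union_upper CollectI exI[of _ "\<lambda>_. 0 :: real"] exI[of _ "UNIV :: real set"]) auto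
qed

definition mix_measure :: "real \<Rightarrow> 'a measure \<Rightarrow> 'a measure \<Rightarrow> 'a measure"
  where "mix_measure t M N = measure_of (space M) (sets M)
    (\<lambda>A. ennreal t * emeasure M A + ennreal (1 - t) * emeasure N A)"

lemma emeasure_mix_measure:
  assumes "sets N = sets M" "A \<in> sets M"
  shows "emeasure (mix_measure t M N) A =
    ennreal t * emeasure M A + ennreal (1 - t) * emeasure N A"
  unfolding mix_measure_def
proof (rule emeasure_measure_of_sigma)
  show "sigma_algebra (space M) (sets M)"
    by (rule sets.sigma_algebra_axioms)
  show "positive (sets M) (\<lambda>A. ennreal t * emeasure M A + ennreal (1 - t) * emeasure N A)"
    by (simp add: positive_def)
  show "countably_additive (sets M)
      (\<lambda>A. ennreal t * emeasure M A + ennreal (1 - t) * emeasure N A)"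
    using assms(1)
    by (auto simp: countably_additive_def suminf_emeasure suminf_add[symmetric])
qed fact

definition convex_measures :: "'a measure set \<Rightarrow> bool"
  where "convex_measures T \<longleftrightarrow> (\<forall>M\<in>T. \<forall>N\<in>T. \<forall>t\<in>{0..1}. mix_measure t M N \<in> T)"

definition closed_convex_hull ::
    "'a::topological_space set \<Rightarrow> 'a measure set \<Rightarrow> 'a measure set"
  where "closed_convex_hull X A = weak_star X closure_of (convex_measures hull A)"

end

theory Submission
  imports Defs
begin

text \<open>
  Call an orbit segment of length \<open>n\<close> neutral up to \<open>\<rho>\<close> if along it the logarithm of the fibre
  derivative stays within \<open>\<rho> n\<close> of \<open>0\<close> at all intermediate times.  The heart of the matter is the
  lemma \<open>closing\<close>: a long neutral segment is shadowed, for its whole duration, by a periodic orbit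
  with negative fibre exponent and also by one with positive fibre exponent, each of period at most
  \<open>n (1 + C \<rho>)\<close>.  For the negative one, a ball of radius \<open>exp (- c \<rho> n)\<close> centred in \<open>J\<close> is moved to
  the segment (accessibility), follows it with bounded distortion, returns to \<open>J\<close> (accessibility
  again) and is put back inside itself by a word whose inverse expands the ball to a neighbourhood
  of \<open>J\<close>.  That word has length of order \<open>c \<rho> n\<close> and contracts at a definite rate, which for
  large \<open>c\<close> outweighs the distortion and the drift along the segment; so the loop is a contraction
  of the ball.  The positive one results from the inverse family and the reversed segment.

  Consequently a measure whose integrals are approximated by averages over long neutral segments,
  with \<open>\<rho>\<close> arbitrarily small, is a weak star limit of ergodic measures of negative exponent and also
  of ergodic measures of positive exponent (\<open>neutrally_approximable_in_closures\<close>); no convex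
  combinations are needed.  This applies to two kinds of measures.  An ergodic measure with zero
  exponent has this property by Birkhoff's theorem, here derived from the maximal ergodic theorem
  (\<open>zero_exponent_neutrally_approximable\<close>); this gives the inclusion.  For the non-emptiness,
  alternating expanding and contracting words of bounded length yields, from any starting point,
  orbits along which the derivative sums stay bounded (\<open>bounded_sum_orbits\<close>); an accumulation point
  of their empirical measures exists by Helly's theorem, transported to the phase space through a
  coding by real numbers (\<open>exists_neutrally_approximable\<close>).
\<close>

section \<open>Metric and differential calculus on the circle\<close>

lemma dist_circle_proj_le: "dist (circle_proj s) (circle_proj t) \<le> \<bar>s - t\<bar>"
  using dist_to_int_le[of "s - t" 0] by (simp add: dist_circle_proj)

lemma dist_circle_proj_eq:
  assumes "\<bar>s - t\<bar> \<le> 1 / 2"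
  shows "dist (circle_proj s) (circle_proj t) = \<bar>s - t\<bar>"
proof (cases "round (s - t) = 0")
  case True
  then show ?thesis by (simp add: dist_circle_proj dist_to_int_def)
next
  case False
  then have "1 \<le> \<bar>of_int (round (s - t)) :: real\<bar>" by linarith
  moreover have "\<bar>s - t - of_int (round (s - t))\<bar> \<le> \<bar>s - t\<bar>"
    using round_diff_minimal[of "s - t" 0] by simp
  ultimately show ?thesis
    using assms unfolding dist_circle_proj dist_to_int_def by argo
qed

lemma dist_circle_lift:
  obtains t where "circle_proj t = y" "\<bar>s - t\<bar> = dist (circle_proj s) y"
proof -
  obtain u where u: "circle_proj u = y" using circle_proj_surj by blast
  let ?t = "u + of_int (round (s - u))"
  have "circle_proj ?t = y"
    using u circle_proj_eq_iff[of ?t u] by simp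
  moreover have "\<bar>s - ?t\<bar> = dist (circle_proj s) y"
    unfolding u[symmetric] dist_circle_proj dist_to_int_def by (simp add: algebra_simps)
  ultimately show ?thesis by (rule that)
qed

lemma continuous_on_circle_proj: "continuous_on S circle_proj"
  unfolding continuous_on_iff using dist_circle_proj_le
  by (metis dist_real_def le_less_trans)

lemma compact_circle: "compact (UNIV :: circle set)"
proof -
  have "circle_proj ` {0..1} = UNIV"
  proof (intro set_eqI iffI UNIV_I)
    fix x :: circle
    obtain s where s: "circle_proj s = x" using circle_proj_surj by blast
    have "circle_proj (frac s) = x"
      using s circle_proj_eq_iff[of "frac s" s] by (simp add: frac_def)
    moreover have "frac s \<in> {0..1}" using frac_lt_1[of s] by simp
    ultimately show "x \<in> circle_proj ` {0..1}" by blast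
  qed
  then show ?thesis
    using compact_continuous_image[OF continuous_on_circle_proj, of "{0..1}"] by simp
qed

lemma cball_circle: "cball (circle_proj t) r = circle_proj ` {t - r..t + r}"
proof (intro set_eqI iffI)
  fix y assume y: "y \<in> cball (circle_proj t) r"
  obtain u where u: "circle_proj u = y" "\<bar>t - u\<bar> = dist (circle_proj t) y"
    using dist_circle_lift .
  have "u \<in> {t - r..t + r}" using u y by auto
  then show "y \<in> circle_proj ` {t - r..t + r}" using u by blast
next
  fix y assume "y \<in> circle_proj ` {t - r..t + r}"
  then obtain u where u: "u \<in> {t - r..t + r}" "y = circle_proj u" by blast
  show "y \<in> cball (circle_proj t) r"
    unfolding u mem_cball by (rule order_trans[OF dist_circle_proj_le]) (use u in auto)
qed

lemma circle_interval_cball: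
  assumes "r < 1 / 2" shows "circle_interval (cball x r)"
proof -
  obtain t where t: "circle_proj t = x" using circle_proj_surj by blast
  have "dist (circle_proj t) (circle_proj (t + 1 / 2)) = 1 / 2"
    by (subst dist_circle_proj_eq) auto
  then have "circle_proj (t + 1 / 2) \<notin> cball x r"
    using assms t by simp
  then have "cball x r \<noteq> UNIV" by blast
  moreover have "is_interval {t - r..t + r}" by (rule is_interval_cc)
  ultimately show ?thesis
    using cball_circle[of t r] t unfolding circle_interval_def by blast
qed

text \<open>The length is in fact \<open>2 * r\<close>; the expansion axiom only sees its logarithm up to an additive
  constant, so bounds up to a factor suffice.\<close>

lemma circle_length_cball:
  assumes "0 < r" "r < 1 / 2"
  shows "r \<le> circle_length (cball x r)" "circle_length (cball x r) \<le> 6 * r"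
proof -
  obtain t0 where t0: "circle_proj t0 = x" using circle_proj_surj by blast
  define t where "t = frac t0"
  have t: "circle_proj t = x" "0 \<le> t" "t < 1"
    using t0 circle_proj_eq_iff[of t t0] frac_lt_1[of t0] by (auto simp: t_def frac_def)
  let ?A = "{0..<1} \<inter> circle_proj -` cball x r"
  have pre: "circle_proj -` cball x r \<in> sets borel"
    by (intro borel_closed closed_vimage continuous_on_circle_proj) auto
  then have A: "?A \<in> sets lborel" by auto
  have fin: "emeasure lborel ?A < \<infinity>"
  proof -
    have "emeasure lborel ?A \<le> emeasure lborel {0..1::real}"
      by (rule emeasure_mono) auto
    then show ?thesis by (auto simp: less_top[symmetric] top_unique)
  qed
  have dist_le: "s \<in> circle_proj -` cball x r" if "\<bar>s - t\<bar> \<le> r" for s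
    using that order_trans[OF dist_circle_proj_le[of t s], of r] t by (auto simp: abs_minus_commute)
  define B where "B = (if t < 1 / 2 then {t..<t + r} else {t - r<..t})"
  have "B \<subseteq> ?A"
  proof
    fix s assume s: "s \<in> B"
    then have "s \<in> {0..<1}" using assms t by (auto simp: B_def split: if_splits)
    moreover have "\<bar>s - t\<bar> \<le> r" using s by (auto simp: B_def split: if_splits)
    ultimately show "s \<in> ?A" using dist_le by blast
  qed
  then have "measure lborel B \<le> measure lborel ?A"
    by (intro measure_mono_fmeasurable) (use A fin in \<open>auto simp: B_def fmeasurable_def\<close>)
  moreover have "measure lborel B = r" using assms by (simp add: B_def)
  ultimately show "r \<le> circle_length (cball x r)" unfolding circle_length_def by simp
  let ?C = "{t - r..t + r} \<union> {t + 1 - r..t + 1 + r} \<union> {t - 1 - r..t - 1 + r}"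
  have "?A \<subseteq> ?C"
  proof
    fix s assume s: "s \<in> ?A"
    then have "dist (circle_proj s) (circle_proj t) \<le> r" using t by (simp add: dist_commute)
    then have *: "\<bar>s - t - of_int (round (s - t))\<bar> \<le> r"
      by (simp add: dist_circle_proj dist_to_int_def)
    have "-1 < s - t" "s - t < 1" using s t by auto
    then have "round (s - t) \<le> 1" "round (s - t) \<ge> -1"
      unfolding round_def by linarith+
    then have "round (s - t) \<in> {-1, 0, 1}" by auto
    then show "s \<in> ?C" using * by (auto simp: abs_le_iff)
  qed
  then have "measure lborel ?A \<le> measure lborel ?C"
    by (intro measure_mono_fmeasurable) (use A in \<open>auto intro!: fmeasurable.Un fmeasurable_compact\<close>)
  also have "\<dots> \<le> measure lborel {t - r..t + r} + measure lborel {t + 1 - r..t + 1 + r}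
      + measure lborel {t - 1 - r..t - 1 + r}"
    by (intro order_trans[OF measure_Un_le] add_mono order_refl) auto
  also have "\<dots> = 6 * r" using assms by simp
  finally show "circle_length (cball x r) \<le> 6 * r" unfolding circle_length_def .
qed

lemma has_circle_deriv_unique:
  assumes "has_circle_deriv f D x" "has_circle_deriv f E x"
  shows "D = E"
proof -
  obtain \<phi> t where \<phi>: "circle_proj t = x" "\<And>s. f (circle_proj s) = circle_proj (\<phi> s)"
    "(\<phi> has_real_derivative D) (at t)"
    using assms(1) unfolding has_circle_deriv_def by blast
  obtain \<psi> u where \<psi>: "circle_proj u = x" "\<And>s. f (circle_proj s) = circle_proj (\<psi> s)"
    "(\<psi> has_real_derivative E) (at u)"
    using assms(2) unfolding has_circle_deriv_def by blast
  define h where "h s = \<phi> s - \<psi> (s + (u - t))" for s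
  have "((\<lambda>s. \<psi> (s + (u - t))) has_real_derivative E) (at t)"
    using \<psi>(3) DERIV_shift[of \<psi> E t "u - t"] by simp
  then have h': "(h has_real_derivative (D - E)) (at t)"
    unfolding h_def[abs_def] by (rule DERIV_diff[OF \<phi>(3)])
  have int: "h s \<in> \<int>" for s
  proof -
    have "u - t \<in> \<int>" using \<phi>(1) \<psi>(1) circle_proj_eq_iff by metis
    then have "circle_proj (s + (u - t)) = circle_proj s" by (simp add: circle_proj_eq_iff)
    then have "circle_proj (\<phi> s) = circle_proj (\<psi> (s + (u - t)))" using \<phi>(2) \<psi>(2) by metis
    then show ?thesis by (simp add: h_def circle_proj_eq_iff)
  qed
  have "isCont h t" using h' DERIV_isCont by blast
  then obtain d where d: "d > 0" "\<And>s. \<bar>s - t\<bar> < d \<Longrightarrow> \<bar>h s - h t\<bar> < 1"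
    unfolding continuous_at_eps_delta dist_real_def by (metis zero_less_one)
  \<comment> \<open>the difference of two lifts is integer-valued, hence constant near a point of continuity\<close>
  have "h s = h t" if "\<bar>s - t\<bar> < d" for s
    using d(2)[OF that] Ints_nonzero_abs_less1[OF Ints_diff[OF int[of s] int[of t]]] by simp
  then have "(h has_real_derivative 0) (at t)"
    using DERIV_local_const[OF h' d(1)] h' by (metis abs_minus_commute)
  then have "D - E = 0" using h' DERIV_unique by blast
  then show ?thesis by simp
qed

lemma has_circle_deriv_imp: "has_circle_deriv f D x \<Longrightarrow> circle_deriv f x = D"
  unfolding circle_deriv_def using has_circle_deriv_unique by blast

lemma has_circle_deriv_id: "has_circle_deriv (\<lambda>x. x) 1 x"
proof -
  obtain t where "circle_proj t = x" using circle_proj_surj by blast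
  then show ?thesis
    unfolding has_circle_deriv_def by (intro exI[of _ "\<lambda>s. s"] exI[of _ t]) auto
qed

lemma has_circle_deriv_compose:
  assumes "has_circle_deriv f D x" "has_circle_deriv g E (f x)"
  shows "has_circle_deriv (\<lambda>y. g (f y)) (E * D) x"
proof -
  obtain \<phi> t where \<phi>: "circle_proj t = x" "\<And>s. f (circle_proj s) = circle_proj (\<phi> s)"
    "(\<phi> has_real_derivative D) (at t)"
    using assms(1) unfolding has_circle_deriv_def by blast
  obtain \<psi> u where \<psi>: "circle_proj u = f x" "\<And>s. g (circle_proj s) = circle_proj (\<psi> s)"
    "(\<psi> has_real_derivative E) (at u)"
    using assms(2) unfolding has_circle_deriv_def by blast
  define m where "m = u - \<phi> t"
  have "m \<in> \<int>" using \<phi>(1,2) \<psi>(1) circle_proj_eq_iff unfolding m_def by metis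
  then have m: "circle_proj (s + m) = circle_proj s" for s by (simp add: circle_proj_eq_iff)
  have "((\<lambda>s. \<psi> (s + m)) has_real_derivative E) (at (\<phi> t))"
    using \<psi>(3) DERIV_shift[of \<psi> E "\<phi> t" m] by (simp add: m_def)
  from DERIV_chain2[OF this \<phi>(3)]
  have "((\<lambda>s. \<psi> (\<phi> s + m)) has_real_derivative (E * D)) (at t)" .
  moreover have "g (f (circle_proj s)) = circle_proj (\<psi> (\<phi> s + m))" for s
    using \<phi>(2) \<psi>(2) m by metis
  ultimately show ?thesis
    unfolding has_circle_deriv_def using \<phi>(1)
    by (intro exI[of _ "\<lambda>s. \<psi> (\<phi> s + m)"] exI[of _ t]) auto
qed

lemma has_circle_deriv_local_lipschitz:
  assumes "has_circle_deriv f D x" "\<bar>D\<bar> < c"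
  shows "\<exists>d>0. \<forall>y. dist x y < d \<longrightarrow> dist (f x) (f y) \<le> c * dist x y"
proof -
  obtain \<phi> t where \<phi>: "circle_proj t = x" "\<And>s. f (circle_proj s) = circle_proj (\<phi> s)"
    "(\<phi> has_real_derivative D) (at t)"
    using assms(1) unfolding has_circle_deriv_def by blast
  have "(\<lambda>y. (\<phi> y - \<phi> t) / (y - t)) \<midarrow>t\<rightarrow> D"
    using \<phi>(3) by (simp add: has_field_derivative_iff)
  then obtain d where d: "d > 0"
    "\<And>s. s \<noteq> t \<Longrightarrow> \<bar>s - t\<bar> < d \<Longrightarrow> \<bar>(\<phi> s - \<phi> t) / (s - t) - D\<bar> < c - \<bar>D\<bar>"
    using assms(2) unfolding LIM_eq real_norm_def by (metis diff_gt_0_iff_gt)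
  have "dist (f x) (f y) \<le> c * dist x y" if y: "dist x y < d" for y
  proof -
    obtain s where s: "circle_proj s = y" "\<bar>t - s\<bar> = dist x y"
      using dist_circle_lift \<phi>(1) by metis
    have "\<bar>\<phi> t - \<phi> s\<bar> \<le> c * \<bar>t - s\<bar>"
    proof (cases "s = t")
      case False
      then have "\<bar>(\<phi> s - \<phi> t) / (s - t) - D\<bar> < c - \<bar>D\<bar>" using d(2) s(2) y by auto
      then have "\<bar>(\<phi> s - \<phi> t) / (s - t)\<bar> \<le> c" by linarith
      then show ?thesis using False
        by (simp add: abs_divide divide_le_eq abs_minus_commute)
    qed simp
    then show ?thesis
      using s \<phi>(1,2) order_trans[OF dist_circle_proj_le] by metis
  qed
  then show ?thesis using d(1) by blast
qed

text \<open>A mean value inequality along the projection of \<open>{a..b}\<close>.  No global lift of \<open>f\<close> is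
  needed, because the estimate is local and additive in the arc.\<close>

lemma circle_mean_value_arc:
  assumes "a \<le> b"
    and deriv: "\<And>s. a \<le> s \<Longrightarrow> s \<le> b \<Longrightarrow> has_circle_deriv f (f' (circle_proj s)) (circle_proj s)"
    and bound: "\<And>s. a \<le> s \<Longrightarrow> s \<le> b \<Longrightarrow> \<bar>f' (circle_proj s)\<bar> \<le> c"
  shows "dist (f (circle_proj a)) (f (circle_proj b)) \<le> c * (b - a)"
proof (rule field_le_epsilon)
  fix e :: real assume e: "e > 0"
  define c' where "c' = c + e / (1 + (b - a))"
  have "0 < e / (1 + (b - a))" using e assms(1) by simp
  then have c': "c < c'" by (simp add: c'_def)
  have "c \<ge> 0" using bound[of a] assms(1) abs_ge_zero order_trans by blast
  have "dist (f (circle_proj a)) (f (circle_proj b)) \<le> c' * (b - a)"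
    using assms(1)
  proof (induction rule: Bolzano)
    case (trans p q r)
    then show ?case
      using dist_triangle[of "f (circle_proj p)" "f (circle_proj r)" "f (circle_proj q)"]
      by (simp add: algebra_simps)
  next
    case (local x)
    obtain d where d: "d > 0" "\<And>y. dist (circle_proj x) y < d \<Longrightarrow>
        dist (f (circle_proj x)) (f y) \<le> c' * dist (circle_proj x) y"
      using has_circle_deriv_local_lipschitz[OF deriv[OF local], of c'] bound[OF local] c'
      by (metis le_less_trans)
    have near: "dist (f (circle_proj x)) (f (circle_proj y)) \<le> c' * \<bar>x - y\<bar>" if "\<bar>x - y\<bar> < d" for y
      using d(2)[of "circle_proj y"] that dist_circle_proj_le[of x y] \<open>c \<ge> 0\<close> c'
      by (meson le_less_trans mult_left_mono order_trans less_imp_le)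
    have "dist (f (circle_proj p)) (f (circle_proj q)) \<le> c' * (q - p)"
      if "p \<le> x" "x \<le> q" "q - p < d" for p q
    proof -
      have "dist (f (circle_proj p)) (f (circle_proj q)) \<le> c' * \<bar>x - p\<bar> + c' * \<bar>x - q\<bar>"
        using near[of p] near[of q] that dist_triangle3[of "f (circle_proj p)" "f (circle_proj q)" "f (circle_proj x)"]
        by (simp add: dist_commute)
      also have "\<dots> = c' * (q - p)" using that by (simp add: algebra_simps)
      finally show ?thesis .
    qed
    then show ?case using d(1) by blast
  qed
  also have "\<dots> \<le> c * (b - a) + e"
    using e assms(1) by (simp add: c'_def algebra_simps divide_simps)
  finally show "dist (f (circle_proj a)) (f (circle_proj b)) \<le> c * (b - a) + e" .
qed

lemma circle_mean_value_cball:
  assumes "y \<in> cball x r" "z \<in> cball x r" "r \<le> 1 / 4"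
    and deriv: "\<And>s. s \<in> cball x r \<Longrightarrow> has_circle_deriv f (f' s) s"
    and bound: "\<And>s. s \<in> cball x r \<Longrightarrow> \<bar>f' s\<bar> \<le> c"
  shows "dist (f y) (f z) \<le> c * dist y z"
proof -
  obtain t where t: "circle_proj t = x" using circle_proj_surj by blast
  obtain a where a: "circle_proj a = y" "\<bar>t - a\<bar> \<le> r"
    using dist_circle_lift[of y t] assms(1) t by (metis mem_cball)
  obtain b where b: "circle_proj b = z" "\<bar>t - b\<bar> \<le> r"
    using dist_circle_lift[of z t] assms(2) t by (metis mem_cball)
  have in_ball: "circle_proj s \<in> cball x r" if "\<bar>t - s\<bar> \<le> r" for s
    using that order_trans[OF dist_circle_proj_le] t by (metis mem_cball)
  have eq: "dist y z = \<bar>a - b\<bar>"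
  proof -
    have "\<bar>a - b\<bar> \<le> 1 / 2" using a(2) b(2) assms(3) by linarith
    then show ?thesis using dist_circle_proj_eq a(1) b(1) by blast
  qed
  consider "a \<le> b" | "b \<le> a" by linarith
  then show ?thesis
  proof cases
    case 1
    have "dist (f (circle_proj a)) (f (circle_proj b)) \<le> c * (b - a)"
      by (rule circle_mean_value_arc[OF 1]; rule deriv bound; rule in_ball; use a b in linarith)
    then show ?thesis using a b eq 1 by simp
  next
    case 2
    have "dist (f (circle_proj b)) (f (circle_proj a)) \<le> c * (a - b)"
      by (rule circle_mean_value_arc[OF 2]; rule deriv bound; rule in_ball; use a b in linarith)
    then show ?thesis using a b eq 2 by (simp add: dist_commute)
  qed
qed

lemma circle_mean_value_global:
  assumes deriv: "\<And>s. has_circle_deriv f (f' s) s"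
    and bound: "\<And>s. \<bar>f' s\<bar> \<le> c"
  shows "dist (f y) (f z) \<le> c * dist y z"
proof -
  obtain a where a: "circle_proj a = y" using circle_proj_surj by blast
  obtain b where b: "circle_proj b = z" "\<bar>a - b\<bar> = dist y z"
    using dist_circle_lift[of z a] a by metis
  consider "a \<le> b" | "b \<le> a" by linarith
  then show ?thesis
  proof cases
    case 1
    then show ?thesis using circle_mean_value_arc[OF 1 deriv bound] a b by simp
  next
    case 2
    then show ?thesis using circle_mean_value_arc[OF 2 deriv bound] a b by (simp add: dist_commute)
  qed
qed

lemma has_circle_deriv_imp_continuous:
  assumes "\<And>x. \<exists>D. has_circle_deriv f D x"
  shows "continuous_on UNIV f"
proof -
  have "isCont f x" for x
    unfolding continuous_at_eps_delta
  proof (intro allI impI)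
    fix e :: real assume e: "e > 0"
    obtain D where "has_circle_deriv f D x" using assms by blast
    then obtain d where d: "d > 0"
      "\<And>y. dist x y < d \<Longrightarrow> dist (f x) (f y) \<le> (\<bar>D\<bar> + 1) * dist x y"
      using has_circle_deriv_local_lipschitz[of f D x "\<bar>D\<bar> + 1"] by auto
    show "\<exists>d>0. \<forall>y. dist y x < d \<longrightarrow> dist (f y) (f x) < e"
    proof (intro exI[of _ "min d (e / (\<bar>D\<bar> + 1))"] conjI allI impI)
      fix y assume "dist y x < min d (e / (\<bar>D\<bar> + 1))"
      then have *: "dist x y < d" "dist x y * (\<bar>D\<bar> + 1) < e"
        by (auto simp: dist_commute pos_less_divide_eq)
      show "dist (f y) (f x) < e"
        using d(2)[OF *(1)] *(2) by (simp add: dist_commute mult.commute)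
    qed (use d e in auto)
  qed
  then show ?thesis by (simp add: continuous_at_imp_continuous_on)
qed

section \<open>Words in a finite family of circle diffeomorphisms\<close>

text \<open>The logarithm of \<open>\<bar>(f\<^bsub>[w]\<^esub>)'(x)\<bar>\<close>, expanded by the chain rule; see
  \<open>abs_word_deriv\<close> below.\<close>

fun log_deriv_sum :: "(nat \<Rightarrow> circle \<Rightarrow> circle) \<Rightarrow> nat list \<Rightarrow> circle \<Rightarrow> real" where
  "log_deriv_sum f [] x = 0"
| "log_deriv_sum f (a # w) x = ln \<bar>circle_deriv (f a) x\<bar> + log_deriv_sum f w (f a x)"

lemma log_deriv_sum_append:
  "log_deriv_sum f (v @ w) x = log_deriv_sum f v x + log_deriv_sum f w (fold f v x)"
  by (induction v arbitrary: x) auto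

text \<open>A finite family of \<open>C\<^sup>1\<close> diffeomorphisms together with its inverse family.  The locale is
  symmetric in \<open>f\<close> and \<open>g\<close>, so that every fact about expansion yields one about contraction.\<close>

locale circle_ifs =
  fixes k :: nat and f g :: "nat \<Rightarrow> circle \<Rightarrow> circle"
  assumes k_pos: "0 < k"
    and has_deriv: "\<And>i x. i < k \<Longrightarrow> has_circle_deriv (f i) (circle_deriv (f i) x) x"
    and has_deriv_inv: "\<And>i x. i < k \<Longrightarrow> has_circle_deriv (g i) (circle_deriv (g i) x) x"
    and cont_deriv: "\<And>i. i < k \<Longrightarrow> continuous_on UNIV (circle_deriv (f i))"
    and cont_deriv_inv: "\<And>i. i < k \<Longrightarrow> continuous_on UNIV (circle_deriv (g i))"
    and inv_left: "\<And>i x. i < k \<Longrightarrow> g i (f i x) = x"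
    and inv_right: "\<And>i x. i < k \<Longrightarrow> f i (g i x) = x"
begin

lemma swap: "circle_ifs k g f"
  by unfold_locales (use k_pos has_deriv has_deriv_inv cont_deriv cont_deriv_inv inv_left inv_right in auto)

lemma continuous_map_f: "i < k \<Longrightarrow> continuous_on UNIV (f i)"
  using has_circle_deriv_imp_continuous has_deriv by blast

lemma deriv_inverse:
  assumes "i < k" shows "circle_deriv (g i) (f i x) * circle_deriv (f i) x = 1"
proof (rule has_circle_deriv_unique)
  show "has_circle_deriv (\<lambda>y. g i (f i y)) (circle_deriv (g i) (f i x) * circle_deriv (f i) x) x"
    by (rule has_circle_deriv_compose[OF has_deriv[OF assms] has_deriv_inv[OF assms]])
  show "has_circle_deriv (\<lambda>y. g i (f i y)) 1 x"
    using has_circle_deriv_id[of x] inv_left[OF assms] by simp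
qed

lemma deriv_nonzero: "i < k \<Longrightarrow> circle_deriv (f i) x \<noteq> 0"
  using deriv_inverse[of i x] by auto

lemma ln_deriv_inverse:
  assumes "i < k" shows "ln \<bar>circle_deriv (g i) (f i x)\<bar> = - ln \<bar>circle_deriv (f i) x\<bar>"
proof -
  have "\<bar>circle_deriv (g i) (f i x)\<bar> = inverse \<bar>circle_deriv (f i) x\<bar>"
    using deriv_inverse[OF assms, of x]
    by (metis abs_inverse inverse_unique mult.commute)
  then show ?thesis using deriv_nonzero[OF assms, of x] by (simp add: ln_inverse)
qed

lemma continuous_ln_deriv:
  assumes "i < k" shows "continuous_on UNIV (\<lambda>x. ln \<bar>circle_deriv (f i) x\<bar>)"
  by (intro continuous_intros cont_deriv assms) (use deriv_nonzero[OF assms] in auto)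

lemma word_deriv:
  assumes "set w \<subseteq> {..<k}"
  shows "has_circle_deriv (fold f w) (circle_deriv (fold f w) x) x"
    and abs_word_deriv: "\<bar>circle_deriv (fold f w) x\<bar> = exp (log_deriv_sum f w x)"
proof -
  have "\<exists>D. has_circle_deriv (fold f w) D x \<and> \<bar>D\<bar> = exp (log_deriv_sum f w x)"
    using assms
  proof (induction w arbitrary: x)
    case Nil
    then show ?case using has_circle_deriv_id[of x] by (auto simp: id_def intro!: exI[of _ 1])
  next
    case (Cons a w)
    then obtain D where D: "has_circle_deriv (fold f w) D (f a x)"
      "\<bar>D\<bar> = exp (log_deriv_sum f w (f a x))" by force
    have a: "a < k" using Cons.prems by auto
    have "has_circle_deriv (fold f (a # w)) (D * circle_deriv (f a) x) x"
      using has_circle_deriv_compose[OF has_deriv[OF a] D(1)] by (simp add: comp_def)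
    moreover have "\<bar>D * circle_deriv (f a) x\<bar> = exp (log_deriv_sum f (a # w) x)"
      using D(2) deriv_nonzero[OF a, of x] by (simp add: abs_mult exp_add)
    ultimately show ?case by blast
  qed
  then obtain D where "has_circle_deriv (fold f w) D x" "\<bar>D\<bar> = exp (log_deriv_sum f w x)" by blast
  then show "has_circle_deriv (fold f w) (circle_deriv (fold f w) x) x"
    "\<bar>circle_deriv (fold f w) x\<bar> = exp (log_deriv_sum f w x)"
    using has_circle_deriv_imp by auto
qed

lemma continuous_word: "set w \<subseteq> {..<k} \<Longrightarrow> continuous_on UNIV (fold f w)"
  using has_circle_deriv_imp_continuous word_deriv(1) by blast

lemma word_inverse: "set w \<subseteq> {..<k} \<Longrightarrow> fold g (rev w) (fold f w x) = x"
  by (induction w arbitrary: x) (auto simp: inv_left)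

lemma log_deriv_sum_inverse:
  "set w \<subseteq> {..<k} \<Longrightarrow> log_deriv_sum g (rev w) (fold f w x) = - log_deriv_sum f w x"
  by (induction w arbitrary: x) (auto simp: log_deriv_sum_append word_inverse ln_deriv_inverse)

lemma ln_deriv_bounded:
  obtains L where "0 < L" "\<And>i x. i < k \<Longrightarrow> \<bar>ln \<bar>circle_deriv (f i) x\<bar>\<bar> \<le> L"
proof -
  have "\<exists>B. \<forall>x. \<bar>ln \<bar>circle_deriv (f i) x\<bar>\<bar> \<le> B" if "i < k" for i
    using compact_imp_bounded[OF compact_continuous_image[OF continuous_ln_deriv[OF that] compact_circle]]
    unfolding bounded_iff by auto
  then obtain B where B: "\<And>i x. i < k \<Longrightarrow> \<bar>ln \<bar>circle_deriv (f i) x\<bar>\<bar> \<le> B i" by metis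
  have "\<bar>ln \<bar>circle_deriv (f i) x\<bar>\<bar> \<le> (\<Sum>j<k. \<bar>B j\<bar>) + 1" if "i < k" for i x
    using B[OF that, of x] member_le_sum[of i "{..<k}" "\<lambda>j. \<bar>B j\<bar>"] that by auto
  moreover have "0 < (\<Sum>j<k. \<bar>B j\<bar>) + 1" by (simp add: add_nonneg_pos sum_nonneg)
  ultimately show ?thesis using that by blast
qed

lemma ln_deriv_uniform:
  assumes "0 < e"
  obtains d where "0 < d" "\<And>i x y. i < k \<Longrightarrow> dist x y \<le> d \<Longrightarrow>
    \<bar>ln \<bar>circle_deriv (f i) x\<bar> - ln \<bar>circle_deriv (f i) y\<bar>\<bar> \<le> e"
proof -
  have "\<exists>d>0. \<forall>x y. dist x y < d \<longrightarrow>
      \<bar>ln \<bar>circle_deriv (f i) x\<bar> - ln \<bar>circle_deriv (f i) y\<bar>\<bar> < e" if "i < k" for i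
    using compact_uniformly_continuous[OF continuous_ln_deriv[OF that] compact_circle] assms
    unfolding uniformly_continuous_on_def dist_real_def by (metis UNIV_I)
  then obtain d where d: "\<And>i. i < k \<Longrightarrow> d i > 0" "\<And>i x y. i < k \<Longrightarrow> dist x y < d i \<Longrightarrow>
      \<bar>ln \<bar>circle_deriv (f i) x\<bar> - ln \<bar>circle_deriv (f i) y\<bar>\<bar> < e"
    by metis
  define d' where "d' = Min (d ` {..<k}) / 2"
  have min: "Min (d ` {..<k}) > 0" using d(1) k_pos by (subst Min_gr_iff) auto
  have "d' < d i" if "i < k" for i
  proof -
    have "Min (d ` {..<k}) \<le> d i" using that by (intro Min_le) auto
    then show ?thesis using min unfolding d'_def by linarith
  qed
  then have "\<bar>ln \<bar>circle_deriv (f i) x\<bar> - ln \<bar>circle_deriv (f i) y\<bar>\<bar> \<le> e"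
    if "i < k" "dist x y \<le> d'" for i x y
    using d(2)[of i x y] that by force
  moreover have "d' > 0" using min by (simp add: d'_def)
  ultimately show ?thesis using that by blast
qed

lemma abs_log_deriv_sum_le:
  assumes L: "\<And>i x. i < k \<Longrightarrow> \<bar>ln \<bar>circle_deriv (f i) x\<bar>\<bar> \<le> L" and "set w \<subseteq> {..<k}"
  shows "\<bar>log_deriv_sum f w x\<bar> \<le> L * real (length w)"
  using assms(2)
proof (induction w arbitrary: x)
  case (Cons a w)
  then have "\<bar>ln \<bar>circle_deriv (f a) x\<bar>\<bar> \<le> L" "\<bar>log_deriv_sum f w (f a x)\<bar> \<le> L * real (length w)"
    using L[of a x] Cons.IH[of "f a x"] by auto
  then show ?case by (simp add: algebra_simps abs_le_iff)
qed simp

lemma word_lipschitz: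
  assumes L: "\<And>i x. i < k \<Longrightarrow> \<bar>ln \<bar>circle_deriv (f i) x\<bar>\<bar> \<le> L" and w: "set w \<subseteq> {..<k}"
  shows "dist (fold f w y) (fold f w z) \<le> exp (L * real (length w)) * dist y z"
proof (rule circle_mean_value_global[OF word_deriv(1)[OF w]])
  show "\<bar>circle_deriv (fold f w) x\<bar> \<le> exp (L * real (length w))" for x
    using abs_log_deriv_sum_le[OF L w, of x] abs_word_deriv[OF w] by simp
qed

text \<open>Bounded distortion: as long as the ball around \<open>x\<close> stays smaller than the scale \<open>\<delta>\<close> on which
  the logarithmic derivatives vary by at most \<open>\<rho>\<close>, its points are moved like \<open>x\<close> up to a factor
  \<open>exp \<rho>\<close> per letter.\<close>

lemma word_shadowing:
  assumes unif: "\<And>i x y. i < k \<Longrightarrow> dist x y \<le> \<delta> \<Longrightarrow>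
      \<bar>ln \<bar>circle_deriv (f i) x\<bar> - ln \<bar>circle_deriv (f i) y\<bar>\<bar> \<le> \<rho>"
    and "\<delta> \<le> 1 / 4" "set w \<subseteq> {..<k}"
    and "\<And>i. i \<le> length w \<Longrightarrow> r * exp (log_deriv_sum f (take i w) x + real i * \<rho>) \<le> \<delta>"
    and "y \<in> cball x r" "z \<in> cball x r"
  shows "dist (fold f w y) (fold f w z) \<le> exp (log_deriv_sum f w x + real (length w) * \<rho>) * dist y z
    \<and> \<bar>log_deriv_sum f w y - log_deriv_sum f w x\<bar> \<le> real (length w) * \<rho>"
  using assms(3-6)
proof (induction w arbitrary: x y z r)
  case (Cons a w)
  have a: "a < k" and w: "set w \<subseteq> {..<k}" using Cons.prems(1) by auto
  have r: "r \<le> \<delta>" using Cons.prems(2)[of 0] by simp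
  define E where "E = exp (ln \<bar>circle_deriv (f a) x\<bar> + \<rho>)"
  have step: "dist (f a y') (f a z') \<le> E * dist y' z'" if "y' \<in> cball x r" "z' \<in> cball x r" for y' z'
  proof (rule circle_mean_value_cball[OF that])
    show "r \<le> 1 / 4" using r assms(2) by simp
    fix s assume s: "s \<in> cball x r"
    show "has_circle_deriv (f a) (circle_deriv (f a) s) s" by (rule has_deriv[OF a])
    have "ln \<bar>circle_deriv (f a) s\<bar> \<le> ln \<bar>circle_deriv (f a) x\<bar> + \<rho>"
      using unif[OF a, of x s] s r by auto
    then have "exp (ln \<bar>circle_deriv (f a) s\<bar>) \<le> E" unfolding E_def by simp
    then show "\<bar>circle_deriv (f a) s\<bar> \<le> E" using deriv_nonzero[OF a, of s] by simp
  qed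
  have "0 \<le> r" using Cons.prems(3) by (auto intro: order_trans[OF zero_le_dist])
  then have x: "x \<in> cball x r" by simp
  have E0: "0 \<le> E" by (simp add: E_def)
  have in_ball: "f a y' \<in> cball (f a x) (r * E)" if "y' \<in> cball x r" for y'
    using step[OF x that] that mult_left_mono[OF _ E0, of "dist x y'" r]
    by (auto simp: mult.commute)
  have size: "r * E * exp (log_deriv_sum f (take i w) (f a x) + real i * \<rho>) \<le> \<delta>"
    if "i \<le> length w" for i
    using Cons.prems(2)[of "Suc i"] that
    by (simp add: E_def exp_add[symmetric] algebra_simps)
  note IH = Cons.IH[OF w size in_ball[OF Cons.prems(3)] in_ball[OF Cons.prems(4)]]
  have "dist (fold f (a # w) y) (fold f (a # w) z)
      \<le> exp (log_deriv_sum f w (f a x) + real (length w) * \<rho>) * dist (f a y) (f a z)"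
    using IH by simp
  also have "\<dots> \<le> exp (log_deriv_sum f w (f a x) + real (length w) * \<rho>) * (E * dist y z)"
    using step[OF Cons.prems(3,4)] by (intro mult_left_mono) auto
  also have "\<dots> = exp (log_deriv_sum f (a # w) x + real (length (a # w)) * \<rho>) * dist y z"
    by (simp add: E_def exp_add algebra_simps)
  finally have "dist (fold f (a # w) y) (fold f (a # w) z)
      \<le> exp (log_deriv_sum f (a # w) x + real (length (a # w)) * \<rho>) * dist y z" .
  moreover have "\<bar>ln \<bar>circle_deriv (f a) y\<bar> - ln \<bar>circle_deriv (f a) x\<bar>\<bar> \<le> \<rho>"
    using unif[OF a, of y x] Cons.prems(3) r by (auto simp: dist_commute)
  then have "\<bar>log_deriv_sum f (a # w) y - log_deriv_sum f (a # w) x\<bar> \<le> real (length (a # w)) * \<rho>"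
    using IH by (simp add: algebra_simps abs_le_iff)
  ultimately show ?case by blast
qed simp

end

section \<open>Closing almost neutral orbit segments\<close>

context circle_ifs
begin

lemma Acc_plus_bounded:
  assumes "Acc_plus k f J"
  obtains A :: nat where "\<And>x. \<exists>w. set w \<subseteq> {..<k} \<and> length w \<le> A \<and> x \<in> fold f w ` interior J"
proof -
  define W where "W = {w. set w \<subseteq> {..<k}}"
  interpret inv: circle_ifs k g f by (rule swap)
  have eq: "fold f w ` interior J = fold g (rev w) -` interior J" if "w \<in> W" for w
  proof -
    have w: "set w \<subseteq> {..<k}" using that by (simp add: W_def)
    show ?thesis
    proof (intro set_eqI iffI)
      fix x assume "x \<in> fold f w ` interior J"
      then show "x \<in> fold g (rev w) -` interior J" using word_inverse[OF w] by auto
    next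
      fix x assume "x \<in> fold g (rev w) -` interior J"
      then have "fold g (rev w) x \<in> interior J" by simp
      then have "fold f w (fold g (rev w) x) \<in> fold f w ` interior J" by (rule imageI)
      then show "x \<in> fold f w ` interior J" using inv.word_inverse[of "rev w" x] w by simp
    qed
  qed
  have "open (fold f w ` interior J)" if "w \<in> W" for w
    unfolding eq[OF that]
    by (intro open_vimage open_interior inv.continuous_word) (use that in \<open>simp add: W_def\<close>)
  moreover have "UNIV \<subseteq> (\<Union>w\<in>W. fold f w ` interior J)"
    using assms unfolding Acc_plus_def W_def by blast
  ultimately obtain W' where W': "W' \<subseteq> W" "finite W'" "UNIV \<subseteq> (\<Union>w\<in>W'. fold f w ` interior J)"
    using compactE_image[OF compact_circle, of W "\<lambda>w. fold f w ` interior J"] by metis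
  show ?thesis
  proof (rule that[of "Max (insert 0 (length ` W'))"])
    fix x
    obtain w where "w \<in> W'" "x \<in> fold f w ` interior J" using W'(3) by blast
    then show "\<exists>w. set w \<subseteq> {..<k} \<and> length w \<le> Max (insert 0 (length ` W')) \<and> x \<in> fold f w ` interior J"
      using W'(1,2) by (intro exI[of _ w]) (auto simp: W_def)
  qed
qed

text \<open>The expansion axiom for arcs centred in \<open>J\<close>.  The last conclusion bounds the length of
  the word from below, since a short word cannot blow up a small arc.\<close>

lemma CEC_plus_cball:
  assumes "CEC_plus k f J" "u \<in> J" "v \<in> J"
    and L: "\<And>i x. i < k \<Longrightarrow> \<bar>ln \<bar>circle_deriv (f i) x\<bar>\<bar> \<le> L"
  obtains K1 K2 K3 K4 K5 where "0 < K1" "0 < K2" "0 < K3" "0 < K4" "0 < K5"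
    "\<And>y r. y \<in> J \<Longrightarrow> 0 < r \<Longrightarrow> r < K1 \<Longrightarrow> \<exists>w. set w \<subseteq> {..<k} \<and> w \<noteq> [] \<and>
      real (length w) \<le> K2 * (- ln r) + K3 \<and> circle_nbhd J K4 \<subseteq> fold f w ` cball y r \<and>
      (\<forall>z\<in>cball y r. real (length w) * K5 \<le> log_deriv_sum f w z) \<and>
      dist u v \<le> exp (L * real (length w)) * (2 * r)"
proof -
  obtain K1 K2 K3 K4 K5 where K: "0 < K1" "0 < K2" "0 < K3" "0 < K4" "0 < K5"
    and cec: "\<forall>H. circle_interval H \<and> H \<inter> J \<noteq> {} \<and> 0 < circle_length H \<and> circle_length H < K1 \<longrightarrow>
        (\<exists>w. set w \<subseteq> {..<k} \<and> w \<noteq> [] \<and>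
          real (length w) \<le> K2 * \<bar>ln (circle_length H)\<bar> + K3 \<and>
          circle_nbhd J K4 \<subseteq> fold f w ` H \<and>
          (\<forall>x\<in>H. real (length w) * K5 \<le> ln \<bar>circle_deriv (fold f w) x\<bar>))"
    using assms(1) unfolding CEC_plus_def by (elim exE conjE) (rule that; assumption)
  define R where "R = min (1 / 12) (K1 / 6)"
  have "\<exists>w. set w \<subseteq> {..<k} \<and> w \<noteq> [] \<and>
      real (length w) \<le> K2 * (- ln r) + K3 \<and> circle_nbhd J K4 \<subseteq> fold f w ` cball y r \<and>
      (\<forall>z\<in>cball y r. real (length w) * K5 \<le> log_deriv_sum f w z) \<and>
      dist u v \<le> exp (L * real (length w)) * (2 * r)"
    if y: "y \<in> J" and r: "0 < r" "r < R" for y r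
  proof -
    have r12: "r < 1 / 12" "6 * r < K1" using r by (auto simp: R_def)
    define len where "len = circle_length (cball y r)"
    have len: "r \<le> len" "len \<le> 6 * r" using circle_length_cball[of r y] r r12 by (auto simp: len_def)
    have "y \<in> cball y r \<inter> J" using y r by simp
    then have "cball y r \<inter> J \<noteq> {}" by blast
    moreover have "circle_interval (cball y r)" using circle_interval_cball r12 by simp
    ultimately have "circle_interval (cball y r) \<and> cball y r \<inter> J \<noteq> {} \<and>
        0 < circle_length (cball y r) \<and> circle_length (cball y r) < K1"
      using len r r12 unfolding len_def by linarith
    from cec[THEN spec, THEN mp, OF this] obtain w where w: "set w \<subseteq> {..<k}" "w \<noteq> []" "real (length w) \<le> K2 * \<bar>ln len\<bar> + K3"
      "circle_nbhd J K4 \<subseteq> fold f w ` cball y r"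
      "\<And>x. x \<in> cball y r \<Longrightarrow> real (length w) * K5 \<le> ln \<bar>circle_deriv (fold f w) x\<bar>"
      unfolding len_def[symmetric] by blast
    have "len < 1" "0 < len" using len r r12 by linarith+
    then have "\<bar>ln len\<bar> \<le> - ln r" using len r by simp
    then have "real (length w) \<le> K2 * (- ln r) + K3"
      using w(3) K(2) by (meson add_mono_thms_linordered_semiring(3) less_imp_le mult_left_mono order_trans)
    moreover have "real (length w) * K5 \<le> log_deriv_sum f w z" if "z \<in> cball y r" for z
      using w(5)[OF that] abs_word_deriv[OF w(1), of z] by simp
    moreover have "dist u v \<le> exp (L * real (length w)) * (2 * r)"
    proof -
      have "u \<in> circle_nbhd J K4" "v \<in> circle_nbhd J K4"
        using assms(2,3) K(4) unfolding circle_nbhd_def by force+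
      then obtain p q where pq: "p \<in> cball y r" "q \<in> cball y r" "u = fold f w p" "v = fold f w q"
        using w(4) by blast
      have "dist u v \<le> exp (L * real (length w)) * dist p q"
        unfolding pq(3,4) by (rule word_lipschitz[OF L w(1)])
      also have "dist p q \<le> 2 * r"
        using pq(1,2) dist_triangle3[of p q y] by simp
      finally show ?thesis by simp
    qed
    ultimately show ?thesis using w(1,2,4) by blast
  qed
  moreover have "0 < R" using K by (simp add: R_def)
  ultimately show ?thesis using K by (intro that[of R K2 K3 K4 K5])
qed

end

text \<open>A word \<open>w @ t\<close> with a fixed point \<open>p\<close> whose orbit stays \<open>\<delta>\<close>-close to that of \<open>x\<close> while
  \<open>w\<close> is being read, and which is closed up by at most \<open>m\<close> further letters \<open>t\<close>.\<close>

definition shadowing_loop ::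
    "nat \<Rightarrow> (nat \<Rightarrow> circle \<Rightarrow> circle) \<Rightarrow> nat list \<Rightarrow> circle \<Rightarrow> real \<Rightarrow> real \<Rightarrow> nat list \<Rightarrow> circle \<Rightarrow> bool"
  where "shadowing_loop k f w x \<delta> m t p \<longleftrightarrow>
    set t \<subseteq> {..<k} \<and> fold f (w @ t) p = p \<and> real (length t) \<le> m \<and>
    (\<forall>i\<le>length w. dist (fold f (take i w) p) (fold f (take i w) x) \<le> \<delta>)"

context circle_ifs
begin

text \<open>An orbit segment along which the derivative grows at most like \<open>exp (\<rho> n)\<close> is shadowed by
  an attracting periodic orbit, at the cost of a proportion \<open>O(\<rho>)\<close> of additional time.  The
  ball of radius \<open>exp (- c \<rho> n)\<close> around a point of \<open>J\<close> is carried along the segment to a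
  small set near \<open>J\<close>.  A word whose inverse blows the ball up to a neighbourhood of \<open>J\<close> brings
  this set back into the ball; it takes time at least proportional to \<open>c \<rho> n\<close> and contracts at a
  uniform rate, so for large \<open>c\<close> the loop is a contraction of the ball, and Banach's theorem gives
  the periodic point.\<close>

lemma closing_contracting:
  assumes cec: "CEC_plus k g J" and acc: "Acc_plus k f J" and acc': "Acc_plus k g J"
    and J: "a \<in> J" "b \<in> J" "a \<noteq> b"
  obtains C where "0 < C" "\<And>\<rho> \<delta>. 0 < \<rho> \<Longrightarrow> 0 < \<delta> \<Longrightarrow> \<exists>n0. \<forall>w x.
    set w \<subseteq> {..<k} \<and> n0 \<le> length w \<and>
    (\<forall>i\<le>length w. log_deriv_sum f (take i w) x \<le> \<rho> * real (length w)) \<longrightarrow>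
    (\<exists>t p. shadowing_loop k f w x \<delta> (C * \<rho> * real (length w)) t p \<and> log_deriv_sum f (w @ t) p < 0)"
proof -
  interpret inv: circle_ifs k g f by (rule swap)
  obtain L1 where L1: "0 < L1" "\<And>i x. i < k \<Longrightarrow> \<bar>ln \<bar>circle_deriv (f i) x\<bar>\<bar> \<le> L1"
    using ln_deriv_bounded by blast
  obtain L2 where L2: "0 < L2" "\<And>i x. i < k \<Longrightarrow> \<bar>ln \<bar>circle_deriv (g i) x\<bar>\<bar> \<le> L2"
    using inv.ln_deriv_bounded by blast
  obtain A1 where A1: "\<And>x. \<exists>w. set w \<subseteq> {..<k} \<and> length w \<le> A1 \<and> x \<in> fold f w ` interior J"
    using Acc_plus_bounded[OF acc] by blast
  obtain A2 where A2: "\<And>x. \<exists>w. set w \<subseteq> {..<k} \<and> length w \<le> A2 \<and> x \<in> fold g w ` interior J"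
    using inv.Acc_plus_bounded[OF acc'] by blast
  define A where "A = real (max A1 A2)"
  obtain K1 K2 K3 K4 K5 where K: "0 < K1" "0 < K2" "0 < K3" "0 < K4" "0 < K5"
    and cec_ball: "\<And>y r. y \<in> J \<Longrightarrow> 0 < r \<Longrightarrow> r < K1 \<Longrightarrow> \<exists>w. set w \<subseteq> {..<k} \<and> w \<noteq> [] \<and>
      real (length w) \<le> K2 * (- ln r) + K3 \<and> circle_nbhd J K4 \<subseteq> fold g w ` cball y r \<and>
      (\<forall>z\<in>cball y r. real (length w) * K5 \<le> log_deriv_sum g w z) \<and>
      dist a b \<le> exp (L2 * real (length w)) * (2 * r)"
    by (rule inv.CEC_plus_cball[OF cec J(1,2) L2(2)]) (assumption | (rule that; assumption))+
  define C0 where "C0 = 3 + 3 * L2 / K5"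
  define C where "C = K2 * C0 + 1"
  have C0: "3 \<le> C0" "K5 / L2 * C0 \<ge> 3"
    using K L2 by (auto simp: C0_def field_simps)
  show ?thesis
  proof (rule that[of C])
    show "0 < C" using K C0 by (simp add: C_def add_pos_pos)
    fix \<rho> \<delta> :: real assume \<rho>: "0 < \<rho>" and \<delta>: "0 < \<delta>"
    define \<kappa> where "\<kappa> = min (1 / 4) (K4 / 2)"
    obtain d where d: "0 < d" "\<And>i x y. i < k \<Longrightarrow> dist x y \<le> d \<Longrightarrow>
        \<bar>ln \<bar>circle_deriv (f i) x\<bar> - ln \<bar>circle_deriv (f i) y\<bar>\<bar> \<le> \<rho>"
      using ln_deriv_uniform[OF \<rho>] by blast
    define \<delta>' where "\<delta>' = Min {\<delta>, d, 1 / 4, \<kappa> * exp (- L1 * A)}"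
    have \<kappa>: "0 < \<kappa>" "\<kappa> \<le> 1 / 4" "\<kappa> < K4" using K by (auto simp: \<kappa>_def)
    have \<delta>': "0 < \<delta>'" "\<delta>' \<le> \<delta>" "\<delta>' \<le> d" "\<delta>' \<le> 1 / 4" "\<delta>' \<le> \<kappa> * exp (- L1 * A)"
      using \<delta> d \<kappa> by (auto simp: \<delta>'_def)
    \<comment> \<open>lower bounds on \<open>\<rho> n\<close> under which the ball is small enough for the expansion axiom, the
      segment is shadowed, the contraction wins, and the bounded part of the loop is negligible\<close>
    define m1 where "m1 = - ln K1"
    define m2 where "m2 = L1 * A - ln \<delta>'"
    define m3 where "m3 = 2 * L1 * A - K5 / L2 * ln (dist a b / 2)"
    define m4 where "m4 = 2 * A + K3"
    define m where "m = Max {1, m1, m2, m3, m4}"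
    have m: "1 \<le> m" "m1 \<le> m" "m2 \<le> m" "m3 \<le> m" "m4 \<le> m" by (auto simp: m_def)
    define n0 where "n0 = nat \<lceil>m / \<rho>\<rceil> + 1"
    show "\<exists>n0. \<forall>w x.
      set w \<subseteq> {..<k} \<and> n0 \<le> length w \<and>
      (\<forall>i\<le>length w. log_deriv_sum f (take i w) x \<le> \<rho> * real (length w)) \<longrightarrow>
      (\<exists>t p. shadowing_loop k f w x \<delta> (C * \<rho> * real (length w)) t p \<and> log_deriv_sum f (w @ t) p < 0)"
    proof (intro exI[of _ n0] allI impI; elim conjE)
      fix w x
      assume w: "set w \<subseteq> {..<k}" and n0: "n0 \<le> length w"
        and S: "\<forall>i\<le>length w. log_deriv_sum f (take i w) x \<le> \<rho> * real (length w)"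
      define T where "T = \<rho> * real (length w)"
      have "m / \<rho> < real (length w)" using n0 unfolding n0_def by linarith
      then have T: "m < T" using \<rho> by (simp add: T_def field_simps)
      define r0 where "r0 = exp (- C0 * T)"
      define r where "r = exp (L1 * A) * r0"
      have "T \<le> C0 * T" using C0 T m(1) by simp
      then have "exp (- C0 * T) < exp (ln K1)" using m(2) T by (subst exp_less_cancel_iff) (simp add: m1_def)
      then have r0: "0 < r0" "r0 < K1" using K by (auto simp: r0_def)
      have r_pos: "0 < r" using r0 by (simp add: r_def)
      \<comment> \<open>the four pieces of the loop: into the segment, along it, back to \<open>J\<close>, and into the start\<close>
      obtain v y0 where v: "set v \<subseteq> {..<k}" "length v \<le> A1" "y0 \<in> J" "x = fold f v y0"
        using A1[of x] interior_subset by blast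
      obtain u' y1 where u': "set u' \<subseteq> {..<k}" "length u' \<le> A2" "y1 \<in> J" "fold f w x = fold g u' y1"
        using A2[of "fold f w x"] interior_subset by blast
      define u where "u = rev u'"
      have u: "set u \<subseteq> {..<k}" "length u \<le> A2" "fold f u (fold f w x) = y1"
        using u' inv.word_inverse[of u' y1] by (auto simp: u_def)
      obtain e' where e': "set e' \<subseteq> {..<k}" "real (length e') \<le> K2 * (- ln r0) + K3"
        "circle_nbhd J K4 \<subseteq> fold g e' ` cball y0 r0"
        "\<And>z. z \<in> cball y0 r0 \<Longrightarrow> real (length e') * K5 \<le> log_deriv_sum g e' z"
        "dist a b \<le> exp (L2 * real (length e')) * (2 * r0)"
        using cec_ball[OF v(3) r0] by blast
      define e where "e = rev e'"
      define N where "N = real (length e')"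
      have e: "set e \<subseteq> {..<k}" using e' by (simp add: e_def)
      have e_back: "fold f e z \<in> cball y0 r0 \<and> log_deriv_sum f e z \<le> - (N * K5)"
        if "z \<in> circle_nbhd J K4" for z
      proof -
        obtain q where q: "q \<in> cball y0 r0" "z = fold g e' q" using e'(3) \<open>z \<in> circle_nbhd J K4\<close> by blast
        then show ?thesis
          using e'(4)[OF q(1)] inv.word_inverse[OF e'(1), of q] inv.log_deriv_sum_inverse[OF e'(1), of q]
          by (simp add: e_def N_def)
      qed
      have ell: "2 * L1 * A + 2 * T < N * K5"
      proof -
        have "ln (dist a b) \<le> ln (exp (L2 * N) * (2 * r0))"
          using e'(5) J(3) r0 by (subst ln_le_cancel_iff) (auto simp: N_def)
        also have "\<dots> = L2 * N + ln 2 - C0 * T"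
          using r0 by (simp add: ln_mult r0_def)
        finally have "ln (dist a b / 2) + C0 * T \<le> L2 * N" using J(3) by (simp add: ln_div)
        then have "K5 / L2 * (ln (dist a b / 2) + C0 * T) \<le> K5 / L2 * (L2 * N)"
          using K L2 by (intro mult_left_mono) auto
        also have "\<dots> = N * K5" using L2 by simp
        finally have "K5 / L2 * ln (dist a b / 2) + K5 / L2 * C0 * T \<le> N * K5"
          by (simp add: distrib_left mult.assoc)
        moreover have "3 * T \<le> K5 / L2 * C0 * T" using C0(2) T m(1) by (intro mult_right_mono) auto
        ultimately show ?thesis using m(4) T unfolding m3_def by linarith
      qed
      have LA: "exp (L1 * real (length v)) \<le> exp (L1 * A)" "exp (L1 * real (length u)) \<le> exp (L1 * A)"
        using v(2) u(2) L1(1) by (auto simp: A_def)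
      have size: "r * exp (log_deriv_sum f (take i w) x + real i * \<rho>) \<le> r * exp (2 * T)"
        if "i \<le> length w" for i
      proof -
        have "real i * \<rho> \<le> T" using that \<rho> by (simp add: T_def mult.commute)
        then show ?thesis using S that r_pos by (auto simp: T_def[symmetric] intro!: mult_left_mono)
      qed
      have r_small: "r * exp (2 * T) \<le> \<delta>'"
      proof -
        have "3 * T \<le> C0 * T" using C0 T m(1) by (intro mult_right_mono) auto
        then have "L1 * A - C0 * T + 2 * T \<le> ln \<delta>'" using m(3) T unfolding m2_def by linarith
        then have "exp (L1 * A - C0 * T + 2 * T) \<le> \<delta>'" using \<delta>' by (metis exp_le_cancel_iff exp_ln)
        then show ?thesis by (simp add: r_def r0_def exp_add exp_diff exp_minus field_simps)
      qed
      have v_lip: "dist (fold f v y) (fold f v z) \<le> exp (L1 * A) * dist y z" for y z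
        using word_lipschitz[OF L1(2) v(1), of y z] mult_right_mono[OF LA(1), of "dist y z"] by simp
      have u_lip: "dist (fold f u y) (fold f u z) \<le> exp (L1 * A) * dist y z" for y z
        using word_lipschitz[OF L1(2) u(1), of y z] mult_right_mono[OF LA(2), of "dist y z"] by simp
      have v_in: "fold f v y \<in> cball x r" if "y \<in> cball y0 r0" for y
      proof -
        have "exp (L1 * A) * dist y0 y \<le> exp (L1 * A) * r0"
          using that by (intro mult_left_mono) auto
        from order_trans[OF v_lip[of y0 y] this] show ?thesis by (simp add: v(4) r_def)
      qed
      have shadow: "dist (fold f (take i w) y) (fold f (take i w) z) \<le> exp (2 * T) * dist y z
          \<and> \<bar>log_deriv_sum f (take i w) y - log_deriv_sum f (take i w) x\<bar> \<le> T"
        if yz: "y \<in> cball x r" "z \<in> cball x r" and i: "i \<le> length w" for y z i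
      proof -
        have sh: "dist (fold f (take i w) y) (fold f (take i w) z)
            \<le> exp (log_deriv_sum f (take i w) x + real (length (take i w)) * \<rho>) * dist y z
          \<and> \<bar>log_deriv_sum f (take i w) y - log_deriv_sum f (take i w) x\<bar> \<le> real (length (take i w)) * \<rho>"
        proof (rule word_shadowing[where \<delta> = \<delta>' and r = r])
          show "\<bar>ln \<bar>circle_deriv (f i) x\<bar> - ln \<bar>circle_deriv (f i) y\<bar>\<bar> \<le> \<rho>"
            if "i < k" "dist x y \<le> \<delta>'" for i x y using d(2) that \<delta>'(3) by auto
          show "set (take i w) \<subseteq> {..<k}" using w set_take_subset by fastforce
          show "r * exp (log_deriv_sum f (take j (take i w)) x + real j * \<rho>) \<le> \<delta>'"
            if "j \<le> length (take i w)" for j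
          proof -
            have j: "j \<le> i" "j \<le> length w" using that i by auto
            then have "take j (take i w) = take j w" by (simp add: min_def)
            then show ?thesis using size[OF j(2)] r_small by simp
          qed
        qed (use \<delta>' yz in auto)
        have "real (length (take i w)) * \<rho> \<le> T"
          using i \<rho> by (simp add: T_def mult.commute)
        moreover have "log_deriv_sum f (take i w) x \<le> T" using S i by (simp add: T_def)
        ultimately have "log_deriv_sum f (take i w) x + real (length (take i w)) * \<rho> \<le> 2 * T"
          by linarith
        then have "exp (log_deriv_sum f (take i w) x + real (length (take i w)) * \<rho>) * dist (y) (z)
            \<le> exp (2 * T) * dist y z"
          by (intro mult_right_mono) auto
        then show ?thesis using sh \<open>real (length (take i w)) * \<rho> \<le> T\<close> by linarith
      qed
      have x_in: "x \<in> cball x r" using r_pos by simp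
      have w_near: "dist (fold f w y) (fold f w x) \<le> \<delta>'" if "y \<in> cball x r" for y
      proof -
        have "dist (fold f w y) (fold f w x) \<le> exp (2 * T) * dist y x"
          using shadow[OF that x_in, of "length w"] by simp
        also have "\<dots> \<le> exp (2 * T) * r" using that by (intro mult_left_mono) (auto simp: dist_commute)
        finally show ?thesis using r_small by (simp add: mult.commute)
      qed
      have u_in: "fold f u (fold f w y) \<in> cball y1 \<kappa>" if "y \<in> cball x r" for y
      proof -
        have "dist (fold f u (fold f w x)) (fold f u (fold f w y)) \<le> exp (L1 * A) * \<delta>'"
          using u_lip[of "fold f w x" "fold f w y"] w_near[OF that]
          by (smt (verit) dist_commute exp_ge_zero mult_left_mono)
        also have "\<dots> \<le> exp (L1 * A) * (\<kappa> * exp (- L1 * A))" using \<delta>'(5) by (intro mult_left_mono) auto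
        also have "\<dots> = \<kappa>" by (simp add: exp_minus)
        finally show ?thesis by (simp add: u(3))
      qed
      have near_J: "z \<in> circle_nbhd J K4" if "z \<in> cball y1 \<kappa>" for z
        using that u'(3) \<kappa>(3) unfolding circle_nbhd_def by force
      have e_lip: "dist (fold f e y) (fold f e z) \<le> exp (- (N * K5)) * dist y z"
        if "y \<in> cball y1 \<kappa>" "z \<in> cball y1 \<kappa>" for y z
      proof (rule circle_mean_value_cball[OF that \<kappa>(2) word_deriv(1)[OF e]])
        fix s assume "s \<in> cball y1 \<kappa>"
        then show "\<bar>circle_deriv (fold f e) s\<bar> \<le> exp (- (N * K5))"
          using e_back[OF near_J] abs_word_deriv[OF e] by simp
      qed
      define G where "G y = fold f e (fold f u (fold f w (fold f v y)))" for y
      define c where "c = exp (2 * L1 * A + 2 * T - N * K5)"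
      have G_in: "G ` cball y0 r0 \<subseteq> cball y0 r0"
        unfolding G_def using e_back near_J u_in v_in by blast
      have G_lip: "dist (G y) (G z) \<le> c * dist y z" if "y \<in> cball y0 r0" "z \<in> cball y0 r0" for y z
      proof -
        note vy = v_in[OF that(1)] and vz = v_in[OF that(2)]
        have "dist (G y) (G z) \<le> exp (- (N * K5)) *
            dist (fold f u (fold f w (fold f v y))) (fold f u (fold f w (fold f v z)))"
          unfolding G_def by (rule e_lip[OF u_in[OF vy] u_in[OF vz]])
        also have "\<dots> \<le> exp (- (N * K5)) * (exp (L1 * A) *
            dist (fold f w (fold f v y)) (fold f w (fold f v z)))"
          by (intro mult_left_mono u_lip) auto
        also have "\<dots> \<le> exp (- (N * K5)) * (exp (L1 * A) * (exp (2 * T) * dist (fold f v y) (fold f v z)))"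
          using shadow[OF vy vz, of "length w"] by (intro mult_left_mono) auto
        also have "\<dots> \<le> exp (- (N * K5)) * (exp (L1 * A) * (exp (2 * T) * (exp (L1 * A) * dist y z)))"
          by (intro mult_left_mono v_lip) auto
        also have "\<dots> = c * dist y z"
          by (simp add: c_def exp_add exp_diff exp_minus field_simps) (simp add: exp_add[symmetric])
        finally show ?thesis .
      qed
      have "compact (cball y0 r0)"
        using closed_Int_compact[OF closed_cball compact_circle, of y0 r0] by simp
      note compact_imp_complete[OF this]
      moreover have "cball y0 r0 \<noteq> {}" using r0 by simp
      moreover have "0 \<le> c" "c < 1" using ell by (auto simp: c_def)
      ultimately obtain y where y: "y \<in> cball y0 r0" "G y = y"
        using Banach_fix[of "cball y0 r0" c G] G_in G_lip by metis
      define p where "p = fold f v y"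
      define t where "t = u @ e @ v"
      have p_in: "p \<in> cball x r" unfolding p_def by (rule v_in[OF y(1)])
      have "fold f (w @ t) p = p"
        using y(2) by (simp add: t_def p_def G_def)
      moreover have "real (length t) \<le> C * \<rho> * real (length w)"
      proof -
        have "real (length t) \<le> 2 * A + (K2 * (C0 * T) + K3)"
          using u(2) v(2) e'(2) by (simp add: t_def e_def A_def r0_def)
        also have "\<dots> \<le> K2 * (C0 * T) + T" using m(5) T by (simp add: m4_def)
        also have "\<dots> = C * \<rho> * real (length w)" by (simp add: C_def T_def algebra_simps)
        finally show ?thesis .
      qed
      moreover have "log_deriv_sum f (w @ t) p < 0"
      proof -
        define q where "q = fold f u (fold f w p)"
        have q: "q \<in> circle_nbhd J K4" unfolding q_def by (rule near_J[OF u_in[OF p_in]])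
        have "log_deriv_sum f w p \<le> 2 * T"
          using shadow[OF p_in x_in, of "length w"] S by (auto simp: T_def abs_le_iff)
        moreover have "L1 * real (length u) \<le> L1 * A" "L1 * real (length v) \<le> L1 * A"
          using u(2) v(2) L1(1) by (auto simp: A_def)
        then have "log_deriv_sum f u (fold f w p) \<le> L1 * A"
          "log_deriv_sum f v (fold f e q) \<le> L1 * A"
          using abs_log_deriv_sum_le[OF L1(2) u(1), of "fold f w p"]
            abs_log_deriv_sum_le[OF L1(2) v(1), of "fold f e q"] by (auto simp: abs_le_iff)
        moreover have "log_deriv_sum f e q \<le> - (N * K5)" using e_back[OF q] by blast
        ultimately show ?thesis
          using ell by (simp add: t_def log_deriv_sum_append q_def)
      qed
      moreover have "dist (fold f (take i w) p) (fold f (take i w) x) \<le> \<delta>" if "i \<le> length w" for i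
      proof -
        have "dist (fold f (take i w) p) (fold f (take i w) x) \<le> exp (2 * T) * dist p x"
          using shadow[OF p_in x_in that] by simp
        also have "\<dots> \<le> exp (2 * T) * r" using p_in by (intro mult_left_mono) (auto simp: dist_commute)
        finally show ?thesis using r_small \<delta>'(2) by (simp add: mult.commute)
      qed
      moreover have "set t \<subseteq> {..<k}" using u v e by (auto simp: t_def)
      ultimately show "\<exists>t p. shadowing_loop k f w x \<delta> (C * \<rho> * real (length w)) t p \<and> log_deriv_sum f (w @ t) p < 0"
        unfolding shadowing_loop_def by blast
    qed
  qed
qed

lemma word_partial_inverse:
  assumes "set w \<subseteq> {..<k}" "m \<le> length w"
  shows "fold g (take (length w - m) (rev w)) (fold f w y) = fold f (take m w) y"
    and "log_deriv_sum g (take (length w - m) (rev w)) (fold f w y)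
      = log_deriv_sum f (take m w) y - log_deriv_sum f w y"
proof -
  have d: "set (drop m w) \<subseteq> {..<k}" using assms(1) set_drop_subset by fastforce
  have t: "take (length w - m) (rev w) = rev (drop m w)" using assms(2) by (simp add: take_rev)
  have split: "fold f w y = fold f (drop m w) (fold f (take m w) y)"
    by (metis append_take_drop_id comp_apply fold_append)
  show "fold g (take (length w - m) (rev w)) (fold f w y) = fold f (take m w) y"
    unfolding t split by (rule word_inverse[OF d])
  have "log_deriv_sum g (take (length w - m) (rev w)) (fold f w y)
      = - log_deriv_sum f (drop m w) (fold f (take m w) y)"
    unfolding t split by (rule log_deriv_sum_inverse[OF d])
  moreover have "log_deriv_sum f w y
      = log_deriv_sum f (take m w) y + log_deriv_sum f (drop m w) (fold f (take m w) y)"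
    using log_deriv_sum_append[of f "take m w" "drop m w" y] by simp
  ultimately show "log_deriv_sum g (take (length w - m) (rev w)) (fold f w y)
      = log_deriv_sum f (take m w) y - log_deriv_sum f w y" by simp
qed

text \<open>A shadowing loop of the inverse family along the reversed word, read backwards.\<close>

lemma shadowing_loop_inverse:
  assumes w: "set w \<subseteq> {..<k}" and loop: "shadowing_loop k g (rev w) (fold f w x) \<delta> m t q"
  defines "p \<equiv> fold g (rev w) q"
  shows "shadowing_loop k f w x \<delta> m (rev t) p"
    and "log_deriv_sum f (w @ rev t) p = - log_deriv_sum g (rev w @ t) q"
proof -
  interpret inv: circle_ifs k g f by (rule swap)
  have t: "set t \<subseteq> {..<k}" and fix_q: "fold g t p = q"
    and len: "real (length t) \<le> m"
    and close: "\<And>i. i \<le> length w \<Longrightarrow>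
      dist (fold g (take i (rev w)) q) (fold g (take i (rev w)) (fold f w x)) \<le> \<delta>"
    using loop unfolding shadowing_loop_def p_def by auto
  have wp: "fold f w p = q" using inv.word_inverse[of "rev w" q] w by (simp add: p_def)
  have tq: "fold f (rev t) q = p" using inv.word_inverse[OF t, of p] by (simp add: fix_q)
  have "dist (fold f (take i w) p) (fold f (take i w) x) \<le> \<delta>" if "i \<le> length w" for i
    using close[of "length w - i"] word_partial_inverse(1)[OF w that, of p]
      word_partial_inverse(1)[OF w that, of x] wp by simp
  then show "shadowing_loop k f w x \<delta> m (rev t) p"
    unfolding shadowing_loop_def using t len wp tq by simp
  have "log_deriv_sum f w p = - log_deriv_sum g (rev w) q"
    using log_deriv_sum_inverse[OF w, of p] wp by simp
  moreover have "log_deriv_sum f (rev t) q = - log_deriv_sum g t p"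
    using inv.log_deriv_sum_inverse[OF t, of p] fix_q by simp
  ultimately show "log_deriv_sum f (w @ rev t) p = - log_deriv_sum g (rev w @ t) q"
    by (simp add: log_deriv_sum_append wp p_def[symmetric])
qed

text \<open>Closing with either sign; the repelling loops are attracting loops of the inverse family
  along the reversed segment.\<close>

lemma closing:
  assumes cec: "CEC_plus k f J" and cec': "CEC_plus k g J"
    and acc: "Acc_plus k f J" and acc': "Acc_plus k g J"
    and J: "a \<in> J" "b \<in> J" "a \<noteq> b"
  obtains C where "0 < C" "\<And>\<rho> \<delta>. 0 < \<rho> \<Longrightarrow> 0 < \<delta> \<Longrightarrow> \<exists>n0. \<forall>w x.
    set w \<subseteq> {..<k} \<and> n0 \<le> length w \<and>
    (\<forall>i\<le>length w. \<bar>log_deriv_sum f (take i w) x\<bar> \<le> \<rho> * real (length w)) \<longrightarrow>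
    (\<exists>t p. shadowing_loop k f w x \<delta> (C * \<rho> * real (length w)) t p \<and> log_deriv_sum f (w @ t) p < 0) \<and>
    (\<exists>t p. shadowing_loop k f w x \<delta> (C * \<rho> * real (length w)) t p \<and> log_deriv_sum f (w @ t) p > 0)"
proof -
  interpret inv: circle_ifs k g f by (rule swap)
  obtain C1 where C1: "0 < C1" "\<And>\<rho> \<delta>. 0 < \<rho> \<Longrightarrow> 0 < \<delta> \<Longrightarrow> \<exists>n0. \<forall>w x.
    set w \<subseteq> {..<k} \<and> n0 \<le> length w \<and>
    (\<forall>i\<le>length w. log_deriv_sum f (take i w) x \<le> \<rho> * real (length w)) \<longrightarrow>
    (\<exists>t p. shadowing_loop k f w x \<delta> (C1 * \<rho> * real (length w)) t p \<and> log_deriv_sum f (w @ t) p < 0)"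
    by (rule closing_contracting[OF cec' acc acc' J]) (rule that; assumption)
  obtain C2 where C2: "0 < C2" "\<And>\<rho> \<delta>. 0 < \<rho> \<Longrightarrow> 0 < \<delta> \<Longrightarrow> \<exists>n0. \<forall>w x.
    set w \<subseteq> {..<k} \<and> n0 \<le> length w \<and>
    (\<forall>i\<le>length w. log_deriv_sum g (take i w) x \<le> \<rho> * real (length w)) \<longrightarrow>
    (\<exists>t p. shadowing_loop k g w x \<delta> (C2 * \<rho> * real (length w)) t p \<and> log_deriv_sum g (w @ t) p < 0)"
    by (rule inv.closing_contracting[OF cec acc' acc J]) (rule that; assumption)
  define C where "C = max C1 (2 * C2)"
  have mono: "shadowing_loop k f w x \<delta> m t p \<Longrightarrow> m \<le> m' \<Longrightarrow> shadowing_loop k f w x \<delta> m' t p"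
    for w x \<delta> m m' t p unfolding shadowing_loop_def by auto
  show ?thesis
  proof (rule that[of C])
    show "0 < C" using C1(1) by (simp add: C_def)
    fix \<rho> \<delta> :: real assume \<rho>: "0 < \<rho>" and \<delta>: "0 < \<delta>"
    obtain n1 where n1: "\<And>w x. set w \<subseteq> {..<k} \<Longrightarrow> n1 \<le> length w \<Longrightarrow>
      (\<forall>i\<le>length w. log_deriv_sum f (take i w) x \<le> \<rho> * real (length w)) \<Longrightarrow>
      (\<exists>t p. shadowing_loop k f w x \<delta> (C1 * \<rho> * real (length w)) t p \<and> log_deriv_sum f (w @ t) p < 0)"
      using C1(2)[OF \<rho> \<delta>] by metis
    obtain n2 where n2: "\<And>w x. set w \<subseteq> {..<k} \<Longrightarrow> n2 \<le> length w \<Longrightarrow>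
      (\<forall>i\<le>length w. log_deriv_sum g (take i w) x \<le> 2 * \<rho> * real (length w)) \<Longrightarrow>
      (\<exists>t p. shadowing_loop k g w x \<delta> (C2 * (2 * \<rho>) * real (length w)) t p \<and> log_deriv_sum g (w @ t) p < 0)"
      using C2(2)[of "2 * \<rho>" \<delta>] \<rho> \<delta> by (metis mult_pos_pos zero_less_numeral)
    have "(\<exists>t p. shadowing_loop k f w x \<delta> (C * \<rho> * real (length w)) t p \<and> log_deriv_sum f (w @ t) p < 0) \<and>
      (\<exists>t p. shadowing_loop k f w x \<delta> (C * \<rho> * real (length w)) t p \<and> log_deriv_sum f (w @ t) p > 0)"
      if w: "set w \<subseteq> {..<k}" and n: "max n1 n2 \<le> length w"
        and S: "\<forall>i\<le>length w. \<bar>log_deriv_sum f (take i w) x\<bar> \<le> \<rho> * real (length w)" for w x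
    proof
      have le: "C1 * \<rho> * real (length w) \<le> C * \<rho> * real (length w)"
        "C2 * (2 * \<rho>) * real (length w) \<le> C * \<rho> * real (length w)"
      proof -
        have "C1 * (\<rho> * real (length w)) \<le> C * (\<rho> * real (length w))"
          "(2 * C2) * (\<rho> * real (length w)) \<le> C * (\<rho> * real (length w))"
          by (rule mult_right_mono; use \<rho> in \<open>simp add: C_def\<close>)+
        then show "C1 * \<rho> * real (length w) \<le> C * \<rho> * real (length w)"
          "C2 * (2 * \<rho>) * real (length w) \<le> C * \<rho> * real (length w)"
          by (simp_all add: mult_ac)
      qed
      show "\<exists>t p. shadowing_loop k f w x \<delta> (C * \<rho> * real (length w)) t p \<and> log_deriv_sum f (w @ t) p < 0"
        using n1[OF w, of x] n S mono[OF _ le(1)] by (metis abs_le_iff max.bounded_iff)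
      have "log_deriv_sum g (take i (rev w)) (fold f w x) \<le> 2 * \<rho> * real (length (rev w))"
        if "i \<le> length (rev w)" for i
      proof -
        have "log_deriv_sum g (take i (rev w)) (fold f w x)
            = log_deriv_sum f (take (length w - i) w) x - log_deriv_sum f (take (length w) w) x"
          using word_partial_inverse(2)[OF w, of "length w - i" x] that by simp
        also have "\<dots> \<le> \<rho> * real (length w) + \<rho> * real (length w)"
          using S[THEN spec, of "length w - i"] S[THEN spec, of "length w"] by linarith
        finally show ?thesis by simp
      qed
      then obtain t q where tq: "shadowing_loop k g (rev w) (fold f w x) \<delta> (C2 * (2 * \<rho>) * real (length w)) t q"
        "log_deriv_sum g (rev w @ t) q < 0"
        using n2[of "rev w" "fold f w x"] w n by auto
      show "\<exists>t p. shadowing_loop k f w x \<delta> (C * \<rho> * real (length w)) t p \<and> log_deriv_sum f (w @ t) p > 0"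
        using mono[OF shadowing_loop_inverse(1)[OF w tq(1)] le(2)]
          shadowing_loop_inverse(2)[OF w tq(1)] tq(2) by (metis neg_0_less_iff_less)
    qed
    then show "\<exists>n0. \<forall>w x. set w \<subseteq> {..<k} \<and> n0 \<le> length w \<and>
      (\<forall>i\<le>length w. \<bar>log_deriv_sum f (take i w) x\<bar> \<le> \<rho> * real (length w)) \<longrightarrow>
      (\<exists>t p. shadowing_loop k f w x \<delta> (C * \<rho> * real (length w)) t p \<and> log_deriv_sum f (w @ t) p < 0) \<and>
      (\<exists>t p. shadowing_loop k f w x \<delta> (C * \<rho> * real (length w)) t p \<and> log_deriv_sum f (w @ t) p > 0)"
      by (intro exI[of _ "max n1 n2"] allI impI; elim conjE; blast)
  qed
qed

end

section \<open>Orbits with bounded derivative sums\<close>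

text \<open>A ball small enough that every word blowing it up to size \<open>d\<close> is long; the expansion gained
  along such a word, of length \<open>N\<close>, outweighs a preceding loss of \<open>L * A\<close>.\<close>

lemma radius_for_long_word:
  fixes d K K5 L A :: real
  assumes "0 < d" "0 < K" "0 < K5" "0 < L"
  obtains r where "0 < r" "r < K" "\<And>N. d \<le> exp (L * N) * (2 * r) \<Longrightarrow> L * A \<le> N * K5"
proof
  define r where "r = min (K / 2) (d / 2 * exp (- (L * (L * A / K5))))"
  show "0 < r" "r < K" using assms by (auto simp: r_def)
  fix N assume "d \<le> exp (L * N) * (2 * r)"
  also have "\<dots> \<le> exp (L * N) * (d * exp (- (L * (L * A / K5))))"
    by (intro mult_left_mono) (auto simp: r_def)
  also have "\<dots> = d * exp (L * N - L * (L * A / K5))" by (simp add: exp_diff exp_minus field_simps)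
  finally have "1 \<le> exp (L * N - L * (L * A / K5))" using assms(1) by simp
  then have "L * (L * A / K5) \<le> L * N" by simp
  then have "L * A / K5 \<le> N" using assms(4) by (meson mult_le_cancel_left_pos)
  then show "L * A \<le> N * K5" using assms(3) by (simp add: pos_divide_le_eq)
qed

context circle_ifs
begin

lemma bounded_words_into:
  assumes "Acc_plus k g J"
  obtains A where "\<And>x. \<exists>u. set u \<subseteq> {..<k} \<and> length u \<le> A \<and> fold f u x \<in> J"
proof -
  interpret inv: circle_ifs k g f by (rule swap)
  obtain A :: nat where A: "\<And>x. \<exists>w. set w \<subseteq> {..<k} \<and> length w \<le> A \<and> x \<in> fold g w ` interior J"
    using inv.Acc_plus_bounded[OF assms] by blast
  have "\<exists>u. set u \<subseteq> {..<k} \<and> length u \<le> A \<and> fold f u x \<in> J" for x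
  proof -
    obtain w y where w: "set w \<subseteq> {..<k}" "length w \<le> A" "x = fold g w y" "y \<in> interior J"
      using A[of x] by blast
    then have "fold f (rev w) x \<in> J"
      using inv.word_inverse[OF w(1), of y] interior_subset[of J] by auto
    then show ?thesis using w by (intro exI[of _ "rev w"]) auto
  qed
  then show ?thesis by (rule that)
qed

lemma bounded_expanding_words:
  assumes cec: "CEC_plus k f J" and acc: "Acc_plus k g J" and J: "a \<in> J" "b \<in> J" "a \<noteq> b"
  obtains m :: nat where "\<And>x. \<exists>w. set w \<subseteq> {..<k} \<and> w \<noteq> [] \<and> length w \<le> m \<and> 0 \<le> log_deriv_sum f w x"
proof -
  obtain L where L: "0 < L" "\<And>i x. i < k \<Longrightarrow> \<bar>ln \<bar>circle_deriv (f i) x\<bar>\<bar> \<le> L"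
    using ln_deriv_bounded by blast
  obtain A where A: "\<And>x. \<exists>u. set u \<subseteq> {..<k} \<and> length u \<le> A \<and> fold f u x \<in> J"
    using bounded_words_into[OF acc] by blast
  obtain K1 K2 K3 K4 K5 where K: "0 < K1" "0 < K2" "0 < K3" "0 < K4" "0 < K5"
    and cec_ball: "\<And>y r. y \<in> J \<Longrightarrow> 0 < r \<Longrightarrow> r < K1 \<Longrightarrow> \<exists>w. set w \<subseteq> {..<k} \<and> w \<noteq> [] \<and>
      real (length w) \<le> K2 * (- ln r) + K3 \<and> circle_nbhd J K4 \<subseteq> fold f w ` cball y r \<and>
      (\<forall>z\<in>cball y r. real (length w) * K5 \<le> log_deriv_sum f w z) \<and>
      dist a b \<le> exp (L * real (length w)) * (2 * r)"
    by (rule CEC_plus_cball[OF cec J(1,2) L(2)]) (assumption | (rule that; assumption))+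
  obtain r where r: "0 < r" "r < K1"
    "\<And>N. dist a b \<le> exp (L * N) * (2 * r) \<Longrightarrow> L * real A \<le> N * K5"
    by (rule radius_for_long_word[of "dist a b" K1 K5 L "real A"]) (use J K L in auto)
  define m where "m = A + nat \<lceil>K2 * (- ln r) + K3\<rceil>"
  have "\<exists>w. set w \<subseteq> {..<k} \<and> w \<noteq> [] \<and> length w \<le> m \<and> 0 \<le> log_deriv_sum f w x" for x
  proof -
    obtain u where u: "set u \<subseteq> {..<k}" "length u \<le> A" "fold f u x \<in> J" using A by blast
    obtain w where w: "set w \<subseteq> {..<k}" "w \<noteq> []" "real (length w) \<le> K2 * (- ln r) + K3"
      "\<And>z. z \<in> cball (fold f u x) r \<Longrightarrow> real (length w) * K5 \<le> log_deriv_sum f w z"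
      "dist a b \<le> exp (L * real (length w)) * (2 * r)"
      using cec_ball[OF u(3) r(1,2)] by blast
    have "L * real A \<le> log_deriv_sum f w (fold f u x)"
      using r(3)[OF w(5)] w(4)[of "fold f u x"] r(1) by simp
    moreover have "L * real (length u) \<le> L * real A" using u(2) L(1) by simp
    then have "- (L * real A) \<le> log_deriv_sum f u x"
      using abs_log_deriv_sum_le[OF L(2) u(1), of x] by (simp add: abs_le_iff)
    moreover have "length w \<le> nat \<lceil>K2 * (- ln r) + K3\<rceil>" using w(3) by linarith
    ultimately show ?thesis using u w
      by (intro exI[of _ "u @ w"]) (auto simp: log_deriv_sum_append m_def)
  qed
  then show ?thesis by (rule that)
qed

lemma bounded_contracting_words:
  assumes cec: "CEC_plus k g J" and acc: "Acc_plus k g J" and J: "a \<in> J" "b \<in> J" "a \<noteq> b"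
  obtains m :: nat where "\<And>x. \<exists>w. set w \<subseteq> {..<k} \<and> w \<noteq> [] \<and> length w \<le> m \<and> log_deriv_sum f w x \<le> 0"
proof -
  interpret inv: circle_ifs k g f by (rule swap)
  obtain L1 where L1: "0 < L1" "\<And>i x. i < k \<Longrightarrow> \<bar>ln \<bar>circle_deriv (f i) x\<bar>\<bar> \<le> L1"
    using ln_deriv_bounded by blast
  obtain L2 where L2: "0 < L2" "\<And>i x. i < k \<Longrightarrow> \<bar>ln \<bar>circle_deriv (g i) x\<bar>\<bar> \<le> L2"
    using inv.ln_deriv_bounded by blast
  define L where "L = max L1 L2"
  have L: "0 < L" "\<And>i x. i < k \<Longrightarrow> \<bar>ln \<bar>circle_deriv (f i) x\<bar>\<bar> \<le> L"
    "\<And>i x. i < k \<Longrightarrow> \<bar>ln \<bar>circle_deriv (g i) x\<bar>\<bar> \<le> L"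
    using L1 L2 by (auto simp: L_def le_max_iff_disj)
  obtain A where A: "\<And>x. \<exists>u. set u \<subseteq> {..<k} \<and> length u \<le> A \<and> fold f u x \<in> J"
    using bounded_words_into[OF acc] by blast
  obtain K1 K2 K3 K4 K5 where K: "0 < K1" "0 < K2" "0 < K3" "0 < K4" "0 < K5"
    and cec_ball: "\<And>y r. y \<in> J \<Longrightarrow> 0 < r \<Longrightarrow> r < K1 \<Longrightarrow> \<exists>w. set w \<subseteq> {..<k} \<and> w \<noteq> [] \<and>
      real (length w) \<le> K2 * (- ln r) + K3 \<and> circle_nbhd J K4 \<subseteq> fold g w ` cball y r \<and>
      (\<forall>z\<in>cball y r. real (length w) * K5 \<le> log_deriv_sum g w z) \<and>
      dist a b \<le> exp (L * real (length w)) * (2 * r)"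
    by (rule inv.CEC_plus_cball[OF cec J(1,2) L(3)]) (assumption | (rule that; assumption))+
  obtain r where r: "0 < r" "r < K1"
    "\<And>N. dist a b \<le> exp (L * N) * (2 * r) \<Longrightarrow> L * real A \<le> N * K5"
    by (rule radius_for_long_word[of "dist a b" K1 K5 L "real A"]) (use J K L in auto)
  obtain e where e: "set e \<subseteq> {..<k}" "e \<noteq> []" "circle_nbhd J K4 \<subseteq> fold g e ` cball a r"
      "\<And>z. z \<in> cball a r \<Longrightarrow> real (length e) * K5 \<le> log_deriv_sum g e z"
      "dist a b \<le> exp (L * real (length e)) * (2 * r)"
    using cec_ball[OF J(1) r(1,2)] by blast
  have "\<exists>w. set w \<subseteq> {..<k} \<and> w \<noteq> [] \<and> length w \<le> A + length e \<and> log_deriv_sum f w x \<le> 0" for x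
  proof -
    obtain u where u: "set u \<subseteq> {..<k}" "length u \<le> A" "fold f u x \<in> J" using A by blast
    have "fold f u x \<in> circle_nbhd J K4" using u(3) K(4) unfolding circle_nbhd_def by force
    then obtain z where z: "z \<in> cball a r" "fold f u x = fold g e z" using e(3) by blast
    have "log_deriv_sum f (rev e) (fold f u x) \<le> - (L * real A)"
      using inv.log_deriv_sum_inverse[OF e(1), of z] e(4)[OF z(1)] r(3)[OF e(5)] z(2) by simp
    moreover have "L * real (length u) \<le> L * real A" using u(2) L(1) by simp
    then have "log_deriv_sum f u x \<le> L * real A"
      using abs_log_deriv_sum_le[OF L(2) u(1), of x] by (simp add: abs_le_iff)
    ultimately show ?thesis using u e
      by (intro exI[of _ "u @ rev e"]) (auto simp: log_deriv_sum_append)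
  qed
  then show ?thesis by (rule that)
qed

text \<open>Appending expanding words while the accumulated sum is negative and contracting words
  while it is not keeps all partial sums bounded.\<close>

lemma bounded_sum_orbits:
  assumes "CEC_plus k f J" "CEC_plus k g J" "Acc_plus k g J" "a \<in> J" "b \<in> J" "a \<noteq> b"
  obtains B where "\<And>n. \<exists>w. set w \<subseteq> {..<k} \<and> n \<le> length w \<and>
    (\<forall>i\<le>length w. \<bar>log_deriv_sum f (take i w) x\<bar> \<le> B)"
proof -
  obtain L where L: "0 < L" "\<And>i x. i < k \<Longrightarrow> \<bar>ln \<bar>circle_deriv (f i) x\<bar>\<bar> \<le> L"
    using ln_deriv_bounded by blast
  obtain m1 where m1: "\<And>x. \<exists>w. set w \<subseteq> {..<k} \<and> w \<noteq> [] \<and> length w \<le> m1 \<and> 0 \<le> log_deriv_sum f w x"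
    using bounded_expanding_words[OF assms(1,3-6)] by blast
  obtain m2 where m2: "\<And>x. \<exists>w. set w \<subseteq> {..<k} \<and> w \<noteq> [] \<and> length w \<le> m2 \<and> log_deriv_sum f w x \<le> 0"
    using bounded_contracting_words[OF assms(2-6)] by blast
  define D where "D = L * real (max m1 m2)"
  have D: "\<bar>log_deriv_sum f v y\<bar> \<le> D" if "set v \<subseteq> {..<k}" "length v \<le> max m1 m2" for v y
  proof -
    have "L * real (length v) \<le> D" unfolding D_def using that(2) L(1) by (intro mult_left_mono) auto
    then show ?thesis using abs_log_deriv_sum_le[OF L(2) that(1), of y] by linarith
  qed
  have "\<exists>w. set w \<subseteq> {..<k} \<and> n \<le> length w \<and> \<bar>log_deriv_sum f w x\<bar> \<le> D \<and>
      (\<forall>i\<le>length w. \<bar>log_deriv_sum f (take i w) x\<bar> \<le> 2 * D)" for n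
  proof (induction n)
    case 0
    show ?case using L(1) by (intro exI[of _ "[]"]) (auto simp: D_def)
  next
    case (Suc n)
    then obtain w where w: "set w \<subseteq> {..<k}" "n \<le> length w" "\<bar>log_deriv_sum f w x\<bar> \<le> D"
      "\<And>i. i \<le> length w \<Longrightarrow> \<bar>log_deriv_sum f (take i w) x\<bar> \<le> 2 * D" by blast
    let ?y = "fold f w x"
    obtain v where v: "set v \<subseteq> {..<k}" "v \<noteq> []" "length v \<le> max m1 m2"
      "log_deriv_sum f w x < 0 \<Longrightarrow> 0 \<le> log_deriv_sum f v ?y"
      "0 \<le> log_deriv_sum f w x \<Longrightarrow> log_deriv_sum f v ?y \<le> 0"
      using m1[of ?y] m2[of ?y] by (cases "log_deriv_sum f w x < 0") (auto simp: le_max_iff_disj)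
    have "\<bar>log_deriv_sum f (take i (w @ v)) x\<bar> \<le> 2 * D" if "i \<le> length (w @ v)" for i
    proof (cases "i \<le> length w")
      case False
      have "set (take (i - length w) v) \<subseteq> {..<k}" using v(1) set_take_subset by fastforce
      then have "\<bar>log_deriv_sum f (take (i - length w) v) ?y\<bar> \<le> D"
        using v(3) by (intro D) auto
      then show ?thesis using False w(3) by (simp add: log_deriv_sum_append)
    qed (use w(4) in simp)
    moreover have "\<bar>log_deriv_sum f (w @ v) x\<bar> \<le> D"
      using D[OF v(1,3), of ?y] w(3) v(4,5) by (simp add: log_deriv_sum_append) linarith
    moreover have "Suc n \<le> length (w @ v)" using w(2) v(2) by (cases v) auto
    ultimately show ?case using w(1) v(1) by (intro exI[of _ "w @ v"]) auto
  qed
  then show ?thesis by (intro that[of "2 * D"]) blast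
qed

end

section \<open>The phase space and the skew product\<close>

lemma compact_Sigma_seq: "compact (Sigma_seq k)"
proof -
  have "Sigma_seq k = Pi\<^sub>E UNIV (\<lambda>_. {..<k})" by (auto simp: Sigma_seq_def)
  moreover have "compactin (product_topology (\<lambda>_ :: int. euclidean) UNIV) (Pi\<^sub>E UNIV (\<lambda>_. {..<k}))"
    by (subst compactin_PiE) (auto intro: finite_imp_compact)
  ultimately show ?thesis
    unfolding euclidean_product_topology by simp
qed

lemma compact_phase_space: "compact (phase_space k)"
  unfolding phase_space_def by (intro compact_Times compact_Sigma_seq compact_circle)

lemma continuous_on_phase_space_bounded:
  fixes g :: "(int \<Rightarrow> nat) \<times> circle \<Rightarrow> real"
  assumes "continuous_on (phase_space k) g"
  obtains B where "0 < B" "\<And>z. z \<in> phase_space k \<Longrightarrow> \<bar>g z\<bar> \<le> B"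
proof -
  have "bounded (g ` phase_space k)"
    by (intro compact_imp_bounded compact_continuous_image assms compact_phase_space)
  then show ?thesis using that unfolding bounded_pos by auto
qed

lemma continuous_on_letter:
  fixes h :: "nat \<Rightarrow> circle \<Rightarrow> 'b::topological_space"
  assumes "\<And>i. i < k \<Longrightarrow> continuous_on UNIV (h i)"
  shows "continuous_on (phase_space k) (\<lambda>z. h (fst z 0) (snd z))"
  unfolding continuous_on_def
proof
  fix z :: "(int \<Rightarrow> nat) \<times> circle" assume z: "z \<in> phase_space k"
  have "continuous_on UNIV (\<lambda>\<xi> :: int \<Rightarrow> nat. \<xi> 0)"
    by (rule continuous_on_product_coordinates)
  then have "((\<lambda>z. fst z (0 :: int) :: nat) \<longlongrightarrow> fst z 0) (at z within phase_space k)"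
    using continuous_on_compose2[OF _ continuous_on_fst[OF continuous_on_id], of UNIV "\<lambda>\<xi>. \<xi> 0" "phase_space k"] z
    unfolding continuous_on_def by auto
  then have ev: "\<forall>\<^sub>F y in at z within phase_space k. fst y 0 = fst z 0"
    by (rule tendsto_discrete[THEN iffD1])
  have "fst z 0 < k" using z by (auto simp: phase_space_def Sigma_seq_def)
  then have "continuous_on (phase_space k) (\<lambda>y. h (fst z 0) (snd y))"
    using continuous_on_compose2[OF assms continuous_on_snd[OF continuous_on_id]] by auto
  then have "((\<lambda>y. h (fst z 0) (snd y)) \<longlongrightarrow> h (fst z 0) (snd z)) (at z within phase_space k)"
    using z unfolding continuous_on_def by blast
  then show "((\<lambda>y. h (fst y 0) (snd y)) \<longlongrightarrow> h (fst z 0) (snd z)) (at z within phase_space k)"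
    by (rule Lim_transform_eventually) (use ev in eventually_elim, simp)
qed

text \<open>Uniform continuity in terms of the coordinates: two points are close as soon as the
  sequences agree on a long window around \<open>0\<close> and the fibre coordinates are close.\<close>

lemma phase_space_modulus:
  fixes g :: "(int \<Rightarrow> nat) \<times> circle \<Rightarrow> real"
  assumes "continuous_on (phase_space k) g" "0 < e"
  obtains m :: nat and d where "0 < d"
    "\<And>z z'. z \<in> phase_space k \<Longrightarrow> z' \<in> phase_space k \<Longrightarrow>
      (\<And>i. \<bar>i\<bar> \<le> int m \<Longrightarrow> fst z i = fst z' i) \<Longrightarrow> dist (snd z) (snd z') \<le> d \<Longrightarrow> \<bar>g z - g z'\<bar> \<le> e"
proof -
  \<comment> \<open>regard the symbols as real numbers, to use the product metric on \<open>int \<Rightarrow> real\<close>\<close>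
  define \<phi> where "\<phi> z = ((\<lambda>i. real (fst z i)), snd z)" for z :: "(int \<Rightarrow> nat) \<times> circle"
  define \<psi> where "\<psi> w = ((\<lambda>i. nat \<lfloor>fst w i\<rfloor>), snd w)" for w :: "(int \<Rightarrow> real) \<times> circle"
  have \<psi>\<phi>: "\<psi> (\<phi> z) = z" for z by (simp add: \<phi>_def \<psi>_def)
  have "continuous_on (phase_space k) (\<lambda>z. real (fst z i))" for i
  proof (rule continuous_on_compose2[of UNIV real])
    show "continuous_on (phase_space k) (\<lambda>z. fst z i)"
      by (rule continuous_on_compose2[OF continuous_on_product_coordinates continuous_on_fst[OF continuous_on_id]]) simp
  qed auto
  then have \<phi>: "continuous_on (phase_space k) \<phi>"
    unfolding \<phi>_def by (intro continuous_on_Pair continuous_on_coordinatewise_then_product continuous_on_snd continuous_on_id)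
  have \<psi>: "continuous_on (\<phi> ` phase_space k) \<psi>"
    by (rule continuous_on_inv[OF \<phi> compact_phase_space]) (simp add: \<psi>\<phi>)
  have "continuous_on (\<phi> ` phase_space k) (\<lambda>w. g (\<psi> w))"
    by (rule continuous_on_compose2[OF assms(1) \<psi>]) (auto simp: \<psi>\<phi>)
  then have "uniformly_continuous_on (\<phi> ` phase_space k) (\<lambda>w. g (\<psi> w))"
    by (intro compact_uniformly_continuous compact_continuous_image \<phi> compact_phase_space)
  then obtain d where d: "0 < d" "\<And>z z'. z \<in> phase_space k \<Longrightarrow> z' \<in> phase_space k \<Longrightarrow>
      dist (\<phi> z') (\<phi> z) < d \<Longrightarrow> dist (g z') (g z) < e"
    using assms(2) unfolding uniformly_continuous_on_def by (metis \<psi>\<phi> imageI)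
  obtain N where N: "(1 / 2 :: real) ^ N < d / 2"
    using real_arch_pow_inv[of "d / 2" "1 / 2"] d(1) by auto
  define m where "m = nat (\<Sum>n\<le>N. \<bar>from_nat n :: int\<bar>)"
  have m: "\<bar>from_nat n :: int\<bar> \<le> int m" if "n \<le> N" for n
    using member_le_sum[of n "{..N}" "\<lambda>n. \<bar>from_nat n :: int\<bar>"] that
    by (simp add: m_def sum_nonneg)
  show ?thesis
  proof (rule that[of "d / 3" m])
    show "0 < d / 3" using d(1) by simp
    fix z z' :: "(int \<Rightarrow> nat) \<times> circle"
    assume z: "z \<in> phase_space k" "z' \<in> phase_space k"
      and agree: "\<And>i. \<bar>i\<bar> \<le> int m \<Longrightarrow> fst z i = fst z' i" and close: "dist (snd z) (snd z') \<le> d / 3"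
    let ?a = "fst (\<phi> z')" and ?b = "fst (\<phi> z)"
    have "{dist (?a (from_nat n)) (?b (from_nat n)) |n. n \<le> N} = {0 :: real}"
      using agree[OF m] by (force simp: \<phi>_def)
    then have "dist ?a ?b \<le> (1 / 2) ^ N"
      using dist_fun_le_dist_first_terms[of ?a ?b N] by simp
    then have "dist ?a ?b < d / 2" using N by linarith
    moreover have "dist (\<phi> z') (\<phi> z) \<le> dist ?a ?b + dist (snd z') (snd z)"
      using sqrt_sum_squares_le_sum[of "dist ?a ?b" "dist (snd z') (snd z)"]
      by (simp add: dist_prod_def \<phi>_def)
    ultimately have "dist (\<phi> z') (\<phi> z) < d" using close d(1) by (simp add: dist_commute)
    then have "dist (g z') (g z) < e" using d(2) z by blast
    then show "\<bar>g z - g z'\<bar> \<le> e" by (simp add: dist_real_def abs_minus_commute)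
  qed
qed

text \<open>The first \<open>n\<close> letters read by the skew product from a given sequence.\<close>

definition itinerary :: "(int \<Rightarrow> nat) \<Rightarrow> nat \<Rightarrow> nat list"
  where "itinerary \<xi> n = map (\<lambda>i. \<xi> (int i)) [0..<n]"

lemma length_itinerary [simp]: "length (itinerary \<xi> n) = n"
  by (simp add: itinerary_def)

lemma itinerary_Suc: "itinerary \<xi> (Suc n) = itinerary \<xi> n @ [\<xi> (int n)]"
  by (simp add: itinerary_def)

lemma take_itinerary: "i \<le> n \<Longrightarrow> take i (itinerary \<xi> n) = itinerary \<xi> i"
  by (simp add: itinerary_def take_map)

lemma set_itinerary: "\<xi> \<in> Sigma_seq k \<Longrightarrow> set (itinerary \<xi> n) \<subseteq> {..<k}"
  by (auto simp: itinerary_def Sigma_seq_def)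

lemma skew_product_funpow:
  "(skew_product f ^^ n) (\<xi>, x) = ((\<lambda>i. \<xi> (i + int n)), fold f (itinerary \<xi> n) x)"
  by (induction n) (auto simp: skew_product_def left_shift_def itinerary_Suc itinerary_def add_ac)

lemma funpow_in_phase_space:
  "z \<in> phase_space k \<Longrightarrow> (skew_product f ^^ n) z \<in> phase_space k"
  by (cases z) (auto simp: skew_product_funpow phase_space_def Sigma_seq_def)

lemma continuous_on_skew_product:
  assumes "\<And>i. i < k \<Longrightarrow> continuous_on UNIV (f i)"
  shows "continuous_on (phase_space k) (skew_product f)"
proof -
  have "continuous_on (phase_space k) (\<lambda>z. left_shift (fst z))"
    unfolding left_shift_def
    by (rule continuous_on_coordinatewise_then_product)
       (rule continuous_on_compose2[OF continuous_on_product_coordinates continuous_on_fst[OF continuous_on_id]], simp)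
  then have "continuous_on (phase_space k) (\<lambda>z. (left_shift (fst z), f (fst z 0) (snd z)))"
    by (intro continuous_on_Pair continuous_on_letter assms)
  then show ?thesis by (simp add: skew_product_def case_prod_beta')
qed

lemma log_deriv_sum_itinerary:
  "log_deriv_sum f (itinerary \<xi> n) x =
    (\<Sum>i<n. (\<lambda>(\<xi>, x). ln \<bar>circle_deriv (f (\<xi> 0)) x\<bar>) ((skew_product f ^^ i) (\<xi>, x)))"
  by (induction n) (auto simp: skew_product_funpow itinerary_Suc log_deriv_sum_append itinerary_def[of _ 0])

section \<open>Periodic orbit measures and the weak star topology\<close>

lemma weak_star_closureI:
  assumes "S \<subseteq> borel_probs X" "\<nu> \<in> borel_probs X"
    and approx: "\<And>G e. finite G \<Longrightarrow> (\<And>g. g \<in> G \<Longrightarrow> continuous_on X g) \<Longrightarrow> 0 < (e :: real) \<Longrightarrow>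
      \<exists>M\<in>S. \<forall>g\<in>G. \<bar>integral\<^sup>L M g - integral\<^sup>L \<nu> g\<bar> < e"
  shows "\<nu> \<in> weak_star X closure_of S"
proof -
  \<comment> \<open>every neighbourhood contains one given by finitely many test functions\<close>
  have nbhd: "\<exists>G e. finite G \<and> (\<forall>g\<in>G. continuous_on X g) \<and> 0 < (e :: real) \<and>
      {M \<in> borel_probs X. \<forall>g\<in>G. \<bar>integral\<^sup>L M g - integral\<^sup>L \<nu> g\<bar> < e} \<subseteq> T"
    if "generate_topology_on
      {{M \<in> borel_probs X. integral\<^sup>L M g \<in> U} | g (U :: real set). continuous_on X g \<and> open U} T"
      "\<nu> \<in> T" for T
    using that
  proof (induction rule: generate_topology_on.induct)
    case (Int T1 T2)
    obtain G1 e1 where 1: "finite G1" "\<forall>g\<in>G1. continuous_on X g" "0 < (e1 :: real)"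
      "{M \<in> borel_probs X. \<forall>g\<in>G1. \<bar>integral\<^sup>L M g - integral\<^sup>L \<nu> g\<bar> < e1} \<subseteq> T1"
      using Int.IH(1) Int.prems by auto
    obtain G2 e2 where 2: "finite G2" "\<forall>g\<in>G2. continuous_on X g" "0 < (e2 :: real)"
      "{M \<in> borel_probs X. \<forall>g\<in>G2. \<bar>integral\<^sup>L M g - integral\<^sup>L \<nu> g\<bar> < e2} \<subseteq> T2"
      using Int.IH(2) Int.prems by auto
    show ?case
    proof (intro exI[of _ "G1 \<union> G2"] exI[of _ "min e1 e2"] conjI)
      show "{M \<in> borel_probs X. \<forall>g\<in>G1 \<union> G2. \<bar>integral\<^sup>L M g - integral\<^sup>L \<nu> g\<bar> < min e1 e2} \<subseteq> T1 \<inter> T2"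
        using 1(4) 2(4) by fastforce
    qed (use 1 2 in auto)
  next
    case (UN K)
    then obtain T where T: "T \<in> K" "\<nu> \<in> T" by blast
    obtain G e where "finite G" "\<forall>g\<in>G. continuous_on X g" "0 < (e :: real)"
      "{M \<in> borel_probs X. \<forall>g\<in>G. \<bar>integral\<^sup>L M g - integral\<^sup>L \<nu> g\<bar> < e} \<subseteq> T"
      using UN.IH[OF T] by blast
    then show ?case using T(1) by (intro exI[of _ G] exI[of _ e]) blast
  next
    case (Basis T)
    then obtain g and U :: "real set" where gU: "T = {M \<in> borel_probs X. integral\<^sup>L M g \<in> U}"
      "continuous_on X g" "open U" by blast
    then have "integral\<^sup>L \<nu> g \<in> U" using Basis.prems by simp
    then obtain e where e: "0 < e" "ball (integral\<^sup>L \<nu> g) e \<subseteq> U"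
      using gU(3) open_contains_ball by blast
    have "{M \<in> borel_probs X. \<forall>h\<in>{g}. \<bar>integral\<^sup>L M h - integral\<^sup>L \<nu> h\<bar> < e} \<subseteq> T"
      using e(2) unfolding gU(1) by (auto simp: ball_def dist_real_def abs_minus_commute)
    then show ?case using gU(2) e(1) by (intro exI[of _ "{g}"] exI[of _ e]) auto
  qed auto
  show ?thesis
    unfolding in_closure_of
  proof (intro conjI allI impI)
    show "\<nu> \<in> topspace (weak_star X)" using assms(2) by (simp add: topspace_weak_star)
    fix T assume T: "\<nu> \<in> T \<and> openin (weak_star X) T"
    then have gen: "generate_topology_on
      {{M \<in> borel_probs X. integral\<^sup>L M g \<in> U} | g (U :: real set). continuous_on X g \<and> open U} T"
      unfolding weak_star_def by (simp add: openin_topology_generated_by)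
    obtain G e where G: "finite G" "\<forall>g\<in>G. continuous_on X g" "0 < (e :: real)"
      "{M \<in> borel_probs X. \<forall>g\<in>G. \<bar>integral\<^sup>L M g - integral\<^sup>L \<nu> g\<bar> < e} \<subseteq> T"
      using nbhd[OF gen] T by blast
    obtain M where M: "M \<in> S" "\<forall>g\<in>G. \<bar>integral\<^sup>L M g - integral\<^sup>L \<nu> g\<bar> < e"
      using approx[OF G(1) _ G(3)] G(2) by blast
    then have "M \<in> T" using G(4) assms(1) by blast
    then show "\<exists>y. y \<in> S \<and> y \<in> T" using M(1) by blast
  qed
qed

lemma closure_subset_closed_convex_hull: "weak_star X closure_of S \<subseteq> closed_convex_hull X S"
  unfolding closed_convex_hull_def by (intro closure_of_mono hull_subset)

text \<open>The uniform distribution on the first \<open>n\<close> points of an orbit.\<close>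

definition orbit_measure :: "'a::topological_space set \<Rightarrow> ('a \<Rightarrow> 'a) \<Rightarrow> 'a \<Rightarrow> nat \<Rightarrow> 'a measure"
  where "orbit_measure X F z n =
    distr (measure_pmf (pmf_of_set {..<n})) (restrict_space borel X) (\<lambda>i. (F ^^ i) z)"

lemma integral_orbit_measure:
  fixes g :: "'a::topological_space \<Rightarrow> real"
  assumes "0 < n" "\<And>i. (F ^^ i) z \<in> X" "continuous_on X g"
  shows "integral\<^sup>L (orbit_measure X F z n) g = (\<Sum>i<n. g ((F ^^ i) z)) / real n"
proof -
  have "integral\<^sup>L (orbit_measure X F z n) g = (\<integral>i. g ((F ^^ i) z) \<partial>measure_pmf (pmf_of_set {..<n}))"
    unfolding orbit_measure_def
    by (rule integral_distr)
       (auto simp: assms(2) space_restrict_space intro!: borel_measurable_continuous_on_restrict assms(3))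
  also have "\<dots> = (\<Sum>i<n. g ((F ^^ i) z)) / real n"
    using assms(1) by (subst integral_pmf_of_set) auto
  finally show ?thesis .
qed

lemma orbit_measure_ergodic:
  fixes F :: "'a::topological_space \<Rightarrow> 'a"
  assumes n: "0 < n" and X: "\<And>i. (F ^^ i) z \<in> X" and F: "continuous_on X F" "F ` X \<subseteq> X"
    and per: "(F ^^ n) z = z"
  shows "orbit_measure X F z n \<in> ergodic_measures X F"
proof -
  let ?R = "restrict_space borel X" and ?p = "pmf_of_set {..<n}" and ?o = "\<lambda>i. (F ^^ i) z"
  define M where "M = orbit_measure X F z n"
  have orb: "?o \<in> measurable (measure_pmf ?p) ?R"
    using X by (auto simp: space_restrict_space)
  have sets: "sets M = sets ?R" by (simp add: M_def orbit_measure_def)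
  have space: "space M = X" using sets_eq_imp_space_eq[OF sets] by (simp add: space_restrict_space)
  have prob: "prob_space M"
    unfolding M_def orbit_measure_def by (intro prob_space.prob_space_distr prob_space_measure_pmf orb)
  have "F \<in> measurable ?R ?R"
    by (rule measurable_restrict_space2)
       (use F in \<open>auto simp: space_restrict_space intro: borel_measurable_continuous_on_restrict\<close>)
  then have meas: "F \<in> measurable M M" by (simp add: measurable_cong_sets[OF sets sets])
  define S where "S i = Suc i mod n" for i
  have per': "?o (i mod n) = ?o i" for i by (rule funpow_mod_eq[OF per])
  have "bij_betw S {..<n} {..<n}"
  proof -
    have "inj_on S {..<n}"
    proof (rule inj_onI)
      fix i j assume "i \<in> {..<n}" "j \<in> {..<n}" "S i = S j"
      then show "i = j" by (auto simp: S_def mod_Suc split: if_splits)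
    qed
    moreover have "S ` {..<n} \<subseteq> {..<n}" using n by (auto simp: S_def)
    ultimately show ?thesis by (simp add: bij_betw_def endo_inj_surj)
  qed
  then have "map_pmf S ?p = ?p"
    using n by (intro map_pmf_of_set_bij_betw) auto
  then have S: "distr (measure_pmf ?p) (count_space UNIV) S = measure_pmf ?p"
    by (metis map_pmf_rep_eq)
  have "distr M M F = distr M ?R F" by (rule distr_cong) (simp_all add: sets)
  also have "\<dots> = distr (measure_pmf ?p) ?R (F \<circ> ?o)"
    unfolding M_def orbit_measure_def
    by (rule distr_distr[OF \<open>F \<in> measurable ?R ?R\<close> orb])
  also have "F \<circ> ?o = ?o \<circ> S" using per' by (auto simp: S_def fun_eq_iff)
  also have "distr (measure_pmf ?p) ?R (?o \<circ> S) = distr (distr (measure_pmf ?p) (count_space UNIV) S) ?R ?o"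
    by (rule distr_distr[symmetric]) (use X in \<open>auto simp: space_restrict_space\<close>)
  also have "\<dots> = M" unfolding S by (simp add: M_def orbit_measure_def)
  finally have inv: "distr M M F = M" .
  have erg: "measure M A = 0 \<or> measure M A = 1" if A: "A \<in> sets M" "F -` A \<inter> space M = A" for A
  proof -
    have step: "?o (Suc i) \<in> A \<longleftrightarrow> ?o i \<in> A" for i
    proof -
      have "?o i \<in> A \<longleftrightarrow> ?o i \<in> F -` A \<inter> space M" using A(2) by simp
      then show ?thesis using X[of i] space by simp
    qed
    have orb_A: "?o i \<in> A \<longleftrightarrow> z \<in> A" for i
    proof (induction i)
      case (Suc i)
      then show ?case using step[of i] by blast
    qed simp
    have "measure M A = measure (measure_pmf ?p) (?o -` A \<inter> space (measure_pmf ?p))"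
      unfolding M_def orbit_measure_def
      by (rule measure_distr[OF orb]) (use A(1) sets in \<open>simp add: M_def\<close>)
    also have "?o -` A \<inter> space (measure_pmf ?p) = (if z \<in> A then UNIV else {})"
      using orb_A by auto
    finally show ?thesis using prob_space.prob_space[OF prob_space_measure_pmf, of ?p] by auto
  qed
  have "M \<in> borel_probs X" using prob sets by (simp add: borel_probs_def)
  then show ?thesis using meas inv erg unfolding M_def ergodic_measures_def by blast
qed

section \<open>From neutral orbit segments to hyperbolic measures\<close>

text \<open>The averages of two bounded sequences are compared when \<open>b\<close> follows \<open>a\<close> up to \<open>e\<close>, except for
  \<open>m\<close> terms at either end, and is then continued for \<open>l\<close> further terms.\<close>

lemma average_compare:
  fixes a b :: "nat \<Rightarrow> real"
  assumes B: "\<And>i. \<bar>a i\<bar> \<le> B" "\<And>i. \<bar>b i\<bar> \<le> B" and "0 \<le> e" and n: "0 < n"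
    and close: "\<And>i. m \<le> i \<Longrightarrow> i + m < n \<Longrightarrow> \<bar>b i - a i\<bar> \<le> e"
  shows "\<bar>(\<Sum>i<n + l. b i) / real (n + l) - (\<Sum>i<n. a i) / real n\<bar>
    \<le> e + (4 * real m * B + 2 * real l * B) / real n"
proof -
  define SA SB SL where "SA = (\<Sum>i<n. a i)" and "SB = (\<Sum>i<n. b i)" and "SL = (\<Sum>i<l. b (n + i))"
  have B0: "0 \<le> B" using B(1)[of 0] by linarith
  have split: "(\<Sum>i<n + l. b i) = SB + SL"
    unfolding SB_def SL_def by (induction l) auto
  have SL: "\<bar>SL\<bar> \<le> real l * B"
  proof -
    have "(\<Sum>i<l. \<bar>b (n + i)\<bar>) \<le> real (card {..<l}) * B"
      by (rule sum_bounded_above) (rule B(2))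
    then show ?thesis unfolding SL_def using sum_abs[of "\<lambda>i. b (n + i)" "{..<l}"] unfolding card_lessThan by linarith
  qed
  have SA: "\<bar>SA\<bar> \<le> real n * B"
  proof -
    have "(\<Sum>i<n. \<bar>a i\<bar>) \<le> real (card {..<n}) * B"
      by (rule sum_bounded_above) (rule B(1))
    then show ?thesis unfolding SA_def using sum_abs[of a "{..<n}"] unfolding card_lessThan by linarith
  qed
  have card: "card ({..<n} \<inter> {i. i < m}) \<le> m" "card ({..<n} \<inter> {i. n \<le> i + m}) \<le> m"
  proof -
    show "card ({..<n} \<inter> {i. i < m}) \<le> m"
      using card_mono[of "{..<m}" "{..<n} \<inter> {i. i < m}"] by auto
    have "{..<n} \<inter> {i. n \<le> i + m} \<subseteq> {n - m..<n}" by auto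
    from card_mono[OF finite_atLeastLessThan this]
    show "card ({..<n} \<inter> {i. n \<le> i + m}) \<le> m" by simp
  qed
  have "\<bar>SB - SA\<bar> \<le> (\<Sum>i<n. \<bar>b i - a i\<bar>)"
    unfolding SB_def SA_def sum_subtractf[symmetric] by (rule sum_abs)
  also have "\<dots> \<le> (\<Sum>i<n. e + 2 * B * of_bool (i < m) + 2 * B * of_bool (n \<le> i + m))"
  proof (rule sum_mono)
    fix i
    show "\<bar>b i - a i\<bar> \<le> e + 2 * B * of_bool (i < m) + 2 * B * of_bool (n \<le> i + m)"
      using close[of i] B(1)[of i] B(2)[of i] B0 \<open>0 \<le> e\<close>
      by (cases "i < m"; cases "n \<le> i + m") (auto simp: abs_le_iff)
  qed
  also have "\<dots> = real n * e + 2 * B * real (card ({..<n} \<inter> {i. i < m}))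
      + 2 * B * real (card ({..<n} \<inter> {i. n \<le> i + m}))"
    by (simp add: sum.distrib sum_distrib_left[symmetric] sum_of_bool_eq)
  also have "\<dots> \<le> real n * e + 2 * B * real m + 2 * B * real m"
    using card B0 by (intro add_mono mult_left_mono order_refl) auto
  finally have SBA: "\<bar>SB - SA\<bar> \<le> real n * e + 4 * real m * B" by (simp add: mult_ac)
  have eq: "(SB + SL) / real (n + l) - SA / real n
      = ((SB - SA) + SL - real l * (SA / real n)) / real (n + l)"
    using n by (simp add: field_simps)
  have "\<bar>(SB - SA) + SL - real l * (SA / real n)\<bar> \<le> real n * e + 4 * real m * B + 2 * real l * B"
  proof -
    have "\<bar>SA / real n\<bar> \<le> B" using SA n by (simp add: abs_divide divide_le_eq mult.commute)
    then have "real l * \<bar>SA / real n\<bar> \<le> real l * B" by (rule mult_left_mono) simp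
    then have "\<bar>real l * (SA / real n)\<bar> \<le> real l * B" by (simp only: abs_mult abs_of_nat)
    note r = this
    have "\<bar>p + q - r\<bar> \<le> \<bar>p\<bar> + \<bar>q\<bar> + \<bar>r\<bar>" for p q r :: real by linarith
    also have "\<bar>SB - SA\<bar> + \<bar>SL\<bar> + \<bar>real l * (SA / real n)\<bar>
        \<le> (real n * e + 4 * real m * B) + real l * B + real l * B"
      by (intro add_mono SBA SL r)
    finally show ?thesis by (simp add: mult_ac)
  qed
  then have "\<bar>((SB - SA) + SL - real l * (SA / real n)) / real (n + l)\<bar>
      \<le> (real n * e + 4 * real m * B + 2 * real l * B) / real (n + l)"
    unfolding abs_divide by (simp add: divide_right_mono)
  also have "\<dots> \<le> (real n * e + 4 * real m * B + 2 * real l * B) / real n"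
    using n B0 \<open>0 \<le> e\<close> by (intro divide_left_mono) auto
  also have "\<dots> = e + (4 * real m * B + 2 * real l * B) / real n"
    using n by (simp add: add_divide_distrib)
  finally show ?thesis unfolding split SA_def[symmetric] eq .
qed

context circle_ifs
begin

lemma continuous_on_skew: "continuous_on (phase_space k) (skew_product f)"
  by (rule continuous_on_skew_product) (rule continuous_map_f)

lemma continuous_on_exponent:
  "continuous_on (phase_space k) (\<lambda>(\<xi>, x). ln \<bar>circle_deriv (f (\<xi> 0)) x\<bar>)"
  using continuous_on_letter[of k "\<lambda>i x. ln \<bar>circle_deriv (f i) x\<bar>"] continuous_ln_deriv
  by (simp add: case_prod_beta')

lemma word_periodic_point:
  assumes W: "set W \<subseteq> {..<k}" "W \<noteq> []" and fixp: "fold f W p = p"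
  defines "\<xi> \<equiv> \<lambda>i. W ! nat (i mod int (length W))"
  shows "\<xi> \<in> Sigma_seq k" "itinerary \<xi> (length W) = W"
    "(skew_product f ^^ length W) (\<xi>, p) = (\<xi>, p)"
proof -
  have N: "0 < int (length W)" using W(2) by simp
  have "nat (i mod int (length W)) < length W" for i
    using pos_mod_bound[OF N, of i] pos_mod_sign[OF N, of i] by linarith
  then show "\<xi> \<in> Sigma_seq k"
    using W(1) nth_mem by (fastforce simp: Sigma_seq_def \<xi>_def)
  show it: "itinerary \<xi> (length W) = W"
    unfolding itinerary_def \<xi>_def by (rule nth_equalityI) (auto simp: nat_mod_distrib)
  show "(skew_product f ^^ length W) (\<xi>, p) = (\<xi>, p)"
    by (simp add: skew_product_funpow it fixp) (simp add: \<xi>_def)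
qed

text \<open>The periodic orbit measure carried by a shadowing loop: its exponent is read off from the
  loop, and its integrals are close to the averages along the shadowed orbit segment.\<close>

lemma shadowing_loop_measure:
  assumes z: "z \<in> phase_space k" and n: "0 < n"
    and loop: "shadowing_loop k f (itinerary (fst z) n) (snd z) \<delta> T t p"
  obtains M where "M \<in> ergodic_measures (phase_space k) (skew_product f)"
    "fiber_exponent f M = log_deriv_sum f (itinerary (fst z) n @ t) p / real (n + length t)"
    "\<forall>g m B e. continuous_on (phase_space k) g \<and> 0 \<le> e \<and> (\<forall>y\<in>phase_space k. \<bar>g y\<bar> \<le> B) \<and>
      (\<forall>y\<in>phase_space k. \<forall>y'\<in>phase_space k.
        (\<forall>i. \<bar>i\<bar> \<le> int m \<longrightarrow> fst y i = fst y' i) \<and> dist (snd y) (snd y') \<le> \<delta> \<longrightarrow> \<bar>g y - g y'\<bar> \<le> e) \<longrightarrow>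
      \<bar>integral\<^sup>L M g - (\<Sum>i<n. g ((skew_product f ^^ i) z)) / real n\<bar>
        \<le> e + (4 * real m * B + 2 * T * B) / real n"
proof -
  let ?X = "phase_space k" and ?F = "skew_product f"
  define w where "w = itinerary (fst z) n"
  define W where "W = w @ t"
  have fst_z: "fst z \<in> Sigma_seq k" using z by (auto simp: phase_space_def)
  have w: "set w \<subseteq> {..<k}" unfolding w_def by (rule set_itinerary[OF fst_z])
  have len_w: "length w = n" by (simp add: w_def)
  have t: "set t \<subseteq> {..<k}" and fixp: "fold f W p = p" and lt: "real (length t) \<le> T"
    and close: "\<And>i. i \<le> n \<Longrightarrow> dist (fold f (take i w) p) (fold f (take i w) (snd z)) \<le> \<delta>"
    using loop unfolding shadowing_loop_def w_def[symmetric] W_def len_w by auto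
  have W: "set W \<subseteq> {..<k}" "W \<noteq> []" using w t n len_w by (auto simp: W_def)
  have len_W: "length W = n + length t" by (simp add: W_def len_w)
  define \<xi> where "\<xi> = (\<lambda>i. W ! nat (i mod int (length W)))"
  have per: "\<xi> \<in> Sigma_seq k" "itinerary \<xi> (length W) = W" "(?F ^^ length W) (\<xi>, p) = (\<xi>, p)"
    unfolding \<xi>_def by (rule word_periodic_point[OF W fixp])+
  have y: "(\<xi>, p) \<in> ?X" using per(1) by (simp add: phase_space_def)
  note orb = funpow_in_phase_space[OF y, of _ f] and orb_z = funpow_in_phase_space[OF z, of _ f]
  define M where "M = orbit_measure ?X ?F (\<xi>, p) (length W)"
  have N: "0 < length W" using W(2) by simp
  note int = integral_orbit_measure[OF N orb, folded M_def]
  show ?thesis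
  proof (rule that[of M])
    have "?F ` ?X \<subseteq> ?X" using funpow_in_phase_space[of _ k 1 f] by auto
    then show "M \<in> ergodic_measures ?X ?F"
      unfolding M_def by (rule orbit_measure_ergodic[OF N orb continuous_on_skew _ per(3)])
    have "fiber_exponent f M = log_deriv_sum f (itinerary \<xi> (length W)) p / real (length W)"
      unfolding fiber_exponent_def int[OF continuous_on_exponent] log_deriv_sum_itinerary ..
    also have "\<dots> = log_deriv_sum f W p / real (n + length t)"
      by (simp only: per(2)) (simp only: len_W)
    finally show "fiber_exponent f M = log_deriv_sum f (itinerary (fst z) n @ t) p / real (n + length t)"
      by (simp only: W_def w_def)
    show "\<forall>g m B e. continuous_on ?X g \<and> 0 \<le> e \<and> (\<forall>y\<in>?X. \<bar>g y\<bar> \<le> B) \<and>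
      (\<forall>y\<in>?X. \<forall>y'\<in>?X. (\<forall>i. \<bar>i\<bar> \<le> int m \<longrightarrow> fst y i = fst y' i) \<and> dist (snd y) (snd y') \<le> \<delta> \<longrightarrow>
        \<bar>g y - g y'\<bar> \<le> e) \<longrightarrow>
      \<bar>integral\<^sup>L M g - (\<Sum>i<n. g ((?F ^^ i) z)) / real n\<bar>
        \<le> e + (4 * real m * B + 2 * T * B) / real n"
    proof (intro allI impI, elim conjE)
      fix g m B and e :: real
      assume g: "continuous_on ?X g" and e: "0 \<le> e" and B0: "\<forall>y\<in>?X. \<bar>g y\<bar> \<le> B"
        and modulus: "\<forall>y\<in>?X. \<forall>y'\<in>?X. (\<forall>i. \<bar>i\<bar> \<le> int m \<longrightarrow> fst y i = fst y' i) \<and> dist (snd y) (snd y') \<le> \<delta> \<longrightarrow>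
          \<bar>g y - g y'\<bar> \<le> e"
      note B = B0[rule_format]
      have "\<bar>g ((?F ^^ i) (\<xi>, p)) - g ((?F ^^ i) z)\<bar> \<le> e" if i: "m \<le> i" "i + m < n" for i
      proof (rule modulus[rule_format, OF orb orb_z], intro conjI allI impI)
        fix j assume j: "\<bar>j\<bar> \<le> int m"
        define q where "q = nat (j + int i)"
        have q: "j + int i = int q" "q < n" using j i by (auto simp: q_def)
        have "\<xi> (int q) = itinerary \<xi> (length W) ! q"
          using q(2) len_W by (simp add: itinerary_def)
        also have "\<dots> = w ! q" unfolding per(2) using q(2) by (simp add: W_def nth_append len_w)
        also have "\<dots> = fst z (int q)" using q(2) by (simp add: w_def itinerary_def)
        finally show "fst ((?F ^^ i) (\<xi>, p)) j = fst ((?F ^^ i) z) j"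
          by (cases z) (simp add: skew_product_funpow q(1))
      next
        have "itinerary \<xi> i = take i (itinerary \<xi> (length W))"
          using i len_W by (simp add: take_itinerary)
        also have "\<dots> = take i w" unfolding per(2) using i len_w by (simp add: W_def)
        finally have "itinerary \<xi> i = take i w" .
        moreover have "itinerary (fst z) i = take i w" using i by (simp add: w_def take_itinerary)
        ultimately show "dist (snd ((?F ^^ i) (\<xi>, p))) (snd ((?F ^^ i) z)) \<le> \<delta>"
          using close[of i] i by (cases z) (simp add: skew_product_funpow)
      qed
      then have "\<bar>(\<Sum>i<n + length t. g ((?F ^^ i) (\<xi>, p))) / real (n + length t)
          - (\<Sum>i<n. g ((?F ^^ i) z)) / real n\<bar>
          \<le> e + (4 * real m * B + 2 * real (length t) * B) / real n"
        by (intro average_compare B orb orb_z e n)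
      also have "\<dots> \<le> e + (4 * real m * B + 2 * T * B) / real n"
      proof -
        have "0 \<le> B" using B[OF y] by linarith
        then have "2 * real (length t) * B \<le> 2 * T * B" using lt by (intro mult_right_mono) auto
        then show ?thesis by (simp add: divide_right_mono)
      qed
      finally show "\<bar>integral\<^sup>L M g - (\<Sum>i<n. g ((?F ^^ i) z)) / real n\<bar>
          \<le> e + (4 * real m * B + 2 * T * B) / real n"
        unfolding int[OF g] len_W .
    qed
  qed
qed

end

text \<open>A measure that is described, up to any precision, by long orbit segments along which all
  partial sums of the logarithmic derivative are small compared with the length.\<close>

definition neutrally_approximable ::
    "nat \<Rightarrow> (nat \<Rightarrow> circle \<Rightarrow> circle) \<Rightarrow> ((int \<Rightarrow> nat) \<times> circle) measure \<Rightarrow> bool"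
  where "neutrally_approximable k f \<nu> \<longleftrightarrow>
    (\<forall>G e \<rho> n0. finite G \<and> (\<forall>g\<in>G. continuous_on (phase_space k) g) \<and> 0 < e \<and> 0 < \<rho> \<longrightarrow>
      (\<exists>z\<in>phase_space k. \<exists>n\<ge>n0.
        (\<forall>i\<le>n. \<bar>log_deriv_sum f (itinerary (fst z) i) (snd z)\<bar> \<le> \<rho> * real n) \<and>
        (\<forall>g\<in>G. \<bar>(\<Sum>i<n. g ((skew_product f ^^ i) z)) / real n - integral\<^sup>L \<nu> g\<bar> < (e :: real))))"

context circle_ifs
begin

text \<open>The loops of both signs that shadow a long neutral segment carry hyperbolic periodic measures;
  they approximate \<open>\<nu>\<close>, because they spend only a proportion \<open>O(\<rho>)\<close> of the time off the segment.\<close>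

lemma neutrally_approximable_in_closures:
  assumes cec: "CEC_plus k f J" "CEC_plus k g J" and acc: "Acc_plus k f J" "Acc_plus k g J"
    and J: "a \<in> J" "b \<in> J" "a \<noteq> b"
    and \<nu>: "\<nu> \<in> borel_probs (phase_space k)" "neutrally_approximable k f \<nu>"
  shows "\<nu> \<in> weak_star (phase_space k) closure_of
      {M \<in> ergodic_measures (phase_space k) (skew_product f). fiber_exponent f M < 0}"
    and "\<nu> \<in> weak_star (phase_space k) closure_of
      {M \<in> ergodic_measures (phase_space k) (skew_product f). fiber_exponent f M > 0}"
proof -
  let ?X = "phase_space k" and ?F = "skew_product f"
  let ?E = "ergodic_measures ?X ?F"
  obtain C where C: "0 < C" "\<And>\<rho> \<delta>. 0 < \<rho> \<Longrightarrow> 0 < \<delta> \<Longrightarrow> \<exists>n0. \<forall>w x.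
    set w \<subseteq> {..<k} \<and> n0 \<le> length w \<and>
    (\<forall>i\<le>length w. \<bar>log_deriv_sum f (take i w) x\<bar> \<le> \<rho> * real (length w)) \<longrightarrow>
    (\<exists>t p. shadowing_loop k f w x \<delta> (C * \<rho> * real (length w)) t p \<and> log_deriv_sum f (w @ t) p < 0) \<and>
    (\<exists>t p. shadowing_loop k f w x \<delta> (C * \<rho> * real (length w)) t p \<and> log_deriv_sum f (w @ t) p > 0)"
    by (rule closing[OF cec acc J]) (rule that; assumption)
  have approx: "(\<exists>M\<in>{M \<in> ?E. fiber_exponent f M < 0}. \<forall>h\<in>G. \<bar>integral\<^sup>L M h - integral\<^sup>L \<nu> h\<bar> < e) \<and>
      (\<exists>M\<in>{M \<in> ?E. fiber_exponent f M > 0}. \<forall>h\<in>G. \<bar>integral\<^sup>L M h - integral\<^sup>L \<nu> h\<bar> < e)"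
    if G: "finite G" "\<And>h. h \<in> G \<Longrightarrow> continuous_on ?X h" and e: "0 < (e :: real)" for G e
  proof -
    have "\<forall>h\<in>G. \<exists>B>0. \<forall>y\<in>?X. \<bar>h y\<bar> \<le> B"
      using continuous_on_phase_space_bounded G(2) by metis
    then obtain B where B: "\<And>h. h \<in> G \<Longrightarrow> 0 < B h" "\<And>h y. h \<in> G \<Longrightarrow> y \<in> ?X \<Longrightarrow> \<bar>h y\<bar> \<le> B h"
      by metis
    have "\<forall>h\<in>G. \<exists>m :: nat. \<exists>d>0. \<forall>y\<in>?X. \<forall>y'\<in>?X. (\<forall>i. \<bar>i\<bar> \<le> int m \<longrightarrow> fst y i = fst y' i) \<longrightarrow>
        dist (snd y) (snd y') \<le> d \<longrightarrow> \<bar>h y - h y'\<bar> \<le> e / 4"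
      using phase_space_modulus[OF G(2), of _ "e / 4"] e by (smt (verit) zero_less_divide_iff)
    then obtain m d where md: "\<And>h. h \<in> G \<Longrightarrow> 0 < d h"
      "\<And>h y y'. h \<in> G \<Longrightarrow> y \<in> ?X \<Longrightarrow> y' \<in> ?X \<Longrightarrow> (\<forall>i. \<bar>i\<bar> \<le> int (m h) \<longrightarrow> fst y i = fst y' i) \<Longrightarrow>
        dist (snd y) (snd y') \<le> d h \<Longrightarrow> \<bar>h y - h y'\<bar> \<le> e / 4"
      by metis
    define m' B' \<delta> where "m' = (\<Sum>h\<in>G. m h)" and "B' = 1 + (\<Sum>h\<in>G. B h)" and "\<delta> = Min (insert 1 (d ` G))"
    have m': "m h \<le> m'" if "h \<in> G" for h unfolding m'_def by (rule member_le_sum[OF that _ G(1)]) auto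
    have "B h \<le> (\<Sum>h\<in>G. B h)" if "h \<in> G" for h
      by (rule member_le_sum[OF that _ G(1)]) (use B(1) less_imp_le in auto)
    then have B': "\<bar>h y\<bar> \<le> B'" if "h \<in> G" "y \<in> ?X" for h y
      using B(2)[OF that] that(1) by (force simp: B'_def)
    have "0 < B'" unfolding B'_def by (intro add_pos_nonneg sum_nonneg) (use B(1) less_imp_le in auto)
    have \<delta>: "0 < \<delta>" "\<And>h. h \<in> G \<Longrightarrow> \<delta> \<le> d h"
      using G(1) md(1) by (auto simp: \<delta>_def Min_gr_iff)
    \<comment> \<open>the time off the segment, a proportion of at most \<open>C * \<rho>\<close>, then costs at most \<open>e / 4\<close>\<close>
    define \<rho> where "\<rho> = e / (8 * C * B')"
    have \<rho>: "0 < \<rho>" using e C(1) \<open>0 < B'\<close> by (simp add: \<rho>_def)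
    obtain n1 where n1: "\<forall>w x. set w \<subseteq> {..<k} \<and> n1 \<le> length w \<and>
      (\<forall>i\<le>length w. \<bar>log_deriv_sum f (take i w) x\<bar> \<le> \<rho> * real (length w)) \<longrightarrow>
      (\<exists>t p. shadowing_loop k f w x \<delta> (C * \<rho> * real (length w)) t p \<and> log_deriv_sum f (w @ t) p < 0) \<and>
      (\<exists>t p. shadowing_loop k f w x \<delta> (C * \<rho> * real (length w)) t p \<and> log_deriv_sum f (w @ t) p > 0)"
      using C(2)[OF \<rho> \<delta>(1)] ..
    define n0 where "n0 = max (Suc n1) (nat \<lceil>16 * real m' * B' / e\<rceil>)"
    have "\<exists>z\<in>?X. \<exists>n\<ge>n0. (\<forall>i\<le>n. \<bar>log_deriv_sum f (itinerary (fst z) i) (snd z)\<bar> \<le> \<rho> * real n) \<and>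
        (\<forall>h\<in>G. \<bar>(\<Sum>i<n. h ((?F ^^ i) z)) / real n - integral\<^sup>L \<nu> h\<bar> < e / 4)"
      using \<nu>(2)[unfolded neutrally_approximable_def, rule_format, of G "e / 4" \<rho> n0] G e \<rho> by simp
    then obtain z n where z: "z \<in> ?X" and n: "n0 \<le> n"
      and S: "\<And>i. i \<le> n \<Longrightarrow> \<bar>log_deriv_sum f (itinerary (fst z) i) (snd z)\<bar> \<le> \<rho> * real n"
      and avg: "\<And>h. h \<in> G \<Longrightarrow> \<bar>(\<Sum>i<n. h ((?F ^^ i) z)) / real n - integral\<^sup>L \<nu> h\<bar> < e / 4"
      by blast
    have n': "0 < n" "n1 \<le> n" "16 * real m' * B' / e \<le> real n"
      using n unfolding n0_def by linarith+
    let ?w = "itinerary (fst z) n"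
    have "set ?w \<subseteq> {..<k}" using z by (intro set_itinerary) (auto simp: phase_space_def)
    then have loops: "(\<exists>t p. shadowing_loop k f ?w (snd z) \<delta> (C * \<rho> * real n) t p \<and> log_deriv_sum f (?w @ t) p < 0) \<and>
      (\<exists>t p. shadowing_loop k f ?w (snd z) \<delta> (C * \<rho> * real n) t p \<and> log_deriv_sum f (?w @ t) p > 0)"
      using n1[rule_format, of ?w "snd z"] n' S by (simp add: take_itinerary)
    have loop_measure: "\<exists>M\<in>?E. sgn (fiber_exponent f M) = sgn (log_deriv_sum f (?w @ t) p) \<and>
        (\<forall>h\<in>G. \<bar>integral\<^sup>L M h - integral\<^sup>L \<nu> h\<bar> < e)"
      if loop: "shadowing_loop k f ?w (snd z) \<delta> (C * \<rho> * real n) t p" for t p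
    proof -
      obtain M where M: "M \<in> ?E"
        "fiber_exponent f M = log_deriv_sum f (?w @ t) p / real (n + length t)"
        "\<forall>g m B e. continuous_on ?X g \<and> 0 \<le> e \<and> (\<forall>y\<in>?X. \<bar>g y\<bar> \<le> B) \<and>
          (\<forall>y\<in>?X. \<forall>y'\<in>?X.
            (\<forall>i. \<bar>i\<bar> \<le> int m \<longrightarrow> fst y i = fst y' i) \<and> dist (snd y) (snd y') \<le> \<delta> \<longrightarrow> \<bar>g y - g y'\<bar> \<le> e) \<longrightarrow>
          \<bar>integral\<^sup>L M g - (\<Sum>i<n. g ((?F ^^ i) z)) / real n\<bar>
            \<le> e + (4 * real m * B + 2 * (C * \<rho> * real n) * B) / real n"
        by (rule shadowing_loop_measure[OF z n'(1) loop]) (rule that; assumption)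
      have "\<bar>integral\<^sup>L M h - integral\<^sup>L \<nu> h\<bar> < e" if h: "h \<in> G" for h
      proof -
        have "\<bar>integral\<^sup>L M h - (\<Sum>i<n. h ((?F ^^ i) z)) / real n\<bar>
            \<le> e / 4 + (4 * real m' * B' + 2 * (C * \<rho> * real n) * B') / real n"
        proof (rule M(3)[rule_format], intro conjI ballI impI, goal_cases)
          case (4 y y')
          then show ?case using md(2)[OF h 4(1,2)] m'[OF h] \<delta>(2)[OF h] by force
        qed (use G(2)[OF h] e B' h in auto)
        also have "(4 * real m' * B' + 2 * (C * \<rho> * real n) * B') / real n
            = 4 * real m' * B' / real n + 2 * C * \<rho> * B'"
          using n'(1) by (simp add: add_divide_distrib)
        also have "2 * C * \<rho> * B' = e / 4" using C(1) \<open>0 < B'\<close> by (simp add: \<rho>_def)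
        also have "4 * real m' * B' / real n \<le> e / 4"
          using n'(1,3) e by (simp add: field_simps)
        finally show ?thesis using avg[OF h] by linarith
      qed
      moreover have "sgn (fiber_exponent f M) = sgn (log_deriv_sum f (?w @ t) p)"
        unfolding M(2) using n'(1) by (simp add: sgn_divide)
      ultimately show ?thesis using M(1) by blast
    qed
    obtain t p where "shadowing_loop k f ?w (snd z) \<delta> (C * \<rho> * real n) t p" "log_deriv_sum f (?w @ t) p < 0"
      using loops by blast
    then obtain M where "M \<in> ?E" "sgn (fiber_exponent f M) = -1"
        "\<forall>h\<in>G. \<bar>integral\<^sup>L M h - integral\<^sup>L \<nu> h\<bar> < e"
      using loop_measure[of t p] by auto
    moreover obtain t' p' where "shadowing_loop k f ?w (snd z) \<delta> (C * \<rho> * real n) t' p'" "log_deriv_sum f (?w @ t') p' > 0"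
      using loops by blast
    then obtain M' where "M' \<in> ?E" "sgn (fiber_exponent f M') = 1"
        "\<forall>h\<in>G. \<bar>integral\<^sup>L M' h - integral\<^sup>L \<nu> h\<bar> < e"
      using loop_measure[of t' p'] by auto
    ultimately show ?thesis by (auto simp: sgn_1_pos sgn_1_neg)
  qed
  have E: "?E \<subseteq> borel_probs ?X" by (auto simp: ergodic_measures_def)
  show "\<nu> \<in> weak_star ?X closure_of {M \<in> ?E. fiber_exponent f M < 0}"
    by (rule weak_star_closureI) (use E \<nu>(1) approx in auto)
  show "\<nu> \<in> weak_star ?X closure_of {M \<in> ?E. fiber_exponent f M > 0}"
    by (rule weak_star_closureI) (use E \<nu>(1) approx in auto)
qed

end

section \<open>Birkhoff averages of ergodic measures\<close>

text \<open>\<open>max_birkhoff F h n x\<close> is the maximum of the Birkhoff sums of \<open>h\<close> at \<open>x\<close> of length at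
  most \<open>n\<close>, the empty sum included.\<close>

fun max_birkhoff :: "('a \<Rightarrow> 'a) \<Rightarrow> ('a \<Rightarrow> real) \<Rightarrow> nat \<Rightarrow> 'a \<Rightarrow> real" where
  "max_birkhoff F h 0 x = 0"
| "max_birkhoff F h (Suc n) x = max 0 (h x + max_birkhoff F h n (F x))"

lemma max_birkhoff_nonneg: "0 \<le> max_birkhoff F h n x"
  by (cases n) auto

lemma max_birkhoff_mono_Suc: "max_birkhoff F h n x \<le> max_birkhoff F h (Suc n) x"
proof (induction n arbitrary: x)
  case (Suc n)
  from Suc.IH[of "F x"] show ?case by (auto simp: max_def)
qed simp

lemma max_birkhoff_mono: "m \<le> n \<Longrightarrow> max_birkhoff F h m x \<le> max_birkhoff F h n x"
  by (rule lift_Suc_mono_le[of "\<lambda>n. max_birkhoff F h n x", OF max_birkhoff_mono_Suc])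

lemma birkhoff_sum_Suc:
  fixes h :: "'a \<Rightarrow> real"
  shows "(\<Sum>i<Suc n. h ((F ^^ i) x)) = h x + (\<Sum>i<n. h ((F ^^ i) (F x)))"
  unfolding sum.lessThan_Suc_shift by (simp add: funpow_swap1)

lemma birkhoff_sum_le_max:
  fixes h :: "'a \<Rightarrow> real"
  shows "(\<Sum>i<n. h ((F ^^ i) x)) \<le> max_birkhoff F h n x"
proof (induction n arbitrary: x)
  case (Suc n)
  then show ?case unfolding birkhoff_sum_Suc using Suc.IH[of "F x"] by (simp add: le_max_iff_disj)
qed simp

lemma funpow_measurable:
  assumes "F \<in> measurable M M" shows "F ^^ n \<in> measurable M M"
proof (induction n)
  case (Suc n)
  then show ?case using measurable_comp[OF Suc assms] by (simp only: funpow.simps)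
qed (simp add: id_def)

lemma birkhoff_sum_measurable:
  fixes h :: "'a \<Rightarrow> real"
  assumes "F \<in> measurable M M" "h \<in> borel_measurable M"
  shows "(\<lambda>x. \<Sum>i<n. h ((F ^^ i) x)) \<in> borel_measurable M"
  by (rule borel_measurable_sum) (rule measurable_compose[OF funpow_measurable[OF assms(1)] assms(2)])

lemma max_birkhoff_measurable:
  assumes "F \<in> measurable M M" "h \<in> borel_measurable M"
  shows "max_birkhoff F h n \<in> borel_measurable M"
proof (induction n)
  case (Suc n)
  have "(\<lambda>x. max_birkhoff F h n (F x)) \<in> borel_measurable M"
    by (rule measurable_compose[OF assms(1) Suc])
  then have "(\<lambda>x. max 0 (h x + max_birkhoff F h n (F x))) \<in> borel_measurable M"
    using assms(2) by (intro borel_measurable_max borel_measurable_add) auto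
  then show ?case by simp
qed simp

lemma max_birkhoff_bounded:
  assumes F: "F \<in> measurable M M" and B: "\<And>x. x \<in> space M \<Longrightarrow> \<bar>h x\<bar> \<le> B" and x: "x \<in> space M"
  shows "max_birkhoff F h n x \<le> real n * B"
  using x
proof (induction n arbitrary: x)
  case (Suc n)
  have "F x \<in> space M" using measurable_space[OF F Suc.prems] .
  then show ?case
    using Suc.IH[of "F x"] B[OF Suc.prems] max_birkhoff_nonneg[of F h n "F x"] B[OF \<open>F x \<in> space M\<close>]
    by (auto simp: algebra_simps abs_le_iff)
qed simp

text \<open>The maximal ergodic theorem for bounded functions.\<close>

lemma maximal_ergodic:
  assumes M: "prob_space M" and F: "F \<in> measurable M M" "distr M M F = M"
    and h: "h \<in> borel_measurable M" "\<And>x. x \<in> space M \<Longrightarrow> \<bar>h x\<bar> \<le> B"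
  shows "0 \<le> (\<integral>x. h x * of_bool (\<exists>n. 0 < max_birkhoff F h n x) \<partial>M)"
proof -
  interpret prob_space M by (rule M)
  let ?P = "max_birkhoff F h"
  have P_meas [measurable]: "?P n \<in> borel_measurable M" for n by (rule max_birkhoff_measurable[OF F(1) h(1)])
  note h(1) [measurable]
  have P_int: "integrable M (?P n)" for n
  proof (rule integrable_const_bound[of _ "real n * B"])
    show "AE x in M. norm (?P n x) \<le> real n * B"
      using max_birkhoff_bounded[OF F(1) h(2)] max_birkhoff_nonneg[of F h n] by (intro AE_I2) auto
  qed simp
  have PF_int: "integrable M (\<lambda>x. ?P n (F x))" and PF_eq: "(\<integral>x. ?P n (F x) \<partial>M) = (\<integral>x. ?P n x \<partial>M)" for n
    using integrable_distr[OF F(1), of "?P n"] integral_distr[OF F(1), of "?P n"] P_int[of n] F(2) P_meas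
    by auto
  have bound: "norm (h x * of_bool b) \<le> B" if "x \<in> space M" for x b
    using h(2)[OF that] by (auto split: split_of_bool)
  have n_nonneg: "0 \<le> (\<integral>x. h x * of_bool (0 < ?P n x) \<partial>M)" for n
  proof -
    have int: "integrable M (\<lambda>x. h x * of_bool (0 < ?P n x))"
      by (rule integrable_const_bound[of _ B]) (use bound in auto)
    have "?P n x - ?P n (F x) \<le> h x * of_bool (0 < ?P n x)" for x
    proof (cases "0 < ?P n x")
      case True
      then obtain m where m: "n = Suc m" by (cases n) auto
      then have "?P n x = h x + ?P m (F x)" using True by (auto simp: max_def split: if_splits)
      then show ?thesis using True max_birkhoff_mono_Suc[of F h m "F x"] m by simp
    next
      case False
      then show ?thesis using max_birkhoff_nonneg[of F h n "F x"] by simp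
    qed
    then have "(\<integral>x. ?P n x - ?P n (F x) \<partial>M) \<le> (\<integral>x. h x * of_bool (0 < ?P n x) \<partial>M)"
      by (intro integral_mono Bochner_Integration.integrable_diff P_int PF_int int)
    then show ?thesis
      using PF_eq[of n] by (simp add: Bochner_Integration.integral_diff[OF P_int PF_int])
  qed
  have "(\<lambda>n. \<integral>x. h x * of_bool (0 < ?P n x) \<partial>M)
      \<longlonglongrightarrow> (\<integral>x. h x * of_bool (\<exists>n. 0 < ?P n x) \<partial>M)"
  proof (rule integral_dominated_convergence[where w = "\<lambda>_. B"])
    show "AE x in M. (\<lambda>n. h x * of_bool (0 < ?P n x)) \<longlonglongrightarrow> h x * of_bool (\<exists>n. 0 < ?P n x)"
    proof (intro AE_I2 tendsto_mult tendsto_const)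
      fix x
      show "(\<lambda>n. of_bool (0 < ?P n x) :: real) \<longlonglongrightarrow> of_bool (\<exists>n. 0 < ?P n x)"
      proof (cases "\<exists>n. 0 < ?P n x")
        case True
        then obtain m where m: "0 < ?P m x" by blast
        then have "0 < ?P n x" if "m \<le> n" for n using max_birkhoff_mono[OF that, of F h x] by linarith
        then have "\<forall>\<^sub>F n in sequentially. of_bool (0 < ?P n x) = (of_bool (\<exists>n. 0 < ?P n x) :: real)"
          using True unfolding eventually_sequentially by (intro exI[of _ m]) auto
        then show ?thesis by (rule tendsto_eventually)
      qed simp
    qed
  qed (use bound in auto)
  then show ?thesis by (rule LIMSEQ_le_const) (use n_nonneg in blast)
qed

text \<open>The set where the Birkhoff sums of \<open>h - \<integral>h - \<epsilon>\<close> are unbounded above is exactly invariant;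
  by the maximal ergodic theorem it does not have full measure, so it is null.\<close>

lemma birkhoff_upper:
  fixes h :: "'a::topological_space \<Rightarrow> real"
  assumes M: "M \<in> ergodic_measures X F"
    and h: "h \<in> borel_measurable M" "\<And>x. x \<in> space M \<Longrightarrow> \<bar>h x\<bar> \<le> B" and e: "0 < e"
  shows "AE x in M. \<exists>C. \<forall>n. (\<Sum>i<n. h ((F ^^ i) x)) \<le> real n * (integral\<^sup>L M h + e) + C"
proof -
  have prob: "prob_space M" and F: "F \<in> measurable M M" "distr M M F = M"
    and erg: "\<And>A. A \<in> sets M \<Longrightarrow> F -` A \<inter> space M = A \<Longrightarrow> measure M A = 0 \<or> measure M A = 1"
    using M by (auto simp: ergodic_measures_def borel_probs_def)
  interpret prob_space M by (rule prob)
  define h' where "h' x = h x - (integral\<^sup>L M h + e)" for x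
  define S where "S n x = (\<Sum>i<n. h' ((F ^^ i) x))" for n x
  have h'_meas: "h' \<in> borel_measurable M" unfolding h'_def using h(1) by simp
  have S_eq: "S n x = (\<Sum>i<n. h ((F ^^ i) x)) - real n * (integral\<^sup>L M h + e)" for n x
    by (simp add: S_def h'_def sum_subtractf)
  define A where "A = {x \<in> space M. \<forall>C :: nat. \<exists>n. real C < S n x}"
  have S_meas [measurable]: "S n \<in> borel_measurable M" for n
    unfolding S_def[abs_def] by (rule birkhoff_sum_measurable[OF F(1) h'_meas])
  have A: "A \<in> sets M" unfolding A_def by measurable
  have S_Suc: "S (Suc n) x = h' x + S n (F x)" for n x
    unfolding S_def by (rule birkhoff_sum_Suc)
  have "x \<in> A \<longleftrightarrow> F x \<in> A" if x: "x \<in> space M" for x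
  proof
    assume xA: "x \<in> A"
    have "\<exists>n. real C < S n (F x)" for C :: nat
    proof -
      obtain n where n: "real (C + nat \<lceil>\<bar>h' x\<bar>\<rceil>) < S n x" using xA unfolding A_def by blast
      then have "0 < S n x" by (meson le_less_trans of_nat_0_le_iff)
      then obtain m where "n = Suc m" by (cases n) (auto simp: S_def)
      then have "real C < S m (F x)" using n S_Suc[of m x] by (simp add: abs_le_iff) linarith
      then show ?thesis by blast
    qed
    then show "F x \<in> A" using measurable_space[OF F(1) x] by (simp add: A_def)
  next
    assume xA: "F x \<in> A"
    have "\<exists>n. real C < S n x" for C :: nat
    proof -
      obtain n where n: "real (C + nat \<lceil>\<bar>h' x\<bar>\<rceil>) < S n (F x)" using xA unfolding A_def by blast
      then have "real C < S (Suc n) x" using S_Suc[of n x] by linarith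
      then show ?thesis by blast
    qed
    then show "x \<in> A" using x by (simp add: A_def)
  qed
  then have inv: "F -` A \<inter> space M = A" by (auto simp: A_def)
  have h_int: "integrable M h" by (rule integrable_const_bound[of _ B]) (use h in auto)
  have "measure M A \<noteq> 1"
  proof
    assume "measure M A = 1"
    then have AE_A: "AE x in M. x \<in> A" using A by (simp add: prob_eq_1)
    have "0 \<le> (\<integral>x. h' x * of_bool (\<exists>n. 0 < max_birkhoff F h' n x) \<partial>M)"
    proof (rule maximal_ergodic[OF prob F h'_meas])
      show "\<bar>h' x\<bar> \<le> B + \<bar>integral\<^sup>L M h + e\<bar>" if "x \<in> space M" for x
        using h(2)[OF that] by (simp add: h'_def)
    qed
    also have "\<dots> = (\<integral>x. h' x \<partial>M)"
    proof (rule integral_cong_AE)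
      show "AE x in M. h' x * of_bool (\<exists>n. 0 < max_birkhoff F h' n x) = h' x"
        using AE_A
      proof eventually_elim
        case (elim x)
        then have "\<exists>n. real 0 < S n x" unfolding A_def by blast
        then obtain n where "0 < S n x" by auto
        then have "0 < max_birkhoff F h' n x"
          using birkhoff_sum_le_max[of h' F x n] unfolding S_def by linarith
        then have "\<exists>n. 0 < max_birkhoff F h' n x" ..
        then show ?case by simp
      qed
      have [measurable]: "max_birkhoff F h' n \<in> borel_measurable M" for n
        by (rule max_birkhoff_measurable[OF F(1) h'_meas])
      note h'_meas [measurable]
      show "(\<lambda>x. h' x * of_bool (\<exists>n. 0 < max_birkhoff F h' n x)) \<in> borel_measurable M" by measurable
    qed (rule h'_meas)
    also have "\<dots> = - e"
      unfolding h'_def using h_int by (simp add: prob_space)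
    finally show False using e by simp
  qed
  then have "measure M A = 0" using erg[OF A inv] by blast
  then have "AE x in M. x \<notin> A" using A by (simp add: prob_eq_0)
  then show ?thesis
  proof (rule AE_mp, intro AE_I2 impI)
    fix x assume "x \<in> space M" "x \<notin> A"
    then obtain C where "\<And>n. S n x \<le> real C" unfolding A_def by (auto simp: not_less)
    then show "\<exists>C. \<forall>n. (\<Sum>i<n. h ((F ^^ i) x)) \<le> real n * (integral\<^sup>L M h + e) + C"
      unfolding S_eq by (intro exI[of _ "real C"] allI) (simp add: algebra_simps)
  qed
qed

lemma birkhoff_ergodic:
  fixes h :: "'a::topological_space \<Rightarrow> real"
  assumes M: "M \<in> ergodic_measures X F"
    and h: "h \<in> borel_measurable M" "\<And>x. x \<in> space M \<Longrightarrow> \<bar>h x\<bar> \<le> B" and e: "0 < e"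
  shows "AE x in M. \<exists>C. \<forall>n. \<bar>(\<Sum>i<n. h ((F ^^ i) x)) - real n * integral\<^sup>L M h\<bar> \<le> real n * e + C"
proof -
  have "AE x in M. \<exists>C. \<forall>n. (\<Sum>i<n. h ((F ^^ i) x)) \<le> real n * (integral\<^sup>L M h + e) + C"
    by (rule birkhoff_upper[OF M h e])
  moreover have "AE x in M. \<exists>C. \<forall>n. (\<Sum>i<n. - h ((F ^^ i) x)) \<le> real n * (integral\<^sup>L M (\<lambda>x. - h x) + e) + C"
    by (rule birkhoff_upper[OF M _ _ e]) (use h in auto)
  ultimately show ?thesis
  proof eventually_elim
    case (elim x)
    then obtain C1 C2 where C:
      "\<And>n. (\<Sum>i<n. h ((F ^^ i) x)) \<le> real n * (integral\<^sup>L M h + e) + C1"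
      "\<And>n. (\<Sum>i<n. - h ((F ^^ i) x)) \<le> real n * (integral\<^sup>L M (\<lambda>x. - h x) + e) + C2" by blast
    have "\<bar>(\<Sum>i<n. h ((F ^^ i) x)) - real n * integral\<^sup>L M h\<bar> \<le> real n * e + max C1 C2" for n
      using C(1)[of n] C(2)[of n] by (auto simp: sum_negf algebra_simps abs_le_iff)
    then show ?case by blast
  qed
qed

context circle_ifs
begin

text \<open>A typical point of an ergodic measure with zero exponent provides the segments: its Birkhoff
  averages converge, and those of the logarithmic derivative converge to \<open>0\<close>.\<close>

lemma zero_exponent_neutrally_approximable:
  assumes M: "M \<in> ergodic_measures (phase_space k) (skew_product f)" and zero: "fiber_exponent f M = 0"
  shows "neutrally_approximable k f M"
  unfolding neutrally_approximable_def
proof (intro allI impI, elim conjE)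
  let ?X = "phase_space k" and ?F = "skew_product f"
  fix G :: "((int \<Rightarrow> nat) \<times> circle \<Rightarrow> real) set" and e \<rho> :: real and n0 :: nat
  assume G: "finite G" "\<forall>g\<in>G. continuous_on ?X g" and e: "0 < e" and \<rho>: "0 < \<rho>"
  define \<phi> where "\<phi> = (\<lambda>(\<xi> :: int \<Rightarrow> nat, x). ln \<bar>circle_deriv (f (\<xi> 0)) x\<bar>)"
  have \<phi>_int: "integral\<^sup>L M \<phi> = 0" using zero unfolding fiber_exponent_def \<phi>_def .
  have prob: "prob_space M" and sets: "sets M = sets (restrict_space borel ?X)"
    using M by (auto simp: ergodic_measures_def borel_probs_def)
  have space: "space M = ?X" using sets_eq_imp_space_eq[OF sets] by (simp add: space_restrict_space)
  define \<epsilon> where "\<epsilon> = min e \<rho> / 2"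
  have \<epsilon>: "0 < \<epsilon>" "\<epsilon> \<le> e / 2" "\<epsilon> \<le> \<rho> / 2" using e \<rho> by (auto simp: \<epsilon>_def)
  let ?H = "insert \<phi> G"
  have H: "continuous_on ?X h" if "h \<in> ?H" for h
    using that G(2) continuous_on_exponent unfolding \<phi>_def by auto
  have "AE z in M. \<forall>h\<in>?H. \<exists>C. \<forall>n. \<bar>(\<Sum>i<n. h ((?F ^^ i) z)) - real n * integral\<^sup>L M h\<bar> \<le> real n * \<epsilon> + C"
  proof (rule AE_finite_allI)
    fix h assume h: "h \<in> ?H"
    obtain B where B: "\<And>z. z \<in> ?X \<Longrightarrow> \<bar>h z\<bar> \<le> B"
      using continuous_on_phase_space_bounded[OF H[OF h]] by blast
    have "h \<in> borel_measurable M"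
      using borel_measurable_continuous_on_restrict[OF H[OF h]] measurable_cong_sets[OF sets refl] by blast
    then show "AE z in M. \<exists>C. \<forall>n. \<bar>(\<Sum>i<n. h ((?F ^^ i) z)) - real n * integral\<^sup>L M h\<bar> \<le> real n * \<epsilon> + C"
      by (rule birkhoff_ergodic[OF M _ _ \<epsilon>(1)]) (use B space in auto)
  qed (use G(1) in simp)
  then have "AE z in M. z \<in> ?X \<and> (\<forall>h\<in>?H. \<exists>C. \<forall>n. \<bar>(\<Sum>i<n. h ((?F ^^ i) z)) - real n * integral\<^sup>L M h\<bar> \<le> real n * \<epsilon> + C)"
    using AE_space[of M] space by (simp add: eventually_conj_iff)
  then obtain z where z: "z \<in> ?X"
    "\<forall>h\<in>?H. \<exists>C. \<forall>n. \<bar>(\<Sum>i<n. h ((?F ^^ i) z)) - real n * integral\<^sup>L M h\<bar> \<le> real n * \<epsilon> + C"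
    using eventually_happens'[OF prob_space.ae_filter_bot[OF prob]] by blast
  then obtain C where C: "\<And>h n. h \<in> ?H \<Longrightarrow>
      \<bar>(\<Sum>i<n. h ((?F ^^ i) z)) - real n * integral\<^sup>L M h\<bar> \<le> real n * \<epsilon> + C h" by metis
  define D where "D = (\<Sum>h\<in>?H. \<bar>C h\<bar>)"
  have D: "C h \<le> D" if "h \<in> ?H" for h
  proof -
    have "\<bar>C h\<bar> \<le> D" unfolding D_def by (rule member_le_sum[OF that]) (use G(1) in auto)
    then show ?thesis by linarith
  qed
  define n where "n = Suc (max n0 (nat \<lceil>D / \<epsilon>\<rceil>))"
  have n: "n0 \<le> n" "0 < n" "D / \<epsilon> < real n" by (auto simp: n_def) linarith
  then have Dn: "D < real n * \<epsilon>" using \<epsilon>(1) by (simp add: pos_divide_less_eq)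
  show "\<exists>z\<in>?X. \<exists>n\<ge>n0. (\<forall>i\<le>n. \<bar>log_deriv_sum f (itinerary (fst z) i) (snd z)\<bar> \<le> \<rho> * real n) \<and>
      (\<forall>g\<in>G. \<bar>(\<Sum>i<n. g ((?F ^^ i) z)) / real n - integral\<^sup>L M g\<bar> < e)"
  proof (intro bexI[OF _ z(1)] exI[of _ n] conjI allI ballI impI)
    show "n0 \<le> n" by (rule n(1))
    fix i assume i: "i \<le> n"
    have "log_deriv_sum f (itinerary (fst z) i) (snd z) = (\<Sum>j<i. \<phi> ((?F ^^ j) z))"
      unfolding log_deriv_sum_itinerary \<phi>_def by simp
    then have "\<bar>log_deriv_sum f (itinerary (fst z) i) (snd z)\<bar> \<le> real i * \<epsilon> + D"
      using C[of \<phi> i] D[of \<phi>] \<phi>_int by simp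
    also have "real i * \<epsilon> \<le> real n * \<epsilon>" using i \<epsilon>(1) by (intro mult_right_mono) auto
    also have "real n * \<epsilon> + D \<le> real n * (2 * \<epsilon>)" using Dn by (simp add: mult.commute)
    also have "\<dots> \<le> real n * \<rho>" using \<epsilon>(3) by (intro mult_left_mono) auto
    finally show "\<bar>log_deriv_sum f (itinerary (fst z) i) (snd z)\<bar> \<le> \<rho> * real n" by (simp add: mult.commute)
  next
    fix g assume g: "g \<in> G"
    let ?S = "\<Sum>i<n. g ((?F ^^ i) z)"
    have "\<bar>?S - real n * integral\<^sup>L M g\<bar> \<le> real n * \<epsilon> + D"
      using C[of g n] D[of g] g by auto
    also have "\<dots> < real n * (2 * \<epsilon>)" using Dn by (simp add: mult.commute)
    also have "\<dots> \<le> real n * e" using \<epsilon>(2) by (intro mult_left_mono) auto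
    finally have "\<bar>?S - real n * integral\<^sup>L M g\<bar> / real n < e" using n(2) by (simp add: pos_divide_less_eq mult.commute)
    moreover have "?S / real n - integral\<^sup>L M g = (?S - real n * integral\<^sup>L M g) / real n"
      using n(2) by (simp add: field_simps)
    ultimately show "\<bar>?S / real n - integral\<^sup>L M g\<bar> < e" by (simp add: abs_divide)
  qed
qed

end

section \<open>Limits of empirical measures\<close>

text \<open>A continuous image of a compact set of real numbers inherits weak sequential compactness
  from Helly's selection theorem.\<close>

lemma empirical_measures_subsequence:
  fixes \<pi> :: "real \<Rightarrow> 'a::topological_space" and z :: "nat \<Rightarrow> nat \<Rightarrow> 'a"
  assumes K: "compact K" and \<pi>: "continuous_on K \<pi>" "\<pi> ` K = X"
    and z: "\<And>m i. z m i \<in> X" and N: "\<And>m. 0 < N m"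
  obtains \<nu> r where "\<nu> \<in> borel_probs X" "strict_mono r"
    "\<And>g :: 'a \<Rightarrow> real. continuous_on X g \<Longrightarrow>
      (\<lambda>m. (\<Sum>i<N (r m). g (z (r m) i)) / real (N (r m))) \<longlonglongrightarrow> integral\<^sup>L \<nu> g"
proof -
  have "\<exists>t. t \<in> K \<and> \<pi> t = z m i" for m i
  proof -
    have "z m i \<in> \<pi> ` K" using z \<pi>(2) by simp
    then show ?thesis by auto
  qed
  then obtain t where t: "\<And>m i. t m i \<in> K" "\<And>m i. \<pi> (t m i) = z m i" by metis
  define \<mu> where "\<mu> m = distr (measure_pmf (pmf_of_set {..<N m})) borel (t m)" for m
  have real_distr: "real_distribution (\<mu> m)" for m
    unfolding real_distribution_def real_distribution_axioms_def \<mu>_def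
    by (auto intro!: prob_space.prob_space_distr prob_space_measure_pmf)
  have int_\<mu>: "integral\<^sup>L (\<mu> m) u = (\<Sum>i<N m. u (t m i)) / real (N m)"
    if "continuous_on UNIV u" for m and u :: "real \<Rightarrow> real"
  proof -
    have "integral\<^sup>L (\<mu> m) u = (\<integral>i. u (t m i) \<partial>measure_pmf (pmf_of_set {..<N m}))"
      unfolding \<mu>_def by (rule integral_distr) (use that borel_measurable_continuous_onI in auto)
    also have "\<dots> = (\<Sum>i<N m. u (t m i)) / real (N m)"
      using N[of m] by (subst integral_pmf_of_set) auto
    finally show ?thesis .
  qed
  obtain b where b: "0 < b" "\<And>s. s \<in> K \<Longrightarrow> \<bar>s\<bar> \<le> b"
    using compact_imp_bounded[OF K] unfolding bounded_pos by auto
  have "tight \<mu>"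
    unfolding tight_def
  proof (intro conjI allI impI real_distr)
    fix e :: real assume "0 < e"
    have "measure (\<mu> m) {- b - 1<..b} = 1" for m
    proof -
      have "t m -` {- b - 1<..b} = UNIV" using b(2)[OF t(1)] by (force simp: abs_le_iff)
      then show ?thesis
        unfolding \<mu>_def by (subst measure_distr) (auto simp: prob_space.prob_space[OF prob_space_measure_pmf, simplified])
    qed
    then show "\<exists>a b. a < b \<and> (\<forall>n. 1 - e < measure (\<mu> n) {a<..b})"
      using \<open>0 < e\<close> b(1) by (intro exI[of _ "- b - 1"] exI[of _ b]) auto
  qed
  then obtain r L where r: "strict_mono r" and L: "real_distribution L" "weak_conv_m (\<mu> \<circ> id \<circ> r) L"
    using tight_imp_convergent_subsubsequence[of \<mu> id] strict_mono_id by blast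
  interpret L: real_distribution L by (rule L(1))
  have meas_L: "u \<in> borel_measurable L" if "u \<in> borel_measurable borel" for u :: "real \<Rightarrow> real"
    using that measurable_cong_sets[OF L.events_eq_borel refl] by blast
  have conv: "(\<lambda>m. (\<Sum>i<N (r m). u (t (r m) i)) / real (N (r m))) \<longlonglongrightarrow> integral\<^sup>L L u"
    if u: "continuous_on UNIV u" "\<And>s. \<bar>u s\<bar> \<le> B" for u :: "real \<Rightarrow> real" and B
  proof -
    have "(\<lambda>m. integral\<^sup>L ((\<mu> \<circ> id \<circ> r) m) u) \<longlonglongrightarrow> integral\<^sup>L L u"
      by (rule weak_conv_imp_integral_bdd_continuous_conv[OF _ L])
         (use u real_distr in \<open>auto simp: continuous_on_eq_continuous_at\<close>)
    then show ?thesis by (simp add: int_\<mu>[OF u(1)])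
  qed
  obtain t0 where t0: "t0 \<in> K" using t(1) by blast
  have AE_K: "AE s in L. s \<in> K"
  proof -
    define u where "u s = min 1 (infdist s K)" for s :: real
    have u: "continuous_on UNIV u" unfolding u_def
      by (intro continuous_on_min continuous_on_const continuous_on_infdist continuous_on_id)
    have "u s = 0" if "s \<in> K" for s using that by (simp add: u_def)
    then have "(\<lambda>m :: nat. 0) \<longlonglongrightarrow> integral\<^sup>L L u"
      using conv[OF u, of 1] t(1) by (simp add: u_def infdist_nonneg)
    then have "integral\<^sup>L L u = 0" by (simp add: LIMSEQ_const_iff)
    moreover have "u \<in> borel_measurable L"
      by (rule meas_L[OF borel_measurable_continuous_onI[OF u]])
    then have "integrable L u"
      by (rule L.integrable_const_bound[of _ 1, rotated]) (auto simp: u_def infdist_nonneg)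
    ultimately have "AE s in L. u s = 0"
      by (subst (asm) integral_nonneg_eq_0_iff_AE) (auto simp: u_def infdist_nonneg)
    then show ?thesis
    proof eventually_elim
      case (elim s)
      then have "infdist s K = 0" by (simp add: u_def min_def split: if_splits)
      then show ?case
        using in_closed_iff_infdist_zero[OF compact_imp_closed[OF K]] t0 by blast
    qed
  qed
  define \<sigma> where "\<sigma> s = \<pi> (if s \<in> K then s else t0)" for s
  have K_sets: "K \<in> sets borel" using K by (simp add: borel_compact)
  have \<sigma>: "\<sigma> \<in> measurable L (restrict_space borel X)"
  proof -
    have 1: "(\<lambda>s. if s \<in> K then s else t0) \<in> measurable L (restrict_space borel K)"
    proof (rule measurable_restrict_space2)
      have "(\<lambda>s. if s \<in> K then s else t0) \<in> borel_measurable borel"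
        using K_sets by (intro measurable_If) auto
      then show "(\<lambda>s. if s \<in> K then s else t0) \<in> borel_measurable L"
        by (rule meas_L)
    qed (use t0 in auto)
    have 2: "\<pi> \<in> measurable (restrict_space borel K) (restrict_space borel X)"
      by (rule measurable_restrict_space2)
         (use \<pi> in \<open>auto simp: space_restrict_space intro: borel_measurable_continuous_on_restrict\<close>)
    show ?thesis unfolding \<sigma>_def by (rule measurable_compose[OF 1 2])
  qed
  define \<nu> where "\<nu> = distr L (restrict_space borel X) \<sigma>"
  show ?thesis
  proof (rule that[of \<nu> r])
    show "\<nu> \<in> borel_probs X"
      unfolding borel_probs_def \<nu>_def by (auto intro!: L.prob_space_distr \<sigma>)
    show "strict_mono r" by (rule r)
    fix g :: "'a \<Rightarrow> real" assume g: "continuous_on X g"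
    have g\<pi>: "continuous_on K (\<lambda>s. g (\<pi> s))"
      by (rule continuous_on_compose2[OF g \<pi>(1)]) (use \<pi>(2) in auto)
    obtain B where B: "0 < B" "\<And>s. s \<in> K \<Longrightarrow> \<bar>g (\<pi> s)\<bar> \<le> B"
      using compact_imp_bounded[OF compact_continuous_image[OF g\<pi> K]] unfolding bounded_pos by auto
    obtain u where u: "continuous_on UNIV u" "\<And>s. s \<in> K \<Longrightarrow> u s = g (\<pi> s)" "\<And>s. \<bar>u s\<bar> \<le> B"
      using Tietze[OF g\<pi>, of UNIV B] B compact_imp_closed[OF K] by (auto simp: less_imp_le)
    have "integral\<^sup>L \<nu> g = (\<integral>s. g (\<sigma> s) \<partial>L)"
      unfolding \<nu>_def by (rule integral_distr[OF \<sigma> borel_measurable_continuous_on_restrict[OF g]])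
    also have "\<dots> = integral\<^sup>L L u"
    proof (rule integral_cong_AE)
      show "AE s in L. g (\<sigma> s) = u s"
        using AE_K by eventually_elim (simp add: \<sigma>_def u(2))
      show "(\<lambda>s. g (\<sigma> s)) \<in> borel_measurable L"
        by (rule measurable_compose[OF \<sigma> borel_measurable_continuous_on_restrict[OF g]])
      show "u \<in> borel_measurable L"
        by (rule meas_L[OF borel_measurable_continuous_onI[OF u(1)]])
    qed
    finally show "(\<lambda>m. (\<Sum>i<N (r m). g (z (r m) i)) / real (N (r m))) \<longlonglongrightarrow> integral\<^sup>L \<nu> g"
      using conv[OF u(1,3)] t u(2) by simp
  qed
qed

text \<open>Bounded digit sequences, and the value of such a sequence in base \<open>1 / b\<close>.\<close>

definition digit_seq :: "nat \<Rightarrow> (nat \<Rightarrow> nat) set"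
  where "digit_seq k = {d. \<forall>n. d n < k}"

definition digit_value :: "real \<Rightarrow> (nat \<Rightarrow> nat) \<Rightarrow> real"
  where "digit_value b d = (\<Sum>n. real (d n) * b ^ n)"

lemma compact_digit_seq: "compact (digit_seq k)"
proof -
  have "digit_seq k = Pi\<^sub>E UNIV (\<lambda>_. {..<k})" by (auto simp: digit_seq_def)
  moreover have "compactin (product_topology (\<lambda>_ :: nat. euclidean) UNIV) (Pi\<^sub>E UNIV (\<lambda>_. {..<k}))"
    by (subst compactin_PiE) (auto intro: finite_imp_compact)
  ultimately show ?thesis
    unfolding euclidean_product_topology by simp
qed

lemma digit_le: "d \<in> digit_seq k \<Longrightarrow> real (d n) \<le> real k - 1"
  unfolding digit_seq_def by (auto dest: spec[of _ n])

lemma summable_digits: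
  assumes "d \<in> digit_seq k" "0 < b" "b < 1"
  shows "summable (\<lambda>n. real (d n) * b ^ n)"
proof (rule summable_comparison_test')
  show "summable (\<lambda>n. (real k - 1) * b ^ n)"
    using assms by (intro summable_mult summable_geometric) simp
  show "norm (real (d n) * b ^ n) \<le> (real k - 1) * b ^ n" if "0 \<le> n" for n
    using digit_le[OF assms(1), of n] assms(2) by (auto simp: abs_mult intro!: mult_right_mono)
qed

lemma continuous_on_digit_value:
  assumes "0 < b" "b < 1"
  shows "continuous_on (digit_seq k) (digit_value b)"
proof -
  have "uniform_limit (digit_seq k) (\<lambda>n d. \<Sum>i<n. real (d i) * b ^ i) (\<lambda>d. \<Sum>i. real (d i) * b ^ i) sequentially"
  proof (rule Weierstrass_m_test)
    show "summable (\<lambda>n. (real k - 1) * b ^ n)"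
      using assms by (intro summable_mult summable_geometric) simp
    show "norm (real (d n) * b ^ n) \<le> (real k - 1) * b ^ n" if "d \<in> digit_seq k" for n d
      using digit_le[OF that, of n] assms(1) by (auto simp: abs_mult intro!: mult_right_mono)
  qed
  moreover have "continuous_on (digit_seq k) (\<lambda>d. \<Sum>i<n. real (d i) * b ^ i)" for n
  proof (intro continuous_on_sum continuous_on_mult continuous_on_const)
    fix i
    have "continuous_on (digit_seq k) (\<lambda>d. d i)"
      by (rule continuous_on_subset[OF continuous_on_product_coordinates]) simp
    then show "continuous_on (digit_seq k) (\<lambda>d. real (d i))"
      by (rule continuous_on_compose2[of UNIV real, rotated]) auto
  qed
  ultimately show ?thesis
    unfolding digit_value_def[abs_def] by (intro uniform_limit_theorem) auto
qed

lemma digit_value_shift: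
  assumes "d \<in> digit_seq k" "0 < b" "b < 1"
  shows "digit_value b d = real (d 0) + b * digit_value b (\<lambda>n. d (Suc n))"
proof -
  have "(\<lambda>n. d (Suc n)) \<in> digit_seq k" using assms(1) by (auto simp: digit_seq_def)
  note sum = summable_digits[OF this assms(2,3)]
  have "digit_value b d = real (d 0) + (\<Sum>n. real (d (Suc n)) * b ^ Suc n)"
    unfolding digit_value_def using suminf_split_head[OF summable_digits[OF assms]] by simp
  also have "(\<Sum>n. real (d (Suc n)) * b ^ Suc n) = b * digit_value b (\<lambda>n. d (Suc n))"
    unfolding digit_value_def using suminf_mult[OF sum, of b] by (simp add: mult_ac)
  finally show ?thesis .
qed

lemma digit_value_bounds:
  assumes "d \<in> digit_seq k" "0 < b" "b < 1"
  shows "0 \<le> digit_value b d" "digit_value b d \<le> (real k - 1) / (1 - b)"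
proof -
  note sum = summable_digits[OF assms]
  show "0 \<le> digit_value b d" unfolding digit_value_def using assms by (intro suminf_nonneg sum) auto
  have geo: "(\<lambda>n. (real k - 1) * b ^ n) sums ((real k - 1) * (1 / (1 - b)))"
    using assms by (intro sums_mult geometric_sums) simp
  have "digit_value b d \<le> (\<Sum>n. (real k - 1) * b ^ n)"
    unfolding digit_value_def using digit_le[OF assms(1)] assms(2)
    by (intro suminf_le sum sums_summable[OF geo]) (auto intro!: mult_right_mono)
  then show "digit_value b d \<le> (real k - 1) / (1 - b)" using sums_unique[OF geo] by simp
qed

text \<open>In base \<open>k + 1\<close> the digits below \<open>k\<close> are determined by the value.\<close>

lemma inj_on_digit_value: "inj_on (digit_value (1 / (real k + 1))) (digit_seq k)"
proof (rule inj_onI)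
  define b where "b = 1 / (real k + 1)"
  fix d d' assume d: "d \<in> digit_seq k" "d' \<in> digit_seq k"
    and eq: "digit_value (1 / (real k + 1)) d = digit_value (1 / (real k + 1)) d'"
  have k: "0 < real k" using d(1) by (auto simp: digit_seq_def dest: spec[of _ 0])
  have b: "0 < b" "b < 1" using k by (auto simp: b_def)
  have small: "b * ((real k - 1) / (1 - b)) < 1"
  proof -
    have "1 - b = real k * b" using k by (simp add: b_def field_simps)
    then have "b * ((real k - 1) / (1 - b)) = (real k - 1) / real k" using b by simp
    then show ?thesis using k by simp
  qed
  have first: "d 0 = d' 0"
    if d: "d \<in> digit_seq k" "d' \<in> digit_seq k" "digit_value b d = digit_value b d'" for d d'
  proof -
    let ?s = "\<lambda>n. d (Suc n)" and ?s' = "\<lambda>n. d' (Suc n)"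
    have s: "?s \<in> digit_seq k" "?s' \<in> digit_seq k" using d by (auto simp: digit_seq_def)
    have "b * digit_value b ?s < 1" "b * digit_value b ?s' < 1"
      using mult_left_mono[OF digit_value_bounds(2)[OF s(1) b], of b]
        mult_left_mono[OF digit_value_bounds(2)[OF s(2) b], of b] small b by linarith+
    moreover have "0 \<le> b * digit_value b ?s" "0 \<le> b * digit_value b ?s'"
      using digit_value_bounds(1)[OF s(1) b] digit_value_bounds(1)[OF s(2) b] b by auto
    ultimately have "\<bar>real (d 0) - real (d' 0)\<bar> < 1"
      using d(3) digit_value_shift[OF d(1) b] digit_value_shift[OF d(2) b] by linarith
    then show ?thesis by linarith
  qed
  have "d n = d' n" if "d \<in> digit_seq k" "d' \<in> digit_seq k" "digit_value b d = digit_value b d'" for n d d'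
    using that
  proof (induction n arbitrary: d d')
    case (0 d d')
    then show ?case by (rule first)
  next
    case (Suc n d d')
    have "d 0 = d' 0" by (rule first[OF Suc.prems])
    then have "digit_value b (\<lambda>n. d (Suc n)) = digit_value b (\<lambda>n. d' (Suc n))"
      using Suc.prems(3) digit_value_shift[OF Suc.prems(1) b] digit_value_shift[OF Suc.prems(2) b] b by simp
    moreover have "(\<lambda>n. d (Suc n)) \<in> digit_seq k" "(\<lambda>n. d' (Suc n)) \<in> digit_seq k"
      using Suc.prems by (auto simp: digit_seq_def)
    ultimately show ?case using Suc.IH[of "\<lambda>n. d (Suc n)" "\<lambda>n. d' (Suc n)"] by blast
  qed
  then show "d = d'" using d eq by (auto simp: fun_eq_iff b_def)
qed

lemma binary_digits:
  assumes "0 \<le> s" "s < 1"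
  obtains q where "q \<in> digit_seq 2" "digit_value (1 / 2) q / 2 = s"
proof -
  define q where "q n = nat (\<lfloor>2 ^ Suc n * s\<rfloor> mod 2)" for n
  have q: "q \<in> digit_seq 2" by (auto simp: digit_seq_def q_def nat_less_iff)
  have partial: "(\<Sum>i<n. real (q i) * (1 / 2) ^ i) / 2 = of_int \<lfloor>2 ^ n * s\<rfloor> / 2 ^ n" for n
  proof (induction n)
    case 0
    have "\<lfloor>s\<rfloor> = 0" using assms by (simp add: floor_eq_iff)
    then show ?case by simp
  next
    case (Suc n)
    let ?y = "2 ^ n * s"
    have "\<lfloor>2 * ?y\<rfloor> div 2 = \<lfloor>?y\<rfloor>"
    proof -
      have "2 * \<lfloor>?y\<rfloor> \<le> \<lfloor>2 * ?y\<rfloor>" "\<lfloor>2 * ?y\<rfloor> \<le> 2 * \<lfloor>?y\<rfloor> + 1" by linarith+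
      then show ?thesis by linarith
    qed
    then have "\<lfloor>2 * ?y\<rfloor> = 2 * \<lfloor>?y\<rfloor> + \<lfloor>2 * ?y\<rfloor> mod 2" by (metis mult_div_mod_eq)
    moreover have "int (q n) = \<lfloor>2 * ?y\<rfloor> mod 2" by (simp add: q_def mult.assoc)
    ultimately have "\<lfloor>2 * ?y\<rfloor> = 2 * \<lfloor>?y\<rfloor> + int (q n)" by simp
    then have "(of_int \<lfloor>2 * ?y\<rfloor> :: real) = 2 * of_int \<lfloor>?y\<rfloor> + real (q n)" by linarith
    then show ?case using Suc.IH by (simp add: field_simps power_one_over mult.assoc)
  qed
  have "(\<lambda>n. of_int \<lfloor>2 ^ n * s\<rfloor> / 2 ^ n) \<longlonglongrightarrow> s"
  proof (rule LIMSEQ_I)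
    fix e :: real assume "0 < e"
    then obtain N where N: "(1 / 2 :: real) ^ N < e" using real_arch_pow_inv[of e "1 / 2"] by auto
    show "\<exists>N. \<forall>n\<ge>N. norm (of_int \<lfloor>2 ^ n * s\<rfloor> / 2 ^ n - s) < e"
    proof (intro exI[of _ N] allI impI)
      fix n assume n: "N \<le> n"
      have "of_int \<lfloor>2 ^ n * s\<rfloor> / 2 ^ n - s = (of_int \<lfloor>2 ^ n * s\<rfloor> - 2 ^ n * s) / 2 ^ n"
        by (simp add: field_simps)
      moreover have "\<bar>of_int \<lfloor>2 ^ n * s\<rfloor> - 2 ^ n * s\<bar> \<le> 1" by linarith
      ultimately have "\<bar>of_int \<lfloor>2 ^ n * s\<rfloor> / 2 ^ n - s\<bar> \<le> 1 / 2 ^ n"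
        by (simp add: abs_divide divide_right_mono)
      also have "\<dots> \<le> (1 / 2) ^ N" using n by (simp add: power_one_over power_increasing frac_le)
      finally show "norm (of_int \<lfloor>2 ^ n * s\<rfloor> / 2 ^ n - s) < e" using N by simp
    qed
  qed
  moreover have "(\<lambda>n. (\<Sum>i<n. real (q i) * (1 / 2) ^ i) / 2) \<longlonglongrightarrow> digit_value (1 / 2) q / 2"
    unfolding digit_value_def
    by (intro tendsto_divide tendsto_const summable_LIMSEQ summable_digits[OF q]) auto
  ultimately have "digit_value (1 / 2) q / 2 = s"
    unfolding partial using LIMSEQ_unique by blast
  then show ?thesis using that q by blast
qed

text \<open>The phase space is a continuous image of a compact set of real numbers: the even digits
  encode the symbol sequence, the odd ones a binary expansion of the fibre coordinate.\<close>

lemma phase_space_coding: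
  assumes "2 \<le> k"
  obtains K :: "real set" and \<pi> where "compact K" "continuous_on K \<pi>" "\<pi> ` K = phase_space k"
proof -
  define b where "b = 1 / (real k + 1)"
  have b: "0 < b" "b < 1" using assms by (auto simp: b_def)
  let ?D = "digit_seq k"
  define p where "p d = ((\<lambda>i. d (2 * int_encode i)),
    circle_proj (digit_value (1 / 2) (\<lambda>n. min 1 (d (2 * n + 1))) / 2))" for d :: "nat \<Rightarrow> nat"
  define c where "c = digit_value b"
  have c: "continuous_on ?D c" "inj_on c ?D"
    using continuous_on_digit_value[OF b, of k] inj_on_digit_value[of k] by (auto simp: c_def b_def)
  have coord: "continuous_on ?D (\<lambda>d. d n)" for n
    by (rule continuous_on_subset[OF continuous_on_product_coordinates]) simp
  have half: "continuous_on (digit_seq 2) (digit_value (1 / 2))"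
    by (rule continuous_on_digit_value) auto
  have cm: "continuous_on ?D (\<lambda>d n. min 1 (d (2 * n + 1)))"
    by (intro continuous_on_coordinatewise_then_product continuous_on_min continuous_on_const coord)
  then have "continuous_on ?D (\<lambda>d. digit_value (1 / 2) (\<lambda>n. min 1 (d (2 * n + 1))))"
    by (intro continuous_on_compose2[OF half cm]) (auto simp: digit_seq_def)
  then have "continuous_on ?D (\<lambda>d. circle_proj (digit_value (1 / 2) (\<lambda>n. min 1 (d (2 * n + 1))) / 2))"
    by (intro continuous_on_compose2[OF continuous_on_circle_proj[of UNIV]] continuous_on_divide continuous_on_const) auto
  then have p: "continuous_on ?D p"
    unfolding p_def[abs_def] by (intro continuous_on_Pair continuous_on_coordinatewise_then_product coord)
  have "p ` ?D = phase_space k"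
  proof (intro set_eqI iffI)
    fix z assume "z \<in> p ` ?D"
    then show "z \<in> phase_space k" by (auto simp: p_def phase_space_def Sigma_seq_def digit_seq_def)
  next
    fix z assume z: "z \<in> phase_space k"
    obtain s0 where s0: "circle_proj s0 = snd z" using circle_proj_surj by blast
    have s: "circle_proj (frac s0) = snd z"
      using s0 circle_proj_eq_iff[of "frac s0" s0] by (simp add: frac_def)
    obtain q where q: "q \<in> digit_seq 2" "digit_value (1 / 2) q / 2 = frac s0"
      by (rule binary_digits[of "frac s0"]) (auto simp: frac_lt_1)
    define d where "d n = (if even n then fst z (int_decode (n div 2)) else q (n div 2))" for n
    have "q n < 2" for n using q(1) by (simp add: digit_seq_def)
    then have "d \<in> ?D" using z assms
      by (auto simp: digit_seq_def d_def phase_space_def Sigma_seq_def intro: less_le_trans)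
    moreover have "min 1 (d (2 * n + 1)) = q n" for n
      using \<open>q n < 2\<close> by (simp add: d_def)
    then have "p d = z" using s q(2) by (cases z) (simp add: p_def d_def)
    ultimately show "z \<in> p ` ?D" by blast
  qed
  moreover have inv: "the_inv_into ?D c (c d) = d" if "d \<in> ?D" for d
    by (rule the_inv_into_f_f[OF c(2) that])
  moreover have "continuous_on (c ` ?D) (\<lambda>t. p (the_inv_into ?D c t))"
    by (rule continuous_on_compose2[OF p continuous_on_inv_into[OF c(1) compact_digit_seq c(2)]])
       (auto simp: inv)
  moreover have "compact (c ` ?D)" by (rule compact_continuous_image[OF c(1) compact_digit_seq])
  ultimately show ?thesis
    by (intro that[of "c ` ?D" "\<lambda>t. p (the_inv_into ?D c t)"]) (auto simp: image_image)
qed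

section \<open>Zero exponents as limits from both sides\<close>

context circle_ifs
begin

text \<open>The empirical measures along orbits with bounded derivative sums accumulate on a suitable
  measure, which need not be ergodic.\<close>

lemma exists_neutrally_approximable:
  assumes "2 \<le> k"
    and orbits: "\<And>n. \<exists>w. set w \<subseteq> {..<k} \<and> n \<le> length w \<and>
      (\<forall>i\<le>length w. \<bar>log_deriv_sum f (take i w) x\<bar> \<le> B)"
  obtains \<nu> where "\<nu> \<in> borel_probs (phase_space k)" "neutrally_approximable k f \<nu>"
proof -
  let ?X = "phase_space k" and ?F = "skew_product f"
  obtain w where w: "\<And>m. set (w m) \<subseteq> {..<k}" "\<And>m. Suc m \<le> length (w m)"
    "\<And>m i. i \<le> length (w m) \<Longrightarrow> \<bar>log_deriv_sum f (take i (w m)) x\<bar> \<le> B"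
    using orbits[of "Suc _"] by metis
  define \<xi> where "\<xi> m i = (if 0 \<le> i \<and> nat i < length (w m) then w m ! nat i else 0)" for m and i :: int
  have \<xi>: "\<xi> m \<in> Sigma_seq k" for m
    using w(1)[of m] k_pos nth_mem by (fastforce simp: Sigma_seq_def \<xi>_def)
  have it: "itinerary (\<xi> m) (length (w m)) = w m" for m
    unfolding itinerary_def \<xi>_def by (rule nth_equalityI) auto
  define z where "z m = (\<xi> m, x)" for m
  have z: "z m \<in> ?X" for m using \<xi> by (simp add: z_def phase_space_def)
  have N: "0 < length (w m)" for m using w(2)[of m] by linarith
  obtain K :: "real set" and \<pi> where K: "compact K" "continuous_on K \<pi>" "\<pi> ` K = ?X"
    by (rule phase_space_coding[OF assms(1)]) (rule that; assumption)
  obtain \<nu> r where \<nu>: "\<nu> \<in> borel_probs ?X" and r: "strict_mono r"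
    and lim: "\<And>g :: (int \<Rightarrow> nat) \<times> circle \<Rightarrow> real. continuous_on ?X g \<Longrightarrow>
      (\<lambda>m. (\<Sum>i<length (w (r m)). g ((?F ^^ i) (z (r m)))) / real (length (w (r m)))) \<longlonglongrightarrow> integral\<^sup>L \<nu> g"
    by (rule empirical_measures_subsequence[OF K, of "\<lambda>m i. (?F ^^ i) (z m)" "\<lambda>m. length (w m)",
          OF funpow_in_phase_space[OF z] N])
       (rule that; assumption)
  have "neutrally_approximable k f \<nu>"
    unfolding neutrally_approximable_def
  proof (intro allI impI, elim conjE)
    fix G :: "((int \<Rightarrow> nat) \<times> circle \<Rightarrow> real) set" and e \<rho> :: real and n0 :: nat
    assume G: "finite G" "\<forall>g\<in>G. continuous_on ?X g" and e: "0 < e" and \<rho>: "0 < \<rho>"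
    let ?N = "\<lambda>m. length (w (r m))"
    have "\<forall>\<^sub>F m in sequentially. \<forall>g\<in>G.
        \<bar>(\<Sum>i<?N m. g ((?F ^^ i) (z (r m)))) / real (?N m) - integral\<^sup>L \<nu> g\<bar> < e"
    proof (rule eventually_ball_finite[OF G(1)], rule ballI)
      fix g assume "g \<in> G"
      then show "\<forall>\<^sub>F m in sequentially.
          \<bar>(\<Sum>i<?N m. g ((?F ^^ i) (z (r m)))) / real (?N m) - integral\<^sup>L \<nu> g\<bar> < e"
        using tendstoD[OF lim e] G(2) by (simp add: dist_real_def)
    qed
    moreover have "\<forall>\<^sub>F m in sequentially. max n0 (nat \<lceil>B / \<rho>\<rceil>) \<le> m" by (rule eventually_ge_at_top)
    ultimately have "\<forall>\<^sub>F m in sequentially. (\<forall>g\<in>G.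
        \<bar>(\<Sum>i<?N m. g ((?F ^^ i) (z (r m)))) / real (?N m) - integral\<^sup>L \<nu> g\<bar> < e)
        \<and> max n0 (nat \<lceil>B / \<rho>\<rceil>) \<le> m"
      by (rule eventually_conj)
    from eventually_happens'[OF sequentially_bot this] obtain m where m: "\<forall>g\<in>G. \<bar>(\<Sum>i<?N m. g ((?F ^^ i) (z (r m)))) / real (?N m) - integral\<^sup>L \<nu> g\<bar> < e"
      "n0 \<le> m" "nat \<lceil>B / \<rho>\<rceil> \<le> m"
      by auto
    have N_ge: "m \<le> ?N m" using seq_suble[OF r, of m] w(2)[of "r m"] by linarith
    then have "B / \<rho> \<le> real (?N m)" using m(3) by linarith
    then have "B \<le> \<rho> * real (?N m)" using \<rho> by (simp add: pos_divide_le_eq mult.commute)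
    moreover have "itinerary (\<xi> (r m)) i = take i (w (r m))" if "i \<le> ?N m" for i
      using take_itinerary[OF that, of "\<xi> (r m)"] it[of "r m"] by simp
    ultimately have S: "\<bar>log_deriv_sum f (itinerary (\<xi> (r m)) i) x\<bar> \<le> \<rho> * real (?N m)" if "i \<le> ?N m" for i
      using w(3)[OF that] that by (metis order_trans)
    show "\<exists>z\<in>?X. \<exists>n\<ge>n0. (\<forall>i\<le>n. \<bar>log_deriv_sum f (itinerary (fst z) i) (snd z)\<bar> \<le> \<rho> * real n) \<and>
        (\<forall>g\<in>G. \<bar>(\<Sum>i<n. g ((?F ^^ i) z)) / real n - integral\<^sup>L \<nu> g\<bar> < e)"
      using m(1,2) N_ge S z[of "r m"]
      by (intro bexI[of _ "z (r m)"] exI[of _ "?N m"]) (auto simp: z_def)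
  qed
  then show ?thesis using that \<nu> by blast
qed

end

lemma circle_length_pos_imp_two_points:
  assumes "0 < circle_length J"
  obtains a b where "a \<in> J" "b \<in> J" "a \<noteq> b"
proof -
  let ?S = "{0..<1} \<inter> circle_proj -` J"
  have "\<exists>a\<in>J. \<exists>b\<in>J. a \<noteq> b"
  proof (rule ccontr)
    assume single: "\<not> (\<exists>a\<in>J. \<exists>b\<in>J. a \<noteq> b)"
    have eq: "s = t" if "s \<in> ?S" "t \<in> ?S" for s t
    proof -
      have "circle_proj s = circle_proj t" using single that by blast
      then have "s - t \<in> \<int>" by (simp add: circle_proj_eq_iff)
      moreover have "\<bar>s - t\<bar> < 1" using that by auto
      ultimately have "s - t = 0" by (rule Ints_nonzero_abs_less1)
      then show ?thesis by simp
    qed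
    have "finite ?S"
    proof (cases "?S = {}")
      case False
      then obtain s where "s \<in> ?S" by blast
      then have "?S \<subseteq> {s}" using eq by blast
      then show ?thesis by (rule finite_subset) simp
    qed simp
    then have "emeasure lborel ?S = 0" by (intro emeasure_lborel_countable countable_finite)
    then show False using assms by (simp add: circle_length_def measure_def)
  qed
  then show ?thesis using that by blast
qed

lemma circle_ifs_diffeos:
  assumes "2 \<le> k" and "\<And>i. i < k \<Longrightarrow> circle_C1_diffeo (f i)"
  shows "circle_ifs k f (\<lambda>i. inv (f i))"
proof
  have deriv: "has_circle_deriv h (circle_deriv h x) x" if "circle_C1 h" for h x
    using that has_circle_deriv_imp unfolding circle_C1_def by metis
  show "0 < k" using assms(1) by simp
  fix i x assume i: "i < k"
  then have bij: "bij (f i)" and C1: "circle_C1 (f i)" "circle_C1 (inv (f i))"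
    using assms(2) by (auto simp: circle_C1_diffeo_def)
  show "has_circle_deriv (f i) (circle_deriv (f i) x) x" by (rule deriv[OF C1(1)])
  show "has_circle_deriv (inv (f i)) (circle_deriv (inv (f i)) x) x" by (rule deriv[OF C1(2)])
  show "inv (f i) (f i x) = x" using bij by (simp add: bij_is_inj)
  show "f i (inv (f i) x) = x" using bij by (simp add: bij_is_surj surj_f_inv_f)
  show "continuous_on UNIV (circle_deriv (f i))" "continuous_on UNIV (circle_deriv (inv (f i)))"
    using C1 by (auto simp: circle_C1_def)
qed

theorem corollary2:
  fixes k :: nat and f :: "nat \<Rightarrow> circle \<Rightarrow> circle"
  assumes "k \<ge> 2"
    and "\<And>i. i < k \<Longrightarrow> circle_C1_diffeo (f i)"
    and "transitive_on (phase_space k) (skew_product f)"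
    and "satisfies_axioms k f"
  shows "let X = phase_space k; E = ergodic_measures X (skew_product f);
      N = closed_convex_hull X {M \<in> E. fiber_exponent f M < 0};
      P = closed_convex_hull X {M \<in> E. fiber_exponent f M > 0}
    in N \<inter> P \<noteq> {} \<and> {M \<in> E. fiber_exponent f M = 0} \<subseteq> N \<inter> P"
proof -
  let ?X = "phase_space k" and ?E = "ergodic_measures (phase_space k) (skew_product f)"
  let ?g = "\<lambda>i. inv (f i)"
  let ?N = "closed_convex_hull ?X {M \<in> ?E. fiber_exponent f M < 0}"
  let ?P = "closed_convex_hull ?X {M \<in> ?E. fiber_exponent f M > 0}"
  interpret circle_ifs k f ?g by (rule circle_ifs_diffeos[OF assms(1,2)])
  obtain J where len: "0 < circle_length J"
    and cec: "CEC_plus k f J" "CEC_plus k ?g J" and acc: "Acc_plus k f J" "Acc_plus k ?g J"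
    using assms(4) unfolding satisfies_axioms_def CEC_minus_def Acc_minus_def by blast
  obtain a b where J: "a \<in> J" "b \<in> J" "a \<noteq> b"
    using circle_length_pos_imp_two_points[OF len] .
  have both: "\<nu> \<in> ?N \<inter> ?P" if "\<nu> \<in> borel_probs ?X" "neutrally_approximable k f \<nu>" for \<nu>
    using neutrally_approximable_in_closures[OF cec acc J that] closure_subset_closed_convex_hull by blast
  have "?N \<inter> ?P \<noteq> {}"
  proof -
    obtain B where B: "\<And>n. \<exists>w. set w \<subseteq> {..<k} \<and> n \<le> length w \<and>
        (\<forall>i\<le>length w. \<bar>log_deriv_sum f (take i w) a\<bar> \<le> B)"
      using bounded_sum_orbits[OF cec acc(2) J, of a] by blast
    obtain \<nu> where "\<nu> \<in> borel_probs ?X" "neutrally_approximable k f \<nu>"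
      using exists_neutrally_approximable[OF assms(1) B] .
    then show ?thesis using both by blast
  qed
  moreover have "{M \<in> ?E. fiber_exponent f M = 0} \<subseteq> ?N \<inter> ?P"
  proof
    fix M assume "M \<in> {M \<in> ?E. fiber_exponent f M = 0}"
    then have M: "M \<in> ?E" "fiber_exponent f M = 0" by auto
    show "M \<in> ?N \<inter> ?P"
    proof (rule both)
      show "M \<in> borel_probs ?X" using M(1) by (simp add: ergodic_measures_def)
      show "neutrally_approximable k f M" by (rule zero_exponent_neutrally_approximable[OF M])
    qed
  qed
  ultimately show ?thesis unfolding Let_def by blast
qed

end
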